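(* Let $S$ be an unrooted tree on $n$ nodes, and let $X=(x_1,\dots,x_m)$ be a search sequence over $V(S)$. Let $\mathrm{OPT}(X)$ denote the minimum of $\mathrm{cost}_T(X)$ over all search trees $T$ on $S$. Then for every integer $t\ge 1$ one can compute, in time $O(n^{2t+1})$, a search tree $T^*$ on $S$ with $\mathrm{cost}_{T^*}(X)\le (1+\frac{1}{t})\cdot \mathrm{OPT}(X)$.
   Context: A search tree on an unrooted tree $S$ (STT) is a rooted tree $T$ with $V(T)=V(S)$ defined recursively: the root $r$ is any node of $S$, and the subtrees of $T$ rooted at the children of $r$ are search trees on the connected components of $S\setminus r$, one for each component (the order of children is irrelevant). For $x\in V(T)$, $\mathrm{depth}_T(x)$ is the number of nodes on the path in $T$ from the root to $x$ (so the root has depth $1$). The cost of serving $X=(x_1,\dots,x_m)$ in $T$ is $\mathrm{cost}_T(X)=\sum_{i=1}^m \mathrm{depth}_T(x_i)$. *)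

theory Defs
  imports Complex_Main "HOL-Library.Landau_Symbols"
begin

section \<open>Unrooted trees\<close>

text \<open>
  A simple graph is given by a vertex set \<open>V\<close> and a set \<open>E\<close> of two-element edges.
  For a vertex set \<open>A\<close>, the relation \<open>adj E A\<close> is adjacency in the subgraph induced by \<open>A\<close>.
\<close>

definition adj :: "'a set set \<Rightarrow> 'a set \<Rightarrow> 'a rel" where
  "adj E A = {(x, y). x \<in> A \<and> y \<in> A \<and> {x, y} \<in> E}"

definition components :: "'a set set \<Rightarrow> 'a set \<Rightarrow> 'a set set" where
  "components E A = {(adj E A)\<^sup>* `` {u} | u. u \<in> A}"

definition graph_cycle :: "'a set set \<Rightarrow> 'a list \<Rightarrow> bool" where
  "graph_cycle E vs \<longleftrightarrow> length vs \<ge> 3 \<and> distinct vs \<and>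
     (\<forall>i < length vs. {vs ! i, vs ! (Suc i mod length vs)} \<in> E)"

definition unrooted_tree :: "'a set \<Rightarrow> 'a set set \<Rightarrow> bool" where
  "unrooted_tree V E \<longleftrightarrow> finite V \<and> V \<noteq> {} \<and>
     (\<forall>e \<in> E. e \<subseteq> V \<and> card e = 2) \<and>
     (\<forall>u \<in> V. \<forall>v \<in> V. (u, v) \<in> (adj E V)\<^sup>*) \<and>
     (\<nexists>vs. graph_cycle E vs)"


section \<open>Search trees on trees\<close>

text \<open>
  Children are kept in a list. Their order is immaterial: \<open>stt\<close> accepts every order, and
  neither the depth of a node nor the parent array of a tree depends on it.
\<close>

datatype 'a rtree = Node (root: 'a) (children: "'a rtree list")

text \<open>
  \<open>stt E A T\<close>: \<open>T\<close> is a search tree on the subgraph with edges \<open>E\<close> induced by the (connected)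
  set \<open>A\<close>. The distinct list \<open>Cs\<close> matches the components with the children one to one.
\<close>

inductive stt :: "'a set set \<Rightarrow> 'a set \<Rightarrow> 'a rtree \<Rightarrow> bool" for E where
  "\<lbrakk>r \<in> A; distinct Cs; set Cs = components E (A - {r}); list_all2 (stt E) Cs ts\<rbrakk>
   \<Longrightarrow> stt E A (Node r ts)"

inductive root_path :: "'a rtree \<Rightarrow> 'a list \<Rightarrow> bool" where
  "root_path (Node r ts) [r]"
| "\<lbrakk>t \<in> set ts; root_path t p\<rbrakk> \<Longrightarrow> root_path (Node r ts) (r # p)"

definition depth :: "'a rtree \<Rightarrow> 'a \<Rightarrow> nat" where
  "depth T x = length (THE p. root_path T p \<and> last p = x)"

definition cost :: "'a rtree \<Rightarrow> 'a list \<Rightarrow> nat" where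
  "cost T X = (\<Sum>x\<leftarrow>X. depth T x)"

definition opt :: "'a set \<Rightarrow> 'a set set \<Rightarrow> 'a list \<Rightarrow> nat" where
  "opt V E X = (LEAST c. \<exists>T. stt E V T \<and> c = cost T X)"


section \<open>Word RAM programs\<close>

text \<open>
  Time is counted on a word RAM with the usual unit-cost operations, programmed in a structured
  language. There are finitely many registers per program, and a memory with indirect addressing.
  Every value an execution produces, addresses included, has to lie below the word bound \<open>W\<close>;
  otherwise \<open>exec\<close> derives no execution. Subtraction is truncated at \<open>0\<close>, and a condition holds
  iff its value is nonzero (so \<open>a < b\<close> is the condition \<open>Sub b a\<close>).
\<close>

datatype exp =
    Const nat
  | Reg nat
  | Load exp
  | Add exp exp
  | Sub exp exp
  | Mul exp exp
  | Div exp exp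

datatype com =
    Skip
  | Assign nat exp
  | Store exp exp
  | Seq com com
  | Cond exp com com
  | While exp com

record state =
  reg :: "nat \<Rightarrow> nat"
  mem :: "nat \<Rightarrow> nat"

primrec eval :: "exp \<Rightarrow> state \<Rightarrow> nat" where
  "eval (Const c) s = c"
| "eval (Reg r) s = reg s r"
| "eval (Load a) s = mem s (eval a s)"
| "eval (Add a b) s = eval a s + eval b s"
| "eval (Sub a b) s = eval a s - eval b s"
| "eval (Mul a b) s = eval a s * eval b s"
| "eval (Div a b) s = eval a s div eval b s"

primrec fits :: "nat \<Rightarrow> exp \<Rightarrow> state \<Rightarrow> bool" where
  "fits W (Const c) s \<longleftrightarrow> c < W"
| "fits W (Reg r) s \<longleftrightarrow> reg s r < W"
| "fits W (Load a) s \<longleftrightarrow> fits W a s \<and> eval (Load a) s < W"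
| "fits W (Add a b) s \<longleftrightarrow> fits W a s \<and> fits W b s \<and> eval (Add a b) s < W"
| "fits W (Sub a b) s \<longleftrightarrow> fits W a s \<and> fits W b s \<and> eval (Sub a b) s < W"
| "fits W (Mul a b) s \<longleftrightarrow> fits W a s \<and> fits W b s \<and> eval (Mul a b) s < W"
| "fits W (Div a b) s \<longleftrightarrow> fits W a s \<and> fits W b s \<and> eval (Div a b) s < W"

primrec steps :: "exp \<Rightarrow> nat" where
  "steps (Const c) = 1"
| "steps (Reg r) = 1"
| "steps (Load a) = steps a + 1"
| "steps (Add a b) = steps a + steps b + 1"
| "steps (Sub a b) = steps a + steps b + 1"
| "steps (Mul a b) = steps a + steps b + 1"
| "steps (Div a b) = steps a + steps b + 1"

text \<open>
  \<open>exec W c s k s'\<close>: with word bound \<open>W\<close>, program \<open>c\<close> started in \<open>s\<close> halts in \<open>s'\<close> after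
  exactly \<open>k\<close> steps.
\<close>

inductive exec :: "nat \<Rightarrow> com \<Rightarrow> state \<Rightarrow> nat \<Rightarrow> state \<Rightarrow> bool" for W where
  Skip: "exec W Skip s 1 s"
| Assign: "fits W e s \<Longrightarrow>
    exec W (Assign r e) s (steps e + 1) (s\<lparr>reg := (reg s)(r := eval e s)\<rparr>)"
| Store: "\<lbrakk>fits W a s; fits W e s\<rbrakk> \<Longrightarrow>
    exec W (Store a e) s (steps a + steps e + 1) (s\<lparr>mem := (mem s)(eval a s := eval e s)\<rparr>)"
| Seq: "\<lbrakk>exec W c1 s k1 s'; exec W c2 s' k2 s''\<rbrakk> \<Longrightarrow> exec W (Seq c1 c2) s (k1 + k2) s''"
| CondTrue: "\<lbrakk>fits W e s; eval e s \<noteq> 0; exec W c1 s k s'\<rbrakk> \<Longrightarrow>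
    exec W (Cond e c1 c2) s (steps e + 1 + k) s'"
| CondFalse: "\<lbrakk>fits W e s; eval e s = 0; exec W c2 s k s'\<rbrakk> \<Longrightarrow>
    exec W (Cond e c1 c2) s (steps e + 1 + k) s'"
| WhileFalse: "\<lbrakk>fits W e s; eval e s = 0\<rbrakk> \<Longrightarrow> exec W (While e c) s (steps e + 1) s"
| WhileTrue: "\<lbrakk>fits W e s; eval e s \<noteq> 0; exec W c s k1 s'; exec W (While e c) s' k2 s''\<rbrakk> \<Longrightarrow>
    exec W (While e c) s (steps e + 1 + k1 + k2) s''"


section \<open>Input and output\<close>

text \<open>
  The nodes of the input tree are \<open>0, \<dots>, n - 1\<close>. The tree is presented as a list of its edges,
  each edge once, in any order and orientation.
\<close>

definition edge_list :: "nat set set \<Rightarrow> (nat \<times> nat) list \<Rightarrow> bool" where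
  "edge_list E es \<longleftrightarrow> distinct (map (\<lambda>(u, v). {u, v}) es) \<and> set (map (\<lambda>(u, v). {u, v}) es) = E"

text \<open>
  The search sequence is presented by the number of occurrences of each node: its length is not
  bounded in terms of \<open>n\<close>, so no program could read the sequence itself in time depending on
  \<open>n\<close> only. All other memory cells and all registers are initially \<open>0\<close>.
\<close>

definition input_words :: "nat \<Rightarrow> (nat \<times> nat) list \<Rightarrow> nat list \<Rightarrow> nat list" where
  "input_words n es X = n # map (count_list X) [0..<n] @ concat (map (\<lambda>(u, v). [u, v]) es)"

definition initial_state :: "nat list \<Rightarrow> state" where
  "initial_state ws =
     \<lparr>reg = (\<lambda>_. 0), mem = (\<lambda>i. if i < length ws then ws ! i else 0)\<rparr>"

text \<open>
  The word bound \<open>(n + m + 1) ^ d\<close>, where \<open>m\<close> is the length of the sequence, corresponds to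
  words of \<open>d * log 2 (n + m + 1)\<close> bits.
\<close>

definition word_bound :: "nat \<Rightarrow> nat \<Rightarrow> nat list \<Rightarrow> nat" where
  "word_bound d n X = (n + length X + 1) ^ d"

text \<open>
  The output is the parent array in cells \<open>0, \<dots>, n - 1\<close>; the root is its own parent.
\<close>

fun arcs :: "'a rtree \<Rightarrow> ('a \<times> 'a) set" where
  "arcs (Node r ts) = (\<Union>t \<in> set ts. insert (r, root t) (arcs t))"

definition parent_array :: "(nat \<Rightarrow> nat) \<Rightarrow> nat rtree \<Rightarrow> bool" where
  "parent_array a T \<longleftrightarrow> a (root T) = root T \<and> (\<forall>(p, c) \<in> arcs T. a c = p)"

end

(*
  Call the number of tree edges leaving the node set of a subtree of a search tree its boundary.
  An arbitrary search tree is turned into one with all boundaries at most 2t as follows: simulate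
  it, and whenever the boundary has grown to 2t, precede the next simulated root r by a node c that
  leaves at most t - 1 of the boundary edges on the side of r and at most t in every other part.
  The boundary is then at most t + 1 again, so one extra node is paid for by t simulated ones, and
  a depth D grows to at most D + D div t.

  An optimal search tree with boundaries at most k = 2t is found by dynamic programming over
  k-tuples of directed edges, each tuple standing for the nodes that none of its edges cuts off.
  There are O(n^k) tuples. A tuple is processed once, in the round that belongs to the size of its
  region, and O(n) steps give the costs of all roots together, since the components that remain
  when a root is removed correspond to the edges pointing to it.
*)

theory Submission
  imports Defs
begin

section \<open>Trees and their components\<close>

text \<open>The simulated tree enters only through an upper bound \<open>D\<close> on its depths. A
  simulated root may lie outside the current part, for instance because it already served as a
  splitter; the simulation then passes it over, so only inequalities between depths survive.
  Accordingly the dynamic program is compared with every such \<open>D\<close>, not with trees.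
  Tuples are not unique names of regions: redundant edges can occupy positions, and some tuples have
  disconnected regions. The table is filled for all tuples with nonempty region, but its two uses
  ask for different conditions. Optimality is claimed for tuples that list the boundary exactly
  (\<open>canonical\<close>); there a smaller region fits into \<open>k\<close> digits whenever its
  boundary has at most \<open>k\<close> edges. A tree is rebuilt from any tuple with a connected
  region and a value below the sentinel \<open>bound\<close>, since such a value involves no failed
  encoding. Tabulating the branches and reading off the tree take cubic time, which is within the
  claim because \<open>t \<ge> 1\<close>. The sequence enters through its multiplicities, and its
  length only through the word size.\<close>

lemma simple_path:
  assumes "(x, y) \<in> R\<^sup>*"
  shows "\<exists>vs. vs \<noteq> [] \<and> hd vs = x \<and> last vs = y \<and> distinct vs \<and> successively (\<lambda>a b. (a, b) \<in> R) vs"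
  using assms
proof (induction rule: converse_rtrancl_induct)
  case base
  show ?case by (rule exI[of _ "[y]"]) simp
next
  case (step x z)
  then obtain vs where vs: "vs \<noteq> []" "hd vs = z" "last vs = y" "distinct vs"
    "successively (\<lambda>a b. (a, b) \<in> R) vs" by blast
  show ?case
  proof (cases "x \<in> set vs")
    \<comment> \<open>The path returns to \<open>x\<close>, so the loop before that visit is
      dropped.\<close>
    case True
    then obtain as bs where "vs = as @ x # bs" by (meson split_list)
    then show ?thesis using vs
      by (intro exI[of _ "x # bs"]) (auto simp: successively_append_iff)
  next
    case False
    then show ?thesis using vs step(1)
      by (intro exI[of _ "x # vs"]) (auto simp: successively_Cons)
  qed
qed

lemma sym_adj: "sym (adj E A)"
  by (auto simp: adj_def sym_def insert_commute)

lemma adj_rtrancl_sym: "(x, y) \<in> (adj E A)\<^sup>* \<Longrightarrow> (y, x) \<in> (adj E A)\<^sup>*"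
  by (meson sym_adj sym_rtrancl symE)

lemma adj_mono: "E \<subseteq> F \<Longrightarrow> A \<subseteq> B \<Longrightarrow> adj E A \<subseteq> adj F B"
  by (auto simp: adj_def)

lemma adj_rtrancl_in: "(x, y) \<in> (adj E A)\<^sup>* \<Longrightarrow> x \<in> A \<Longrightarrow> y \<in> A"
  by (induction rule: rtrancl_induct) (auto simp: adj_def)

definition connected_in :: "'a set set \<Rightarrow> 'a set \<Rightarrow> bool" where
  "connected_in E A \<longleftrightarrow> (\<forall>x \<in> A. \<forall>y \<in> A. (x, y) \<in> (adj E A)\<^sup>*)"

lemma component_connected:
  assumes "C \<in> components E A"
  shows "connected_in E C" "C \<noteq> {}" "C \<subseteq> A"
proof -
  obtain u where u: "u \<in> A" "C = (adj E A)\<^sup>* `` {u}"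
    using assms by (auto simp: components_def)
  \<comment> \<open>A walk from \<open>u\<close> in \<open>A\<close> never leaves the class of
    \<open>u\<close>, so all its edges survive in the graph induced by \<open>C\<close>.\<close>
  have *: "(u, x) \<in> (adj E C)\<^sup>*" if "(u, x) \<in> (adj E A)\<^sup>*" for x
    using that
  proof (induction rule: rtrancl_induct)
    case (step y z)
    have "y \<in> C" "z \<in> C" using step u by (auto intro: rtrancl_into_rtrancl)
    then have "(y, z) \<in> adj E C" using step by (auto simp: adj_def)
    then show ?case using step by auto
  qed auto
  show "connected_in E C" unfolding connected_in_def
    using * u by (auto intro: rtrancl_trans adj_rtrancl_sym)
  show "C \<noteq> {}" "C \<subseteq> A" using u adj_rtrancl_in by fast+
qed

text \<open>Locates the component of a simulated search that contains the current part.\<close>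

lemma connected_in_component:
  assumes "connected_in E H" "H \<subseteq> A" "H \<noteq> {}"
  shows "\<exists>C \<in> components E A. H \<subseteq> C"
proof -
  obtain x where "x \<in> H" using assms by auto
  then have "(adj E A)\<^sup>* `` {x} \<in> components E A" "H \<subseteq> (adj E A)\<^sup>* `` {x}"
    using assms rtrancl_mono[OF adj_mono[OF subset_refl assms(2), of E]]
    by (auto simp: components_def connected_in_def)
  then show ?thesis by blast
qed

lemma components_Union: "\<Union> (components E A) = A"
proof
  show "\<Union> (components E A) \<subseteq> A" using component_connected(3) by blast
  show "A \<subseteq> \<Union> (components E A)" by (auto simp: components_def)
qed

section \<open>Branches of a tree, and components after the removal of a node\<close>

locale utree =
  fixes V :: "'a set" and E :: "'a set set"
  assumes tree: "unrooted_tree V E"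
begin

lemma finite_V: "finite V"
  using tree by (simp add: unrooted_tree_def)

lemma edgeD:
  assumes "{u, v} \<in> E"
  shows "u \<in> V" "v \<in> V" "u \<noteq> v"
proof -
  have "{u, v} \<subseteq> V" "card {u, v} = 2" using assms tree unfolding unrooted_tree_def by blast+
  then show "u \<in> V" "v \<in> V" "u \<noteq> v" by auto
qed

lemma connected_V: "connected_in E V"
  using tree by (simp add: unrooted_tree_def connected_in_def)

text \<open>A simple path from \<open>v\<close> to \<open>u\<close> avoiding the edge has at least
  three nodes, because \<open>u \<noteq> v\<close> and the direct step is forbidden. The edge itself
  closes it to a cycle.\<close>

lemma no_detour:
  assumes e: "{u, v} \<in> E"
  shows "(v, u) \<notin> (adj (E - {{u, v}}) V)\<^sup>*"
proof
  assume "(v, u) \<in> (adj (E - {{u, v}}) V)\<^sup>*"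
  then obtain vs where vs: "vs \<noteq> []" "hd vs = v" "last vs = u" "distinct vs"
    "successively (\<lambda>a b. (a, b) \<in> adj (E - {{u, v}}) V) vs"
    using simple_path by metis
  have nth: "{vs ! i, vs ! Suc i} \<in> E - {{u, v}}" if "Suc i < length vs" for i
    using vs(5) that by (auto simp: successively_conv_nth adj_def)
  have uv: "vs ! 0 = v" "vs ! (length vs - 1) = u"
    using vs by (auto simp: hd_conv_nth last_conv_nth)
  have "length vs \<noteq> 1" using uv edgeD[OF e] by auto
  moreover have "length vs \<noteq> 2" using uv nth[of 0] by (auto simp: insert_commute)
  moreover have "length vs \<noteq> 0" using vs by auto
  ultimately have len: "length vs \<ge> 3" by linarith
  have "{vs ! i, vs ! (Suc i mod length vs)} \<in> E" if "i < length vs" for i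
  proof (cases "Suc i < length vs")
    case True
    then show ?thesis using nth by auto
  next
    case False
    then have "Suc i = length vs" using that by auto
    then have "Suc i mod length vs = 0" "i = length vs - 1" by auto
    then show ?thesis using uv e by simp
  qed
  then have "graph_cycle E vs" using len vs(4) by (auto simp: graph_cycle_def)
  then show False using tree by (auto simp: unrooted_tree_def)
qed

text \<open>For an edge \<open>{u, v}\<close> this is the side of \<open>v\<close>. Deleting the
  node \<open>u\<close> instead of the edge gives the same set and matches the components used by
  \<open>stt\<close>.\<close>

definition branch :: "'a \<Rightarrow> 'a \<Rightarrow> 'a set" where
  "branch u v = (adj E (V - {u}))\<^sup>* `` {v}"

lemma branch_root: "v \<in> branch u v"
  by (auto simp: branch_def)

lemma branch_subset: "{u, v} \<in> E \<Longrightarrow> branch u v \<subseteq> V - {u}"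
  using edgeD[of u v] adj_rtrancl_in unfolding branch_def by fast

lemma branch_step: "x \<in> branch u v \<Longrightarrow> {x, y} \<in> E \<Longrightarrow> x \<noteq> u \<Longrightarrow> y \<noteq> u \<Longrightarrow> y \<in> branch u v"
  unfolding branch_def using edgeD[of x y]
  by (auto intro: rtrancl_into_rtrancl simp: adj_def)

lemma adj_delete: "u \<in> e \<Longrightarrow> (adj E (V - {u}))\<^sup>* \<subseteq> (adj (E - {e}) V)\<^sup>*"
  by (rule rtrancl_mono) (auto simp: adj_def)

lemma branch_disjoint:
  assumes "{u, v} \<in> E"
  shows "branch u v \<inter> branch v u = {}"
proof -
  have False if "x \<in> branch u v" "x \<in> branch v u" for x
  proof -
    have "(v, x) \<in> (adj (E - {{u, v}}) V)\<^sup>*" "(u, x) \<in> (adj (E - {{u, v}}) V)\<^sup>*"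
      using that adj_delete[of u "{u, v}"] adj_delete[of v "{u, v}"] by (auto simp: branch_def)
    then show False using no_detour[OF assms] by (meson adj_rtrancl_sym rtrancl_trans)
  qed
  then show ?thesis by blast
qed

lemma branch_Un:
  assumes e: "{u, v} \<in> E"
  shows "branch u v \<union> branch v u = V"
proof -
  \<comment> \<open>Along a walk from \<open>u\<close>, sides can change only on arrival at
    \<open>u\<close> or \<open>v\<close>, and each of these lies in its own branch.\<close>
  have "x \<in> branch u v \<union> branch v u" if "(u, x) \<in> (adj E V)\<^sup>*" for x
    using that
  proof (induction rule: rtrancl_induct)
    case base
    show ?case by (simp add: branch_root)
  next
    case (step y z)
    then have yz: "{y, z} \<in> E" by (auto simp: adj_def)
    consider "z = u" | "z = v" | "z \<noteq> u" "z \<noteq> v" by blast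
    then show ?case
    proof cases
      case 3
      have "u \<notin> branch u v" "v \<notin> branch v u"
        using e branch_subset[of u v] branch_subset[of v u] by (auto simp: insert_commute)
      then show ?thesis using step(3) branch_step[OF _ yz, of u v] branch_step[OF _ yz, of v u] 3 by auto
    qed (auto simp: branch_root)
  qed
  moreover have "branch u v \<union> branch v u \<subseteq> V"
    using branch_subset[OF e] branch_subset[of v u] e by (auto simp: insert_commute)
  ultimately show ?thesis using connected_V edgeD[OF e] by (auto simp: connected_in_def)
qed

lemma branch_compl:
  assumes "{u, v} \<in> E"
  shows "branch v u = V - branch u v"
  using branch_disjoint[OF assms] branch_Un[OF assms] by auto

text \<open>A path from \<open>v\<close> to \<open>v'\<close> that avoids \<open>r\<close>, followed
  by the edge from \<open>v'\<close> to \<open>r\<close>, would be a detour around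
  \<open>{r, v}\<close>.\<close>

lemma branch_neighbour:
  assumes "{r, v} \<in> E" "{r, v'} \<in> E" "v' \<in> branch r v"
  shows "v' = v"
proof (rule ccontr)
  assume ne: "v' \<noteq> v"
  have "(v, v') \<in> (adj (E - {{r, v}}) V)\<^sup>*"
    using assms(3) adj_delete[of r "{r, v}"] by (auto simp: branch_def)
  moreover have "(v', r) \<in> adj (E - {{r, v}}) V"
    using assms(2) edgeD[OF assms(2)] ne by (auto simp: adj_def insert_commute doubleton_eq_iff)
  ultimately have "(v, r) \<in> (adj (E - {{r, v}}) V)\<^sup>*" by auto
  then show False using no_detour[OF assms(1)] by auto
qed

lemma branch_disjoint_siblings:
  assumes "{r, v} \<in> E" "{r, v'} \<in> E" "v' \<noteq> v"
  shows "branch r v \<inter> branch r v' = {}"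
proof -
  have False if "x \<in> branch r v" "x \<in> branch r v'" for x
  proof -
    have "v' \<in> branch r v" using that unfolding branch_def
      by (auto intro: rtrancl_trans adj_rtrancl_sym)
    then show False using branch_neighbour assms by blast
  qed
  then show ?thesis by blast
qed

text \<open>The walk is stopped at its first arrival at \<open>r\<close>; \<open>v\<close> is the
  node just before.\<close>

lemma path_last_step:
  assumes A: "A \<subseteq> V" and p: "(x, r) \<in> (adj E A)\<^sup>*" and x: "x \<in> A" "x \<noteq> r"
  shows "\<exists>v \<in> A. {r, v} \<in> E \<and> (x, v) \<in> (adj E (A - {r}))\<^sup>*"
  using p x
proof (induction rule: converse_rtrancl_induct)
  case base
  then show ?case by simp
next
  case (step x z)
  show ?case
  proof (cases "z = r")
    case True
    then show ?thesis using step by (intro bexI[of _ x]) (auto simp: adj_def insert_commute)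
  next
    case False
    then have "(x, z) \<in> adj E (A - {r})" using step by (auto simp: adj_def)
    moreover have "z \<in> A" using step by (auto simp: adj_def)
    ultimately show ?thesis using step.IH False by (meson converse_rtrancl_into_rtrancl)
  qed
qed

lemma component_branch:
  assumes A: "connected_in E A" "A \<subseteq> V" "r \<in> A" and v: "v \<in> A" "{r, v} \<in> E"
  shows "(adj E (A - {r}))\<^sup>* `` {v} = A \<inter> branch r v"
proof
  show "(adj E (A - {r}))\<^sup>* `` {v} \<subseteq> A \<inter> branch r v"
  proof
    fix x assume "x \<in> (adj E (A - {r}))\<^sup>* `` {v}"
    then have p: "(v, x) \<in> (adj E (A - {r}))\<^sup>*" by simp
    have "x \<in> A - {r}" using adj_rtrancl_in[OF p] v edgeD[OF v(2)] by auto
    moreover have "(v, x) \<in> (adj E (V - {r}))\<^sup>*"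
      using p rtrancl_mono[OF adj_mono[of E E "A - {r}" "V - {r}"]] A(2) by auto
    ultimately show "x \<in> A \<inter> branch r v" by (auto simp: branch_def)
  qed
next
  show "A \<inter> branch r v \<subseteq> (adj E (A - {r}))\<^sup>* `` {v}"
  proof
    fix x assume x: "x \<in> A \<inter> branch r v"
    then have "x \<noteq> r" using branch_subset[OF v(2)] by auto
    then obtain v' where v': "v' \<in> A" "{r, v'} \<in> E" "(x, v') \<in> (adj E (A - {r}))\<^sup>*"
      using path_last_step[OF A(2), of x r] A x by (auto simp: connected_in_def)
    have "(x, v') \<in> (adj E (V - {r}))\<^sup>*"
      using v'(3) rtrancl_mono[OF adj_mono[of E E "A - {r}" "V - {r}"]] A(2) by auto
    then have "v' \<in> branch r v" using x unfolding branch_def by (auto intro: rtrancl_trans)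
    then have "v' = v" using branch_neighbour v v' by blast
    then show "x \<in> (adj E (A - {r}))\<^sup>* `` {v}" using v' adj_rtrancl_sym by fast
  qed
qed

text \<open>Replaces reachability inside \<open>A\<close> by branches of the whole tree, one for
  each neighbour of \<open>r\<close> in \<open>A\<close>. Branches do not depend on
  \<open>A\<close>, so they can be tabulated once.\<close>

lemma components_remove:
  assumes A: "connected_in E A" "A \<subseteq> V" "r \<in> A"
  shows "components E (A - {r}) = (\<lambda>v. A \<inter> branch r v) ` {v \<in> A. {r, v} \<in> E}"
proof
  show "components E (A - {r}) \<subseteq> (\<lambda>v. A \<inter> branch r v) ` {v \<in> A. {r, v} \<in> E}"
  proof
    fix C assume "C \<in> components E (A - {r})"
    then obtain x where x: "x \<in> A" "x \<noteq> r" "C = (adj E (A - {r}))\<^sup>* `` {x}"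
      by (auto simp: components_def)
    then obtain v where v: "v \<in> A" "{r, v} \<in> E" "(x, v) \<in> (adj E (A - {r}))\<^sup>*"
      using path_last_step[OF A(2), of x r] A by (auto simp: connected_in_def)
    have "C = (adj E (A - {r}))\<^sup>* `` {v}"
      using x v(3) by (auto intro: rtrancl_trans adj_rtrancl_sym)
    then show "C \<in> (\<lambda>v. A \<inter> branch r v) ` {v \<in> A. {r, v} \<in> E}"
      using component_branch[OF A v(1,2)] v by auto
  qed
next
  show "(\<lambda>v. A \<inter> branch r v) ` {v \<in> A. {r, v} \<in> E} \<subseteq> components E (A - {r})"
  proof clarify
    fix v assume v: "v \<in> A" "{r, v} \<in> E"
    then show "A \<inter> branch r v \<in> components E (A - {r})"
      using component_branch[OF A v] edgeD[OF v(2)] by (auto simp: components_def)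
  qed
qed

definition edge_pairs :: "('a \<times> 'a) set" where
  "edge_pairs = {(u, v). {u, v} \<in> E}"

lemma finite_edge_pairs: "finite edge_pairs"
  by (rule finite_subset[of _ "V \<times> V"]) (use edgeD finite_V in \<open>auto simp: edge_pairs_def\<close>)

lemma branch_towards:
  assumes "x \<in> V" "y \<in> V" "x \<noteq> y"
  shows "\<exists>v. {x, v} \<in> E \<and> y \<in> branch x v"
proof -
  have "y \<in> \<Union> (components E (V - {x}))" using assms by (simp add: components_Union)
  then show ?thesis using components_remove[OF connected_V subset_refl assms(1)] by auto
qed

text \<open>With the tree rooted at \<open>z\<close>, every other node owns the edge that leads
  towards \<open>z\<close>. The count gives the number \<open>2 * n - 2\<close> of directed edges
  and hence the base \<open>M\<close> of the codes.\<close>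

lemma card_E: "card E = card V - 1"
proof -
  obtain z where z: "z \<in> V" using tree by (auto simp: unrooted_tree_def)
  define f where "f x = (SOME v. {x, v} \<in> E \<and> z \<in> branch x v)" for x
  have f: "{x, f x} \<in> E" "z \<in> branch x (f x)" if "x \<in> V - {z}" for x
    using someI_ex[OF branch_towards[of x z]] that z by (auto simp: f_def)
  have "bij_betw (\<lambda>x. {x, f x}) (V - {z}) E"
    unfolding bij_betw_def
  proof
    show "inj_on (\<lambda>x. {x, f x}) (V - {z})"
    proof (rule inj_onI)
      fix x y assume xy: "x \<in> V - {z}" "y \<in> V - {z}" "{x, f x} = {y, f y}"
      show "x = y"
      proof (rule ccontr)
        assume "x \<noteq> y"
        then have "f x = y" "f y = x" using xy(3) by (auto simp: doubleton_eq_iff)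
        then show False using f[OF xy(1)] f[OF xy(2)] branch_disjoint[of x y] by auto
      qed
    qed
    show "(\<lambda>x. {x, f x}) ` (V - {z}) = E"
    proof
      show "E \<subseteq> (\<lambda>x. {x, f x}) ` (V - {z})"
      proof
        fix e assume e: "e \<in> E"
        then have "card e = 2" using tree by (auto simp: unrooted_tree_def)
        then obtain u v where uv: "e = {u, v}" by (auto simp: card_2_iff)
        \<comment> \<open>Each edge can be oriented such that \<open>z\<close> lies on the side of
          \<open>b\<close>; it is then the edge owned by \<open>a\<close>.\<close>
        have *: "{a, b} \<in> (\<lambda>x. {x, f x}) ` (V - {z})" if ab: "{a, b} \<in> E" "z \<in> branch a b" for a b
        proof -
          have a: "a \<in> V - {z}" using branch_subset[OF ab(1)] ab edgeD[OF ab(1)] by auto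
          have "f a = b"
            using branch_disjoint_siblings[OF ab(1) f(1)[OF a]] f(2)[OF a] ab(2) by auto
          then show ?thesis using a by auto
        qed
        show "e \<in> (\<lambda>x. {x, f x}) ` (V - {z})"
          using branch_Un[of u v] z uv e *[of u v] *[of v u] by (auto simp: insert_commute)
      qed
    qed (use f in auto)
  qed
  then show ?thesis using bij_betw_same_card[of _ "V - {z}" E] z finite_V by (auto simp: card_Diff_singleton)
qed

end

section \<open>Searching with few boundary edges\<close>

context utree
begin

text \<open>Edges are directed from inside to outside, so that \<open>fst\<close> tells which part
  inherits an edge when \<open>A\<close> is split.\<close>

definition boundary :: "'a set \<Rightarrow> ('a \<times> 'a) set" where
  "boundary A = {(u, v). u \<in> A \<and> v \<notin> A \<and> {u, v} \<in> E}"

lemma boundary_edge_pairs: "boundary A \<subseteq> edge_pairs"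
  by (auto simp: boundary_def edge_pairs_def)

lemma finite_boundary [simp]: "finite (boundary A)"
  using finite_subset[OF boundary_edge_pairs finite_edge_pairs] .

lemma boundary_V: "boundary V = {}"
  using edgeD by (auto simp: boundary_def)

text \<open>The edge from \<open>v\<close> back to \<open>r\<close> is the only new one: any other
  step from the part to a node of \<open>A\<close> stays in the branch.\<close>

lemma boundary_branch_subset:
  assumes A: "connected_in E A" "A \<subseteq> V" "r \<in> A" and v: "v \<in> A" "{r, v} \<in> E"
  shows "boundary (A \<inter> branch r v) \<subseteq> insert (v, r) {p \<in> boundary A. fst p \<in> branch r v}"
proof clarify
  fix a b assume ab: "(a, b) \<in> boundary (A \<inter> branch r v)" "\<not> (a = v \<and> b = r)"
  then have a: "a \<in> A" "a \<in> branch r v" and b: "b \<notin> A \<inter> branch r v" and e: "{a, b} \<in> E"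
    by (auto simp: boundary_def)
  have ar: "a \<noteq> r" using a(2) branch_subset[OF v(2)] by auto
  have "b \<notin> A"
  proof
    assume bA: "b \<in> A"
    show False
    proof (cases "b = r")
      case True
      then have "a = v" using branch_neighbour[OF v(2), of a] e a by (simp add: insert_commute)
      then show False using ab True by simp
    next
      case False
      then show False using branch_step[OF a(2) e ar] bA b by auto
    qed
  qed
  then show "(a, b) \<in> boundary A \<and> fst (a, b) \<in> branch r v"
    using a e by (auto simp: boundary_def)
qed

lemma card_boundary_branch:
  assumes "connected_in E A" "A \<subseteq> V" "r \<in> A" "v \<in> A" "{r, v} \<in> E"
  shows "card (boundary (A \<inter> branch r v)) \<le> Suc (card {p \<in> boundary A. fst p \<in> branch r v})"
proof -
  let ?P = "{p \<in> boundary A. fst p \<in> branch r v}"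
  have "card (boundary (A \<inter> branch r v)) \<le> card (insert (v, r) ?P)"
    by (rule card_mono[OF _ boundary_branch_subset[OF assms]]) simp
  also have "\<dots> \<le> Suc (card ?P)" by (simp add: card_insert_if)
  finally show ?thesis .
qed

lemma card_boundary_branch':
  assumes "connected_in E A" "A \<subseteq> V" "r \<in> A" "v \<in> A" "{r, v} \<in> E"
  shows "card (boundary (A \<inter> branch r v)) \<le> Suc (card (boundary A))"
  by (rule order_trans[OF card_boundary_branch[OF assms]]) (auto intro: card_mono)

text \<open>
  \<open>searchable k A D\<close> says that some search tree on \<open>A\<close> has depth at most \<open>D x\<close> at every \<open>x\<close>, and
  the node set of each of its subtrees has at most \<open>k\<close> boundary edges. Truncated subtraction
  is harmless, since every root needs \<open>D r \<ge> 1\<close>.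
\<close>

inductive searchable :: "nat \<Rightarrow> 'a set \<Rightarrow> ('a \<Rightarrow> nat) \<Rightarrow> bool" for k where
  "\<lbrakk>r \<in> A; card (boundary A) \<le> k; D r \<ge> 1;
    \<And>C. C \<in> components E (A - {r}) \<Longrightarrow> searchable k C (\<lambda>x. D x - 1)\<rbrakk>
   \<Longrightarrow> searchable k A D"

lemma searchable_mono:
  assumes "searchable k A D" "\<And>x. x \<in> A \<Longrightarrow> D x \<le> D' x"
  shows "searchable k A D'"
  using assms
proof (induction arbitrary: D' rule: searchable.induct)
  case (1 r A D)
  show ?case
  proof (rule searchable.intros[of r])
    fix C assume C: "C \<in> components E (A - {r})"
    show "searchable k C (\<lambda>x. D' x - 1)"
      by (rule 1(5)[OF C]) (use component_connected(3)[OF C] 1(6) in \<open>auto intro: diff_le_mono\<close>)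
  qed (use 1 in \<open>auto intro: order_trans\<close>)
qed

lemma searchable_ge_1:
  assumes "searchable k A D" "x \<in> A"
  shows "D x \<ge> 1"
  using assms
proof (induction rule: searchable.induct)
  case (1 r A D)
  show ?case
  proof (cases "x = r")
    case False
    then obtain C where "C \<in> components E (A - {r})" "x \<in> C"
      using components_Union[of E "A - {r}"] 1 by blast
    then show ?thesis using 1(5) by fastforce
  qed (use 1 in simp)
qed

text \<open>
  The splitter is reached from \<open>r\<close> by descending as long as the part cut off from \<open>r\<close> keeps
  more than \<open>t\<close> boundary edges; what remains on the side of \<open>r\<close> has at most \<open>t - 1\<close> of them.
\<close>

lemma boundary_splitter:
  assumes H: "connected_in E H" "H \<subseteq> V" "r \<in> H" and bd: "card (boundary H) \<le> 2 * t" and t: "t \<ge> 1"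
  obtains c where "c \<in> H"
    "\<And>v. v \<in> H \<Longrightarrow> {c, v} \<in> E \<Longrightarrow>
      card (boundary (H \<inter> branch c v)) \<le> (if r \<in> branch c v then t else t + 1)"
proof -
  define m where "m u v = card {p \<in> boundary H. fst p \<in> branch u v}" for u v
  \<comment> \<open>These are the edges inside \<open>H\<close> that point away from
    \<open>r\<close> and have more than \<open>t\<close> boundary edges beyond them. If there is
    none, \<open>r\<close> itself is the splitter.\<close>
  define P where "P = (\<lambda>(u, v). u \<in> H \<and> v \<in> H \<and> {u, v} \<in> E \<and> r \<notin> branch u v \<and> m u v \<ge> t + 1)"
  show thesis
  proof (cases "\<exists>p. P p")
    case False
    show thesis
    proof (rule that[OF H(3)])
      fix v assume v: "v \<in> H" "{r, v} \<in> E"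
      have r: "r \<notin> branch r v" using branch_subset[OF v(2)] by auto
      moreover have "\<not> P (r, v)" using False by blast
      ultimately have "m r v \<le> t" using v H(3) by (auto simp: P_def)
      then show "card (boundary (H \<inter> branch r v)) \<le> (if r \<in> branch r v then t else t + 1)"
        using card_boundary_branch[OF H v] r by (auto simp: m_def)
    qed
  next
    case True
    \<comment> \<open>A smallest such branch replaces the descent: every branch at \<open>c\<close>
      that continues away from \<open>r\<close> is smaller, hence carries at most \<open>t\<close>
      boundary edges.\<close>
    then obtain p where "P p" "\<And>q. P q \<Longrightarrow> card (branch (fst p) (snd p)) \<le> card (branch (fst q) (snd q))"
      using ex_has_least_nat[of P _ "\<lambda>q. card (branch (fst q) (snd q))"] by blast
    then obtain u c where P: "P (u, c)"
      and least: "\<And>q. P q \<Longrightarrow> card (branch u c) \<le> card (branch (fst q) (snd q))"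
      by (cases p) auto
    have uc: "u \<in> H" "c \<in> H" "{u, c} \<in> E" "{c, u} \<in> E" "r \<notin> branch u c" "m u c \<ge> t + 1"
      using P by (auto simp: P_def insert_commute)
    show thesis
    proof (rule that[OF uc(2)])
      fix v assume v: "v \<in> H" "{c, v} \<in> E"
      show "card (boundary (H \<inter> branch c v)) \<le> (if r \<in> branch c v then t else t + 1)"
      proof (cases "v = u")
        case True
        have "fst p \<in> V" if "p \<in> boundary H" for p
          using that H(2) by (auto simp: boundary_def)
        then have "m u c + m c u = card (boundary H)"
          unfolding m_def using branch_Un[OF uc(3)] branch_disjoint[OF uc(3)]
          by (subst card_Un_disjoint[symmetric]) (auto intro!: arg_cong[of _ _ card])
        \<comment> \<open>At least \<open>t + 1\<close> of the at most \<open>2 * t\<close> edges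
          lie beyond \<open>c\<close>. The cut adds one edge to the rest, which gives
          \<open>t\<close> on the side of \<open>r\<close>.\<close>
        then have "m c u \<le> t - 1" using bd uc(6) by linarith
        then have "card (boundary (H \<inter> branch c v)) \<le> t"
          using card_boundary_branch[OF H(1,2) uc(2) v] True t by (auto simp: m_def)
        then show ?thesis by auto
      next
        case False
        have "branch c v \<inter> branch c u = {}"
          using branch_disjoint_siblings[OF v(2) uc(4)] False by auto
        then have sub: "branch c v \<subseteq> branch u c"
          using branch_compl[OF uc(3)] branch_subset[OF v(2)] by auto
        moreover have "c \<in> branch u c" "c \<notin> branch c v"
          using branch_root branch_subset[OF v(2)] by auto
        ultimately have "branch c v \<subset> branch u c" by auto
        moreover have "finite (branch u c)"
          using branch_subset[OF uc(3)] finite_V by (meson finite_Diff finite_subset)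
        ultimately have "card (branch c v) < card (branch u c)" by (simp add: psubset_card_mono)
        then have "\<not> P (c, v)" using least[of "(c, v)"] by auto
        moreover have r: "r \<notin> branch c v" using sub uc(5) by auto
        ultimately have "m c v \<le> t" using v uc(2) by (simp add: P_def)
        then show ?thesis using card_boundary_branch[OF H(1,2) uc(2) v] r by (auto simp: m_def)
      qed
    qed
  qed
qed

lemma component_ofE:
  assumes "connected_in E A" "A \<subseteq> V" "r \<in> A" "C \<in> components E (A - {r})"
  obtains v where "v \<in> A" "{r, v} \<in> E" "C = A \<inter> branch r v"
  using components_remove[OF assms(1-3)] assms(4) by auto

text \<open>
  The potential \<open>j\<close> counts the steps of the given search since the last inserted splitter. After
  \<open>t - 1\<close> of them the boundary may have \<open>2 * t\<close> edges, and the next step is preceded by a splitter.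
\<close>

lemma searchable_cut:
  assumes "searchable k A D" "H \<subseteq> A" "A \<subseteq> V" "connected_in E H" "H \<noteq> {}"
    and "card (boundary H) \<le> t + 1 + j" "j < t"
  shows "searchable (2 * t) H (\<lambda>x. D x + (D x + j) div t)"
  using assms
proof (induction arbitrary: H j rule: searchable.induct)
  case (1 r A D)
  note IH = 1(5)
  have HV: "H \<subseteq> V" using 1 by auto
  have t: "t \<ge> 1" using 1 by auto
  have ge1: "D x \<ge> 1" if "x \<in> A" for x
    using searchable_ge_1[OF searchable.intros[OF 1(1-4)]] that by auto
  \<comment> \<open>A connected part without \<open>r\<close> lies in a single component of
    \<open>A - {r}\<close>, where the simulation continues with \<open>D\<close> lowered by
    one.\<close>
  have sub: "searchable (2 * t) C (\<lambda>x. (D x - 1) + (D x - 1 + j') div t)"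
    if C: "C \<subseteq> A - {r}" "connected_in E C" "C \<noteq> {}" "card (boundary C) \<le> t + 1 + j'" "j' < t" for C j'
  proof -
    obtain C' where "C' \<in> components E (A - {r})" "C \<subseteq> C'"
      using connected_in_component[OF C(2,1,3)] by blast
    then show ?thesis using IH[of C' C j'] component_connected(3)[of C' E "A - {r}"] C
      using \<open>A \<subseteq> V\<close> by auto
  qed
  show ?case
  proof (cases "r \<in> H")
    \<comment> \<open>The simulated root lies elsewhere: no node is spent, while \<open>D\<close>
      drops by one.\<close>
    case False
    show ?thesis
      by (rule searchable_mono[OF sub[of H j]])
         (use False 1 in \<open>auto intro!: add_mono div_le_mono\<close>)
  next
    case r: True
    note H = 1(8) HV r
    have cmp: "C \<noteq> {}" "connected_in E C" "C \<subseteq> H" "c \<notin> C"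
      if "C \<in> components E (H - {c})" for C c
      using component_connected[OF that] by auto
    show ?thesis
    proof (cases "Suc j < t")
      case True
      \<comment> \<open>The simulated root is copied. The boundary may grow by one and the potential
        does too; since \<open>D x - 1 + Suc j = D x + j\<close>, the quotient is unchanged and the
        depth drops by exactly one.\<close>
      show ?thesis
      proof (rule searchable.intros[OF r])
        show "card (boundary H) \<le> 2 * t" using 1 by linarith
        show "D r + (D r + j) div t \<ge> 1" using ge1[OF 1(1)] by auto
        fix C assume C: "C \<in> components E (H - {r})"
        then obtain v where v: "v \<in> H" "{r, v} \<in> E" "C = H \<inter> branch r v"
          using component_ofE[OF H] by blast
        have "searchable (2 * t) C (\<lambda>x. (D x - 1) + (D x - 1 + Suc j) div t)"
          by (rule sub) (use cmp[OF C] 1 True card_boundary_branch'[OF H v(1,2)] v(3) in auto)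
        then show "searchable (2 * t) C (\<lambda>x. D x + (D x + j) div t - 1)"
        proof (rule searchable_mono)
          fix x assume "x \<in> C"
          then have "D x \<ge> 1" using ge1 cmp[OF C] 1 by auto
          then show "D x - 1 + (D x - 1 + Suc j) div t \<le> D x + (D x + j) div t - 1" by simp
        qed
      qed
    next
      case False
      then have j: "j = t - 1" using 1 by auto
      have bd: "card (boundary H) \<le> 2 * t" using 1 j t by auto
      obtain c where c: "c \<in> H" "\<And>v. v \<in> H \<Longrightarrow> {c, v} \<in> E \<Longrightarrow>
          card (boundary (H \<inter> branch c v)) \<le> (if r \<in> branch c v then t else t + 1)"
        using boundary_splitter[OF H bd t] by blast
      \<comment> \<open>For \<open>j = t - 1\<close> the quotient exceeds
        \<open>(D x - 1) div t\<close> by one. This surplus pays for the splitter, and the potential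
        restarts at \<open>0\<close>.\<close>
      have aux: "D x + (D x + j) div t = D x + 1 + (D x - 1) div t" if "x \<in> A" for x
      proof -
        have "D x + j = (D x - 1) + t" using ge1[OF that] j t by auto
        then show ?thesis using t by simp
      qed
      show ?thesis
      proof (rule searchable.intros[OF c(1) bd])
        show "D c + (D c + j) div t \<ge> 1" using ge1[of c] c(1) 1 by auto
        fix K assume K: "K \<in> components E (H - {c})"
        then obtain v where v: "v \<in> H" "{c, v} \<in> E" "K = H \<inter> branch c v"
          using component_ofE[OF H(1,2) c(1)] by blast
        show "searchable (2 * t) K (\<lambda>x. D x + (D x + j) div t - 1)"
        proof (cases "r \<in> K")
          case False
          have "searchable (2 * t) K (\<lambda>x. (D x - 1) + (D x - 1 + 0) div t)"
            by (rule sub) (use cmp[OF K] 1 False c(2)[OF v(1,2)] v(3) r t in \<open>auto split: if_splits\<close>)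
          then show ?thesis
            by (rule searchable_mono) (use aux cmp[OF K] 1 in auto)
        next
          case True
          note K' = cmp(2)[OF K] subset_trans[OF cmp(3)[OF K] HV] True
          \<comment> \<open>On the side of \<open>r\<close> the splitter guarantees \<open>t\<close>
            rather than \<open>t + 1\<close>, because \<open>r\<close> is used as the next root at
            once and may add another edge.\<close>
          have bdK: "card (boundary K) \<le> t" using c(2)[OF v(1,2)] True v(3) by auto
          show ?thesis
          proof (rule searchable.intros[OF True])
            show "card (boundary K) \<le> 2 * t" using bdK by auto
            show "D r + (D r + j) div t - 1 \<ge> 1" using aux[OF 1(1)] ge1[OF 1(1)] by auto
            fix C assume C: "C \<in> components E (K - {r})"
            note C' = component_connected[OF C]
            obtain w where w: "w \<in> K" "{r, w} \<in> E" "C = K \<inter> branch r w"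
              using component_ofE[OF K' C] by blast
            have "searchable (2 * t) C (\<lambda>x. (D x - 1) + (D x - 1 + 0) div t)"
              by (rule sub)
                 (use C' cmp[OF K] 1 bdK card_boundary_branch'[OF K' w(1,2)] w(3) t in auto)
            then show "searchable (2 * t) C (\<lambda>x. D x + (D x + j) div t - 1 - 1)"
            proof (rule searchable_mono)
              fix x assume "x \<in> C"
              then have "x \<in> A" using C'(3) cmp(3)[OF K] 1(6) by auto
              then show "D x - 1 + (D x - 1 + 0) div t \<le> D x + (D x + j) div t - 1 - 1"
                using aux[of x] ge1[of x] by simp
            qed
          qed
        qed
      qed
    qed
  qed
qed

end

section \<open>Depth in search trees\<close>

lemma components_disjoint:
  assumes "C \<in> components E A" "C' \<in> components E A" "x \<in> C" "x \<in> C'"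
  shows "C = C'"
proof -
  have *: "K = (adj E A)\<^sup>* `` {x}" if "K \<in> components E A" "x \<in> K" for K
    using that by (auto simp: components_def intro: rtrancl_trans adj_rtrancl_sym)
  show ?thesis using *[OF assms(1,3)] *[OF assms(2,4)] by simp
qed

lemma list_all2_ex: "list_all2 P xs ys \<Longrightarrow> x \<in> set xs \<Longrightarrow> \<exists>y \<in> set ys. P x y"
  by (induction rule: list_all2_induct) auto

lemma root_path_Node:
  "root_path (Node r ts) p \<longleftrightarrow> p = [r] \<or> (\<exists>t \<in> set ts. \<exists>q. p = r # q \<and> root_path t q)"
  by (auto elim: root_path.cases intro: root_path.intros)

lemma root_path_nonempty: "root_path T p \<Longrightarrow> p \<noteq> []"
  by (auto elim: root_path.cases)

text \<open>Justifies the \<open>THE\<close> in \<open>depth\<close>: components of siblings are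
  disjoint and omit the root, so the last node of a path determines which child it enters.\<close>

lemma stt_paths:
  "stt E A T \<Longrightarrow> (\<forall>p. root_path T p \<longrightarrow> last p \<in> A) \<and> (\<forall>x \<in> A. \<exists>!p. root_path T p \<and> last p = x)"
proof (induction rule: stt.induct)
  case (1 r A Cs ts)
  have len: "length ts = length Cs" using 1(4) by (simp add: list_all2_lengthD)
  have last: "last p \<in> Cs ! i" if "i < length Cs" "root_path (ts ! i) p" for i p
    using 1(4) that by (auto simp: list_all2_conv_all_nth)
  have ex: "\<exists>!p. root_path (ts ! i) p \<and> last p = x" if "i < length Cs" "x \<in> Cs ! i" for i x
    using 1(4) that by (auto simp: list_all2_conv_all_nth)
  have sub: "Cs ! i \<subseteq> A - {r}" if "i < length Cs" for i
    using component_connected(3)[of "Cs ! i" E "A - {r}"] 1(3) nth_mem[OF that] by auto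
  have same: "i = j" if "i < length Cs" "j < length Cs" "x \<in> Cs ! i" "x \<in> Cs ! j" for i j x
    using components_disjoint[of "Cs ! i" E "A - {r}" "Cs ! j" x] that 1(2,3) nth_mem
    by (metis nth_eq_iff_index_eq)
  have path: "root_path (Node r ts) p \<longleftrightarrow>
      p = [r] \<or> (\<exists>i < length Cs. \<exists>q. p = r # q \<and> root_path (ts ! i) q)" for p
  proof -
    have "(\<exists>t \<in> set ts. P t) \<longleftrightarrow> (\<exists>i < length Cs. P (ts ! i))" for P
      using len by (metis in_set_conv_nth)
    from this[of "\<lambda>t. \<exists>q. p = r # q \<and> root_path t q"] show ?thesis
      unfolding root_path_Node by simp
  qed
  have "last p \<in> A" if "root_path (Node r ts) p" for p
  proof (cases "p = [r]")
    case False
    with iffD1[OF path that] obtain i q where "i < length Cs" "p = r # q" "root_path (ts ! i) q"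
      by blast
    then show ?thesis using last[of i q] sub[of i] root_path_nonempty[of "ts ! i" q] by auto
  qed (use 1(1) in simp)
  moreover have "\<exists>!p. root_path (Node r ts) p \<and> last p = x" if x: "x \<in> A" for x
  proof (cases "x = r")
    case True
    show ?thesis
    proof (rule ex1I[of _ "[r]"])
      fix p assume p: "root_path (Node r ts) p \<and> last p = x"
      show "p = [r]"
      proof (rule ccontr)
        assume "p \<noteq> [r]"
        with iffD1[OF path conjunct1[OF p]] obtain i q
          where "i < length Cs" "p = r # q" "root_path (ts ! i) q" by blast
        then show False using last[of i q] sub[of i] p True root_path_nonempty[of "ts ! i" q] by auto
      qed
    qed (use True in \<open>auto simp: path\<close>)
  next
    case False
    then obtain i where i: "i < length Cs" "x \<in> Cs ! i"
      using x components_Union[of E "A - {r}"] 1(3) by (metis Diff_iff UnionE in_set_conv_nth singletonD)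
    from ex[OF i] obtain q where q: "root_path (ts ! i) q" "last q = x"
      and uq: "\<And>q'. root_path (ts ! i) q' \<Longrightarrow> last q' = x \<Longrightarrow> q' = q" by blast
    show ?thesis
    proof (rule ex1I[of _ "r # q"])
      show "root_path (Node r ts) (r # q) \<and> last (r # q) = x"
        using i q root_path_nonempty[OF q(1)] by (auto simp: path)
      fix p assume p: "root_path (Node r ts) p \<and> last p = x"
      then have "p \<noteq> [r]" using False by auto
      with iffD1[OF path conjunct1[OF p]] obtain j q'
        where j: "j < length Cs" "p = r # q'" "root_path (ts ! j) q'" by blast
      then have "last q' = x" using p root_path_nonempty[OF j(3)] by auto
      moreover from this have "j = i" using same[OF j(1) i(1) _ i(2)] last[OF j(1,3)] by auto
      ultimately show "p = r # q" using uq j by auto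
    qed
  qed
  ultimately show ?case by blast
qed

lemma depth_eq:
  assumes "stt E A T" "root_path T p" "last p = x"
  shows "depth T x = length p"
proof -
  have "\<exists>!p. root_path T p \<and> last p = x" using stt_paths[OF assms(1)] assms(2,3) by blast
  then have "(THE p. root_path T p \<and> last p = x) = p" using assms by (intro the1_equality) auto
  then show ?thesis by (simp add: depth_def)
qed

lemma depth_root:
  assumes "stt E A (Node r ts)"
  shows "depth (Node r ts) r = 1"
  using depth_eq[OF assms root_path.intros(1)] by simp

lemma depth_child:
  assumes "stt E A (Node r ts)" "t \<in> set ts" "stt E C t" "x \<in> C"
  shows "depth (Node r ts) x = Suc (depth t x)"
proof -
  obtain p where p: "root_path t p" "last p = x" using stt_paths[OF assms(3)] assms(4) by blast
  then have "last (r # p) = x" using root_path_nonempty by auto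
  then show ?thesis
    using depth_eq[OF assms(1) root_path.intros(2)[OF assms(2) p(1)]] depth_eq[OF assms(3) p] by simp
qed

lemma cost_sum:
  assumes "finite V" "set X \<subseteq> V"
  shows "cost T X = (\<Sum>x\<in>V. count_list X x * depth T x)"
proof -
  have "cost T X = (\<Sum>x\<in>set X. count_list X x * depth T x)"
    by (simp add: cost_def sum_list_map_eq_sum_count)
  also have "\<dots> = (\<Sum>x\<in>V. count_list X x * depth T x)"
    by (rule sum.mono_neutral_left) (use assms in \<open>auto simp: count_list_0_iff\<close>)
  finally show ?thesis .
qed

context utree
begin

text \<open>All directed edges together bound every boundary, so this choice of \<open>k\<close>
  restricts nothing.\<close>

lemma stt_searchable: "stt E A T \<Longrightarrow> searchable (card edge_pairs) A (depth T)"
proof (induction rule: stt.induct)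
  case (1 r A Cs ts)
  have stt: "stt E A (Node r ts)"
    by (rule stt.intros[OF 1(1-3)]) (use 1(4) in \<open>auto elim: list_all2_mono\<close>)
  show ?case
  proof (rule searchable.intros[OF 1(1)])
    show "card (boundary A) \<le> card edge_pairs"
      by (rule card_mono[OF finite_edge_pairs boundary_edge_pairs])
    show "depth (Node r ts) r \<ge> 1" using depth_root[OF stt] by simp
    fix C assume "C \<in> components E (A - {r})"
    then obtain t where t: "t \<in> set ts" "stt E C t" "searchable (card edge_pairs) C (depth t)"
      using list_all2_ex[OF 1(4), of C] 1(3) by blast
    show "searchable (card edge_pairs) C (\<lambda>x. depth (Node r ts) x - 1)"
      by (rule searchable_mono[OF t(3)]) (use depth_child[OF stt t(1,2)] in simp)
  qed
qed

text \<open>Any node may be the root, as every component is smaller than \<open>A\<close>. The depth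
  bound later shows that the optimal value lies below the sentinel.\<close>

lemma searchable_exists:
  assumes "A \<subseteq> V" "A \<noteq> {}"
  shows "searchable (card edge_pairs) A (\<lambda>_. card A)"
  using assms
proof (induction "card A" arbitrary: A rule: less_induct)
  case less
  have fin: "finite A" using less finite_V finite_subset by blast
  obtain r where r: "r \<in> A" using less by auto
  show ?case
  proof (rule searchable.intros[OF r])
    show "card (boundary A) \<le> card edge_pairs"
      by (rule card_mono[OF finite_edge_pairs boundary_edge_pairs])
    show "card A \<ge> 1" using fin r by (metis One_nat_def Suc_leI card_gt_0_iff empty_iff)
    fix C assume "C \<in> components E (A - {r})"
    note C = component_connected(2,3)[OF this]
    then have "C \<subset> A" using r by auto
    then have lt: "card C < card A" using fin by (simp add: psubset_card_mono)
    show "searchable (card edge_pairs) C (\<lambda>_. card A - 1)"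
      by (rule searchable_mono[OF less(1)[OF lt]]) (use C less lt in auto)
  qed
qed

end

section \<open>Encoding regions by directed edges\<close>

text \<open>
  A digit list \<open>ds\<close> encodes the connected set \<open>region ds\<close> by directed edges leaving it: the edge \<open>e\<close>
  cuts off the branch at \<open>head e\<close> seen from \<open>tail e\<close>, and the digit \<open>0\<close> cuts off nothing.
  \<open>push g f ds\<close> restricts the region to the side of \<open>tail f\<close>: it deletes the digits that have become
  redundant and puts \<open>f\<close> into the first free position; \<open>g\<close> is \<open>f\<close> as long as \<open>f\<close> has not been
  placed and \<open>0\<close> afterwards, so that a nonzero second component of the result signals failure.
\<close>

locale coded_tree = utree V E for V :: "'a set" and E :: "'a set set" +
  fixes M :: nat and tail head :: "nat \<Rightarrow> 'a"
  assumes bij: "bij_betw (\<lambda>e. (tail e, head e)) {1..<M} edge_pairs"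
begin

definition cut :: "nat \<Rightarrow> 'a set" where
  "cut e = (if e \<in> {1..<M} then branch (tail e) (head e) else {})"

definition region :: "nat list \<Rightarrow> 'a set" where
  "region ds = V - (\<Union>e\<in>set ds. cut e)"

fun push :: "nat \<Rightarrow> nat \<Rightarrow> nat list \<Rightarrow> nat list \<times> nat" where
  "push g f [] = ([], g)"
| "push g f (d # ds) =
    (if d = 0 \<or> tail d \<in> cut f then (g # fst (push 0 f ds), snd (push 0 f ds))
     else (d # fst (push g f ds), snd (push g f ds)))"

lemma edge: "e \<in> {1..<M} \<Longrightarrow> {tail e, head e} \<in> E"
  using bij_betw_apply[OF bij] by (auto simp: edge_pairs_def)

lemma edge': "e \<in> {1..<M} \<Longrightarrow> {head e, tail e} \<in> E"
  using edge by (simp add: insert_commute)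

lemma edge_inj: "e \<in> {1..<M} \<Longrightarrow> f \<in> {1..<M} \<Longrightarrow> tail e = tail f \<Longrightarrow> head e = head f \<Longrightarrow> e = f"
  using bij_betw_imp_inj_on[OF bij] by (auto dest: inj_onD)

lemma edge_surj: "{u, v} \<in> E \<Longrightarrow> \<exists>e \<in> {1..<M}. tail e = u \<and> head e = v"
proof -
  assume "{u, v} \<in> E"
  then have "(u, v) \<in> (\<lambda>e. (tail e, head e)) ` {1..<M}"
    using bij_betw_imp_surj_on[OF bij] by (auto simp: edge_pairs_def)
  then show ?thesis by auto
qed

lemma cut_0 [simp]: "cut 0 = {}"
  by (simp add: cut_def)

lemma region_subset: "region ds \<subseteq> V"
  by (auto simp: region_def)

lemma finite_region [simp]: "finite (region ds)"
  using finite_subset[OF region_subset finite_V] .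

lemma head_cut: "e \<in> {1..<M} \<Longrightarrow> head e \<in> cut e"
  by (simp add: cut_def branch_root)

lemma tail_cut: "e \<in> {1..<M} \<Longrightarrow> tail e \<notin> cut e"
  using branch_subset[OF edge[of e]] by (auto simp: cut_def)

lemma cut_compl: "e \<in> {1..<M} \<Longrightarrow> V - cut e = branch (head e) (tail e)"
  using branch_compl[OF edge] by (simp add: cut_def)

lemma region_minus_cut: "f \<in> {1..<M} \<Longrightarrow> region ds - cut f = region ds \<inter> branch (head f) (tail f)"
  using cut_compl[of f] region_subset[of ds] by auto

text \<open>A walk from \<open>head e\<close> that avoids \<open>tail e\<close> stays in
  \<open>cut e\<close> and so never meets \<open>tail f\<close>; as it begins beyond
  \<open>f\<close>, it remains there. Therefore \<open>push\<close> may discard every digit whose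
  tail is cut off.\<close>

lemma cut_absorb:
  assumes e: "e \<in> {1..<M}" and f: "f \<in> {1..<M}" and ef: "tail e \<in> cut f" and fe: "tail f \<notin> cut e"
  shows "cut e \<subseteq> cut f"
proof
  fix x assume "x \<in> cut e"
  then have "(head e, x) \<in> (adj E (V - {tail e}))\<^sup>*" using e by (auto simp: cut_def branch_def)
  then have "x \<in> cut e \<and> x \<in> cut f"
  proof (induction rule: rtrancl_induct)
    case base
    have "head e \<noteq> tail f" "tail e \<noteq> tail f"
      using head_cut[OF e] fe tail_cut[OF f] ef by auto
    then have "head e \<in> cut f"
      using branch_step[OF _ edge[OF e], of "tail f" "head f"] ef f by (auto simp: cut_def)
    then show ?case using head_cut[OF e] by simp
  next
    case (step y z)
    then have yz: "{y, z} \<in> E" "y \<noteq> tail e" "z \<noteq> tail e" by (auto simp: adj_def)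
    have z: "z \<in> cut e"
      using branch_step[OF _ yz(1), of "tail e" "head e"] step yz e by (auto simp: cut_def)
    then have "y \<noteq> tail f" "z \<noteq> tail f" using step fe by auto
    then have "z \<in> cut f"
      using branch_step[OF _ yz(1), of "tail f" "head f"] step f by (auto simp: cut_def)
    then show ?case using z by simp
  qed
  then show "x \<in> cut f" by simp
qed

lemma length_push [simp]: "length (fst (push g f ds)) = length ds"
  by (induction ds arbitrary: g) auto

lemma snd_push_0 [simp]: "snd (push 0 f ds) = 0"
  by (induction ds) auto

lemma push_range:
  "set ds \<subseteq> {..<M} \<Longrightarrow> g < M \<Longrightarrow> set (fst (push g f ds)) \<subseteq> {..<M}"
  by (induction ds arbitrary: g) (auto split: if_splits)

lemma push_set:
  "snd (push g f ds) = 0 \<Longrightarrow>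
    set (fst (push g f ds)) - {0} = insert g {e \<in> set ds. tail e \<notin> cut f} - {0}"
proof (induction ds arbitrary: g)
  case (Cons d ds)
  show ?case
    using Cons.IH[of 0] Cons.IH[of g] Cons.prems by (auto split: if_splits)
qed auto

lemma push_fail:
  "snd (push g f ds) \<noteq> 0 \<Longrightarrow> \<forall>e \<in> set ds. e \<noteq> 0 \<and> tail e \<notin> cut f"
  by (induction ds arbitrary: g) (auto split: if_splits)

lemma set_push_subset: "set (fst (push g f ds)) \<subseteq> insert g (insert 0 (set ds))"
  by (induction ds arbitrary: g) auto

lemma push_distinct:
  "distinct (filter (\<lambda>e. e \<noteq> 0) ds) \<Longrightarrow> g \<notin> set ds \<or> g = 0 \<Longrightarrow>
    distinct (filter (\<lambda>e. e \<noteq> 0) (fst (push g f ds)))"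
proof (induction ds arbitrary: g)
  case (Cons d ds)
  show ?case
    using Cons.IH[of 0] Cons.IH[of g] Cons.prems set_push_subset[of 0 f ds] set_push_subset[of g f ds]
    by (auto split: if_splits)
qed auto

lemma region_nonzero: "region ds = V - (\<Union>e\<in>set ds - {0}. cut e)"
  by (auto simp: region_def)

lemma region_push:
  assumes ds: "set ds \<subseteq> {..<M}" and f: "f \<in> {1..<M}" "tail f \<in> region ds"
    and ok: "snd (push f f ds) = 0"
  shows "region (fst (push f f ds)) = region ds - cut f"
proof -
  have "(\<Union>e\<in>set (fst (push f f ds)) - {0}. cut e) = cut f \<union> (\<Union>e\<in>set ds - {0}. cut e)"
    unfolding push_set[OF ok]
  proof (intro equalityI subsetI)
    fix x assume "x \<in> cut f \<union> (\<Union>e\<in>set ds - {0}. cut e)"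
    then consider "x \<in> cut f" | e where "x \<in> cut e" "e \<in> set ds" "e \<noteq> 0" "x \<notin> cut f" by auto
    then show "x \<in> (\<Union>e\<in>insert f {e \<in> set ds. tail e \<notin> cut f} - {0}. cut e)"
    proof cases
      case 2
      then have "e \<in> {1..<M}" using ds by auto
      \<comment> \<open>Since \<open>tail f\<close> lies in the region, it is outside
        \<open>cut e\<close>. A discarded \<open>e\<close> would be absorbed by
        \<open>cut f\<close>, but \<open>x\<close> is not in \<open>cut f\<close>.\<close>
      then have "tail e \<notin> cut f" using cut_absorb[of e f] 2 f by (auto simp: region_def)
      then show ?thesis using 2 by auto
    qed (use f in auto)
  qed auto
  then show ?thesis unfolding region_nonzero by auto
qed

text \<open>Excludes repeated and redundant digits: these could occupy the last free position and
  make \<open>push\<close> fail although the new boundary fits.\<close>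

definition canonical :: "nat list \<Rightarrow> bool" where
  "canonical ds \<longleftrightarrow> distinct (filter (\<lambda>e. e \<noteq> 0) ds) \<and>
     set ds - {0} = {e \<in> {1..<M}. (tail e, head e) \<in> boundary (region ds)}"

lemma card_boundary: "card {e \<in> {1..<M}. (tail e, head e) \<in> boundary A} = card (boundary A)"
proof (rule bij_betw_same_card)
  show "bij_betw (\<lambda>e. (tail e, head e)) {e \<in> {1..<M}. (tail e, head e) \<in> boundary A} (boundary A)"
  proof (rule bij_betw_imageI)
    show "inj_on (\<lambda>e. (tail e, head e)) {e \<in> {1..<M}. (tail e, head e) \<in> boundary A}"
      using bij_betw_imp_inj_on[OF bij] by (rule inj_on_subset) auto
    show "(\<lambda>e. (tail e, head e)) ` {e \<in> {1..<M}. (tail e, head e) \<in> boundary A} = boundary A"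
    proof (intro equalityI subsetI)
      fix p assume p: "p \<in> boundary A"
      then obtain e where "e \<in> {1..<M}" "tail e = fst p" "head e = snd p"
        using edge_surj[of "fst p" "snd p"] by (auto simp: boundary_def)
      then show "p \<in> (\<lambda>e. (tail e, head e)) ` {e \<in> {1..<M}. (tail e, head e) \<in> boundary A}"
        using p by (auto intro!: image_eqI[of _ _ e])
    qed auto
  qed
qed

text \<open>The digits kept by \<open>push\<close>, together with \<open>f\<close>, are exactly the
  boundary edges of the smaller region. Without a free position all digits would be kept, giving one
  more distinct boundary edge than there are positions.\<close>

lemma push_canonical:
  assumes can: "canonical ds" and ds: "set ds \<subseteq> {..<M}" and conn: "connected_in E (region ds)"
    and f: "f \<in> {1..<M}" "tail f \<in> region ds" "head f \<in> region ds"
    and bd: "card (boundary (region ds - cut f)) \<le> length ds"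
  shows "snd (push f f ds) = 0" "canonical (fst (push f f ds))"
proof -
  let ?C = "region ds - cut f"
  have C: "?C = region ds \<inter> branch (head f) (tail f)" by (rule region_minus_cut[OF f(1)])
  have set_ds: "set ds - {0} = {e \<in> {1..<M}. (tail e, head e) \<in> boundary (region ds)}"
    using can by (simp add: canonical_def)
  have fds: "f \<notin> set ds" using set_ds f by (auto simp: boundary_def)
  have key: "{e \<in> {1..<M}. (tail e, head e) \<in> boundary ?C} = insert f {e \<in> set ds. tail e \<notin> cut f} - {0}"
    (is "?L = ?R")
  proof
    show "?L \<subseteq> ?R"
    proof
      fix e assume "e \<in> ?L"
      then have e: "e \<in> {1..<M}" "(tail e, head e) \<in> boundary ?C" by auto
      then have tl: "tail e \<notin> cut f" by (auto simp: boundary_def)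
      have "(tail e, head e) = (tail f, head f) \<or> (tail e, head e) \<in> boundary (region ds)"
        using boundary_branch_subset[OF conn region_subset f(3,2) edge'[OF f(1)]] e(2)
        unfolding C by blast
      then show "e \<in> ?R" using edge_inj[OF e(1) f(1)] set_ds e(1) tl by auto
    qed
    show "?R \<subseteq> ?L"
    proof
      fix e assume e: "e \<in> ?R"
      show "e \<in> ?L"
      proof (cases "e = f")
        case True
        then show ?thesis using f tail_cut[OF f(1)] head_cut[OF f(1)] edge[OF f(1)]
          by (auto simp: boundary_def)
      next
        case False
        then have "e \<in> set ds - {0}" "tail e \<notin> cut f" using e by auto
        then show ?thesis unfolding set_ds by (auto simp: boundary_def)
      qed
    qed
  qed
  show ok: "snd (push f f ds) = 0"
  proof (rule ccontr)
    assume "snd (push f f ds) \<noteq> 0"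
    note fail = push_fail[OF this]
    then have "insert f {e \<in> set ds. tail e \<notin> cut f} - {0} = insert f (set ds)" using f by auto
    then have "card (boundary ?C) = card (insert f (set ds))" using key card_boundary[of ?C] by simp
    also have "\<dots> = Suc (card (set ds))" using fds by simp
    also have "filter (\<lambda>e. e \<noteq> 0) ds = ds" using fail by (simp add: filter_id_conv)
    then have "card (set ds) = length ds" using can by (simp add: canonical_def distinct_card)
    finally show False using bd by simp
  qed
  show "canonical (fst (push f f ds))"
    unfolding canonical_def
  proof
    show "distinct (filter (\<lambda>e. e \<noteq> 0) (fst (push f f ds)))"
      using push_distinct[of ds f f] can fds by (auto simp: canonical_def)
    show "set (fst (push f f ds)) - {0} =
      {e \<in> {1..<M}. (tail e, head e) \<in> boundary (region (fst (push f f ds)))}"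
      unfolding region_push[OF ds f(1,2) ok] key by (rule push_set[OF ok])
  qed
qed

definition incoming :: "nat list \<Rightarrow> 'a \<Rightarrow> nat set" where
  "incoming ds r = {f \<in> {1..<M}. head f = r \<and> tail f \<in> region ds}"

lemma finite_incoming [simp]: "finite (incoming ds r)"
  by (simp add: incoming_def)

lemma components_region:
  assumes "connected_in E (region ds)" "r \<in> region ds"
  shows "components E (region ds - {r}) = (\<lambda>f. region ds - cut f) ` incoming ds r"
proof -
  have "(\<lambda>f. region ds - cut f) ` incoming ds r = (\<lambda>v. region ds \<inter> branch r v) ` tail ` incoming ds r"
    using region_minus_cut by (auto simp: incoming_def image_image intro!: image_cong)
  also have "tail ` incoming ds r = {v \<in> region ds. {r, v} \<in> E}"
  proof (intro equalityI subsetI)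
    fix v assume "v \<in> {v \<in> region ds. {r, v} \<in> E}"
    then obtain f where "f \<in> {1..<M}" "tail f = v" "head f = r" "v \<in> region ds"
      using edge_surj[of v r] by (auto simp: insert_commute)
    then show "v \<in> tail ` incoming ds r" by (auto simp: incoming_def)
  qed (use edge' in \<open>auto simp: incoming_def\<close>)
  finally show ?thesis using components_remove[OF assms(1) region_subset assms(2)] by simp
qed

lemma branch_disjoint_edges:
  assumes "f \<in> {1..<M}" "f' \<in> {1..<M}" "head f = head f'" "f \<noteq> f'"
  shows "branch (head f) (tail f) \<inter> branch (head f') (tail f') = {}"
proof -
  have "tail f \<noteq> tail f'" using edge_inj assms by auto
  then show ?thesis
    using branch_disjoint_siblings[OF edge'[OF assms(1)], of "tail f'"] edge'[OF assms(2)] assms(3)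
    by auto
qed

lemma incoming_disjoint:
  assumes "f \<in> incoming ds r" "f' \<in> incoming ds r" "f \<noteq> f'"
  shows "(region ds - cut f) \<inter> (region ds - cut f') = {}"
  using branch_disjoint_edges[of f f'] region_minus_cut[of f ds] region_minus_cut[of f' ds] assms
  by (auto simp: incoming_def)

lemma incoming_region:
  assumes "f \<in> incoming ds r" "r \<in> region ds"
  shows "tail f \<in> region ds - cut f" "region ds - cut f \<subseteq> region ds - {r}"
  using assms tail_cut head_cut by (auto simp: incoming_def)

lemma sum_incoming:
  assumes "connected_in E (region ds)" "r \<in> region ds"
  shows "(\<Sum>x\<in>region ds - {r}. h x) = (\<Sum>f\<in>incoming ds r. \<Sum>x\<in>region ds - cut f. (h x :: nat))"
proof -
  have "region ds - {r} = (\<Union>f\<in>incoming ds r. region ds - cut f)"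
    using components_Union[of E "region ds - {r}"] components_region[OF assms] by simp
  then have "(\<Sum>x\<in>region ds - {r}. h x) = (\<Sum>x\<in>(\<Union>f\<in>incoming ds r. region ds - cut f). h x)" by simp
  also have "\<dots> = (\<Sum>f\<in>incoming ds r. \<Sum>x\<in>region ds - cut f. h x)"
    by (rule sum.UNION_disjoint) (simp, simp, use incoming_disjoint in blast)
  finally show ?thesis .
qed

text \<open>Among all edges with head \<open>r\<close>, the one leading to \<open>x\<close> is
  identified by \<open>x \<notin> cut f\<close> alone. This is the test made when the tree is read
  off.\<close>

lemma unique_incoming:
  assumes "connected_in E (region ds)" "r \<in> region ds" "x \<in> region ds" "x \<noteq> r"
  shows "\<exists>f. f \<in> {1..<M} \<and> head f = r \<and> x \<notin> cut f \<and> f \<in> incoming ds r \<and>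
    (\<forall>f'. f' \<in> {1..<M} \<and> head f' = r \<and> x \<notin> cut f' \<longrightarrow> f' = f)"
proof -
  have "x \<in> (\<Union>f\<in>incoming ds r. region ds - cut f)"
    using components_Union[of E "region ds - {r}"] components_region[OF assms(1,2)] assms(3,4) by simp
  then obtain f where f: "f \<in> incoming ds r" "x \<notin> cut f" by auto
  have "f' = f" if f': "f' \<in> {1..<M}" "head f' = r" "x \<notin> cut f'" for f'
  proof (rule ccontr)
    assume "f' \<noteq> f"
    then have "branch (head f) (tail f) \<inter> branch (head f') (tail f') = {}"
      using branch_disjoint_edges[of f f'] f f' by (auto simp: incoming_def)
    moreover have "x \<in> V" using assms region_subset by auto
    ultimately show False
      using cut_compl[of f] cut_compl[OF f'(1)] f f' by (auto simp: incoming_def)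
  qed
  then show ?thesis using f by (auto simp: incoming_def)
qed

end

section \<open>Correctness of the dynamic program\<close>

locale dp_table = coded_tree V E M tail head
  for V :: "'a set" and E :: "'a set set" and M :: nat and tail head :: "nat \<Rightarrow> 'a" +
  fixes k :: nat and w :: "'a \<Rightarrow> nat" and bound :: nat
    and val :: "nat list \<Rightarrow> nat" and choice :: "nat list \<Rightarrow> 'a"
begin

definition codes :: "nat list set" where
  "codes = {ds. length ds = k \<and> set ds \<subseteq> {..<M}}"

definition child :: "nat \<Rightarrow> nat list \<Rightarrow> nat" where
  "child f ds = (if snd (push f f ds) = 0 then val (fst (push f f ds)) else bound)"

text \<open>The recurrence for a minimum over roots, truncated at \<open>bound\<close>; hence
  attainment and a meaningful choice are demanded only below \<open>bound\<close>. The term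
  \<open>sum w (region ds)\<close> charges every node of the region for its root.\<close>

definition entry :: "nat list \<Rightarrow> bool" where
  "entry ds \<longleftrightarrow>
    (\<forall>r \<in> region ds. val ds \<le> sum w (region ds) + (\<Sum>f\<in>incoming ds r. child f ds)) \<and>
    (val ds < bound \<longrightarrow> choice ds \<in> region ds \<and>
       val ds = sum w (region ds) + (\<Sum>f\<in>incoming ds (choice ds). child f ds))"

lemma push_codes: "ds \<in> codes \<Longrightarrow> f < M \<Longrightarrow> fst (push f f ds) \<in> codes"
  using push_range[of ds f f] by (auto simp: codes_def)

lemma card_region_push:
  assumes "ds \<in> codes" "f \<in> {1..<M}" "tail f \<in> region ds" "head f \<in> region ds" "snd (push f f ds) = 0"
  shows "card (region (fst (push f f ds))) < card (region ds)"
proof -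
  have "region (fst (push f f ds)) = region ds - cut f"
    using region_push assms by (auto simp: codes_def)
  moreover have "region ds - cut f \<subset> region ds" using assms head_cut[OF assms(2)] by auto
  ultimately show ?thesis by (simp add: psubset_card_mono)
qed

text \<open>One step of the search for \<open>x\<close>, paired with the last root passed, which
  ends up as the parent of \<open>x\<close>. Having arrived, it stands still, so one number of steps
  serves all nodes.\<close>

fun descend :: "'a \<Rightarrow> nat list \<times> 'a \<Rightarrow> nat list \<times> 'a" where
  "descend x (ds, p) =
    (if choice ds = x then (ds, p)
     else (let f = (THE f. f \<in> {1..<M} \<and> head f = choice ds \<and> x \<notin> cut f)
       in (fst (push f f ds), choice ds)))"

definition solved :: "nat list \<Rightarrow> bool" where
  "solved ds \<longleftrightarrow> ds \<in> codes \<and> connected_in E (region ds) \<and> val ds < bound"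

end

locale solved_dp_table = dp_table +
  assumes entries: "\<And>ds. ds \<in> codes \<Longrightarrow> region ds \<noteq> {} \<Longrightarrow> entry ds"
begin

text \<open>Induction along the given search. Its root is one candidate of the minimum, and each
  component has at most \<open>k\<close> boundary edges, so pushing succeeds and the tuple stays
  canonical. Splitting \<open>D x\<close> as \<open>1 + (D x - 1)\<close> matches the
  recurrence.\<close>

lemma val_le:
  "searchable k A D \<Longrightarrow> ds \<in> codes \<Longrightarrow> region ds = A \<Longrightarrow> connected_in E A \<Longrightarrow> canonical ds \<Longrightarrow>
    val ds \<le> (\<Sum>x\<in>A. w x * D x)"
proof (induction arbitrary: ds rule: searchable.induct)
  case (1 r A D)
  note ds = 1(6) and A = 1(7)[symmetric] and conn = 1(8)[folded 1(7)] and can = 1(9)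
  have r: "r \<in> region ds" using 1 by simp
  have ge1: "D x \<ge> 1" if "x \<in> A" for x
    using searchable_ge_1[OF searchable.intros[OF 1(1-4)]] that by auto
  have "val ds \<le> sum w (region ds) + (\<Sum>f\<in>incoming ds r. child f ds)"
    using entries[OF ds] r by (auto simp: entry_def)
  also have "(\<Sum>f\<in>incoming ds r. child f ds) \<le>
      (\<Sum>f\<in>incoming ds r. \<Sum>x\<in>region ds - cut f. w x * (D x - 1))"
  proof (rule sum_mono)
    fix f assume f: "f \<in> incoming ds r"
    then have f': "f \<in> {1..<M}" "tail f \<in> region ds" "head f \<in> region ds"
      using r by (auto simp: incoming_def)
    have C: "region ds - cut f \<in> components E (A - {r})"
      using components_region[OF conn r] f A by auto
    have "card (boundary (region ds - cut f)) \<le> length ds"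
      using searchable.cases[OF 1(4)[OF C]] ds by (auto simp: codes_def)
    note push = push_canonical[OF can _ conn f' this]
    have bds: "set ds \<subseteq> {..<M}" using ds by (auto simp: codes_def)
    note reg = region_push[OF bds f'(1,2) push(1)[OF bds]]
    have "val (fst (push f f ds)) \<le> (\<Sum>x\<in>region ds - cut f. w x * (D x - 1))"
      by (rule 1(5)[OF C])
         (use push_codes[OF ds] f' reg component_connected(1)[OF C] push(2)[OF bds] in auto)
    then show "child f ds \<le> (\<Sum>x\<in>region ds - cut f. w x * (D x - 1))"
      using push(1)[OF bds] by (simp add: child_def)
  qed
  also have "\<dots> = (\<Sum>x\<in>region ds - {r}. w x * (D x - 1))"
    by (rule sum_incoming[OF conn r, symmetric])
  also have "\<dots> \<le> (\<Sum>x\<in>region ds. w x * (D x - 1))"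
    by (rule sum_mono2) auto
  also have "sum w (region ds) + \<dots> = (\<Sum>x\<in>A. w x * D x)"
    unfolding A sum.distrib[symmetric]
  proof (rule sum.cong)
    fix x assume "x \<in> region ds"
    then have "D x = Suc (D x - 1)" using ge1[of x] A by simp
    then show "w x + w x * (D x - 1) = w x * D x" by (metis mult_Suc_right)
  qed simp
  finally show ?case by simp
qed

text \<open>A sum below \<open>bound\<close> has all its terms below \<open>bound\<close>. So no
  child of the chosen root carries the sentinel, and all these pushes have succeeded.\<close>

lemma solved_child:
  assumes s: "solved ds" and ne: "region ds \<noteq> {}" and f: "f \<in> incoming ds (choice ds)"
  shows "snd (push f f ds) = 0" "solved (fst (push f f ds))"
    "region (fst (push f f ds)) = region ds - cut f"
    "card (region (fst (push f f ds))) < card (region ds)"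
    "child f ds = val (fst (push f f ds))"
proof -
  have ds: "ds \<in> codes" "connected_in E (region ds)" "val ds < bound" using s by (auto simp: solved_def)
  have e: "choice ds \<in> region ds" "val ds = sum w (region ds) + (\<Sum>f\<in>incoming ds (choice ds). child f ds)"
    using entries[OF ds(1) ne] ds by (auto simp: entry_def)
  have "child f ds \<le> (\<Sum>f\<in>incoming ds (choice ds). child f ds)"
    by (rule member_le_sum[OF f]) auto
  then have lt: "child f ds < bound" using e ds by linarith
  then show ok: "snd (push f f ds) = 0" by (auto simp: child_def split: if_splits)
  then show ch: "child f ds = val (fst (push f f ds))" by (simp add: child_def)
  have f': "f \<in> {1..<M}" "tail f \<in> region ds" "head f \<in> region ds"
    using f e by (auto simp: incoming_def)
  show reg: "region (fst (push f f ds)) = region ds - cut f"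
    using region_push ds f' ok by (auto simp: codes_def)
  have "region ds - cut f \<in> components E (region ds - {choice ds})"
    using components_region[OF ds(2) e(1)] f by auto
  then show "solved (fst (push f f ds))"
    using push_codes[OF ds(1)] f' component_connected(1) reg lt ch by (auto simp: solved_def)
  show "card (region (fst (push f f ds))) < card (region ds)"
    by (rule card_region_push[OF ds(1) f' ok])
qed

lemma choice_region: "solved ds \<Longrightarrow> region ds \<noteq> {} \<Longrightarrow> choice ds \<in> region ds"
  using entries by (auto simp: entry_def solved_def)

lemma descend_edge:
  assumes "solved ds" "x \<in> region ds" "choice ds \<noteq> x"
  obtains f where "f \<in> incoming ds (choice ds)" "f \<in> {1..<M}" "head f = choice ds" "x \<notin> cut f"
    "\<And>f'. f' \<in> {1..<M} \<Longrightarrow> head f' = choice ds \<Longrightarrow> x \<notin> cut f' \<Longrightarrow> f' = f"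
    "\<And>p. descend x (ds, p) = (fst (push f f ds), choice ds)"
proof -
  have "choice ds \<in> region ds" using choice_region[OF assms(1)] assms(2) by auto
  then obtain f where f: "f \<in> {1..<M}" "head f = choice ds" "x \<notin> cut f" "f \<in> incoming ds (choice ds)"
    "\<forall>f'. f' \<in> {1..<M} \<and> head f' = choice ds \<and> x \<notin> cut f' \<longrightarrow> f' = f"
    using unique_incoming[of ds "choice ds" x] assms by (auto simp: solved_def)
  have "(THE f. f \<in> {1..<M} \<and> head f = choice ds \<and> x \<notin> cut f) = f"
    by (rule the_equality) (use f in auto)
  then have "descend x (ds, p) = (fst (push f f ds), choice ds)" for p
    using assms(3) by (simp add: Let_def)
  then show thesis using that f by metis
qed

lemma descend_solved:
  assumes "solved ds" "x \<in> region ds"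
  shows "solved (fst (descend x (ds, p)))" "x \<in> region (fst (descend x (ds, p)))"
proof -
  have "solved (fst (descend x (ds, p))) \<and> x \<in> region (fst (descend x (ds, p)))"
  proof (cases "choice ds = x")
    case False
    then obtain f where f: "f \<in> incoming ds (choice ds)" "x \<notin> cut f"
      "\<And>p. descend x (ds, p) = (fst (push f f ds), choice ds)"
      using descend_edge assms by metis
    then show ?thesis using solved_child[OF assms(1) _ f(1)] assms(2) by auto
  qed (use assms in simp)
  then show "solved (fst (descend x (ds, p)))" "x \<in> region (fst (descend x (ds, p)))" by auto
qed

text \<open>Tree, cost and parents are treated together because they concern the same
  \<open>T\<close>. The initial parent \<open>p\<close> and the number \<open>j\<close> of steps are
  arbitrary: after one step the walk is that of a child, with the chosen root as its initial parent
  and one step less.\<close>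

lemma reconstruct:
  assumes "solved ds" "region ds \<noteq> {}"
  shows "\<exists>T. stt E (region ds) T \<and> root T = choice ds \<and>
    (\<Sum>x\<in>region ds. w x * depth T x) = val ds \<and>
    (\<forall>j \<ge> card (region ds). \<forall>p. snd ((descend (root T) ^^ j) (ds, p)) = p \<and>
      (\<forall>(q, y) \<in> arcs T. y \<in> region ds \<and> snd ((descend y ^^ j) (ds, p)) = q))"
  using assms
proof (induction "card (region ds)" arbitrary: ds rule: less_induct)
  case less
  let ?r = "choice ds" and ?A = "region ds"
  let ?sub = "\<lambda>f. fst (push f f ds)"
  note s = less(2) and ne = less(3)
  have r: "?r \<in> ?A" by (rule choice_region[OF s ne])
  have conn: "connected_in E ?A" using s by (simp add: solved_def)
  define good where "good f T \<longleftrightarrow> stt E (?A - cut f) T \<and> root T = choice (?sub f) \<and>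
      (\<Sum>x\<in>?A - cut f. w x * depth T x) = child f ds \<and>
      (\<forall>j \<ge> card (?A - cut f). \<forall>p. snd ((descend (root T) ^^ j) (?sub f, p)) = p \<and>
        (\<forall>(q, y) \<in> arcs T. y \<in> ?A - cut f \<and> snd ((descend y ^^ j) (?sub f, p)) = q))" for f T
  have "\<exists>T. good f T" if f: "f \<in> incoming ds ?r" for f
  proof -
    note c = solved_child[OF s ne f]
    have "region (?sub f) \<noteq> {}" using c(3) incoming_region(1)[OF f r] by auto
    from less(1)[OF c(4) c(2) this] show "\<exists>T. good f T" unfolding c(3,5) good_def .
  qed
  then have "\<forall>f \<in> incoming ds ?r. \<exists>T. good f T" by blast
  from bchoice[OF this] obtain T where good: "\<And>f. f \<in> incoming ds ?r \<Longrightarrow> good f (T f)" by blast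
  have T: "\<And>f. f \<in> incoming ds ?r \<Longrightarrow> stt E (?A - cut f) (T f)"
    and rootT: "\<And>f. f \<in> incoming ds ?r \<Longrightarrow> root (T f) = choice (?sub f)"
    and costT: "\<And>f. f \<in> incoming ds ?r \<Longrightarrow> (\<Sum>x\<in>?A - cut f. w x * depth (T f) x) = child f ds"
    and walkT: "\<And>f. f \<in> incoming ds ?r \<Longrightarrow> \<forall>j \<ge> card (?A - cut f). \<forall>p.
      snd ((descend (root (T f)) ^^ j) (?sub f, p)) = p \<and>
      (\<forall>(q, y) \<in> arcs (T f). y \<in> ?A - cut f \<and> snd ((descend y ^^ j) (?sub f, p)) = q)"
    using good unfolding good_def by blast+
  obtain fs where fs: "set fs = incoming ds ?r" "distinct fs"
    using finite_distinct_list[OF finite_incoming] by blast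
  let ?T = "Node ?r (map T fs)"
  have stt: "stt E ?A ?T"
  proof (rule stt.intros[OF r])
    show "distinct (map (\<lambda>f. ?A - cut f) fs)"
      unfolding distinct_map
    proof (intro conjI fs(2) inj_onI, rule ccontr)
      fix f f' assume "f \<in> set fs" "f' \<in> set fs" "?A - cut f = ?A - cut f'" "f \<noteq> f'"
      then show False using incoming_disjoint[of f ds ?r f'] incoming_region(1)[of f ds ?r] fs(1) r
        by blast
    qed
    show "set (map (\<lambda>f. ?A - cut f) fs) = components E (?A - {?r})"
      using components_region[OF conn r] fs(1) by simp
    show "list_all2 (stt E) (map (\<lambda>f. ?A - cut f) fs) (map T fs)"
      using T fs(1) by (simp add: list_all2_map1 list_all2_map2 list_all2_same)
  qed
  have "(\<Sum>x\<in>?A. w x * depth ?T x) = w ?r + (\<Sum>x\<in>?A - {?r}. w x * depth ?T x)"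
    using depth_root[OF stt] by (subst sum.remove[OF _ r]) auto
  also have "(\<Sum>x\<in>?A - {?r}. w x * depth ?T x) =
      (\<Sum>f\<in>incoming ds ?r. \<Sum>x\<in>?A - cut f. w x * depth ?T x)"
    by (rule sum_incoming[OF conn r])
  also have "\<dots> = (\<Sum>f\<in>incoming ds ?r. \<Sum>x\<in>?A - cut f. w x + w x * depth (T f) x)"
    using depth_child[OF stt _ T] fs(1) by (intro sum.cong) auto
  also have "\<dots> = (\<Sum>f\<in>incoming ds ?r. sum w (?A - cut f)) + (\<Sum>f\<in>incoming ds ?r. child f ds)"
    using costT by (simp add: sum.distrib)
  also have "(\<Sum>f\<in>incoming ds ?r. sum w (?A - cut f)) = sum w (?A - {?r})"
    by (rule sum_incoming[OF conn r, symmetric])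
  also have "w ?r + (sum w (?A - {?r}) + (\<Sum>f\<in>incoming ds ?r. child f ds)) =
      sum w ?A + (\<Sum>f\<in>incoming ds ?r. child f ds)"
    by (subst sum.remove[OF _ r, of w]) auto
  also have "\<dots> = val ds" using entries[of ds] s ne by (auto simp: entry_def solved_def)
  finally have cost: "(\<Sum>x\<in>?A. w x * depth ?T x) = val ds" .
  have "snd ((descend ?r ^^ j) (ds, p)) = p \<and>
      (\<forall>(q, y) \<in> arcs ?T. y \<in> ?A \<and> snd ((descend y ^^ j) (ds, p)) = q)"
    if j: "j \<ge> card ?A" for j p
  proof
    have "(descend ?r ^^ i) (ds, p) = (ds, p)" for i by (induction i) auto
    then show "snd ((descend ?r ^^ j) (ds, p)) = p" by simp
    show "\<forall>(q, y) \<in> arcs ?T. y \<in> ?A \<and> snd ((descend y ^^ j) (ds, p)) = q"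
    proof clarify
      fix q y assume "(q, y) \<in> arcs ?T"
      then obtain f where f: "f \<in> incoming ds ?r"
        and qy: "(q = ?r \<and> y = root (T f)) \<or> (q, y) \<in> arcs (T f)"
        using fs(1) by auto
      note c = solved_child[OF s ne f]
      have ne': "region (?sub f) \<noteq> {}" using c(3) incoming_region(1)[OF f r] by auto
      have y: "y \<in> ?A - cut f"
        using qy walkT[OF f] choice_region[OF c(2) ne'] rootT[OF f] c(3) by fastforce
      then have y': "y \<in> ?A" "y \<noteq> ?r" using incoming_region(2)[OF f r] by auto
      then obtain f' where f': "\<And>f''. f'' \<in> {1..<M} \<Longrightarrow> head f'' = ?r \<Longrightarrow> y \<notin> cut f'' \<Longrightarrow> f'' = f'"
        "\<And>p. descend y (ds, p) = (?sub f', ?r)"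
        using descend_edge[OF s y'(1)] by metis
      have "f' = f" using f'(1)[of f] f y by (auto simp: incoming_def)
      then have d: "descend y (ds, p) = (?sub f, ?r)" using f' by simp
      \<comment> \<open>One step was spent on entering the child, whose region is strictly smaller,
        so the remaining \<open>i\<close> steps suffice.\<close>
      obtain i where i: "j = Suc i" "i \<ge> card (?A - cut f)"
        using j c(3,4) by (cases j) auto
      have "snd ((descend y ^^ j) (ds, p)) = snd ((descend y ^^ i) (?sub f, ?r))"
        unfolding i(1) funpow_Suc_right o_apply d ..
      also have "\<dots> = q" using qy walkT[OF f, rule_format, OF i(2), of ?r] by auto
      finally show "y \<in> ?A \<and> snd ((descend y ^^ j) (ds, p)) = q" using y' by simp
    qed
  qed
  then show ?case using stt cost by (intro exI[of _ ?T]) auto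
qed

end

section \<open>Time-bounded Hoare triples for the word RAM\<close>

text \<open>
  The word bound is \<open>N ^ d\<close>. If all registers and cells stay below \<open>N ^ p\<close>, then \<open>d\<close> can be read off
  the program text: \<open>exp_bits p e\<close> bounds the exponent needed for all intermediate values of \<open>e\<close>.
\<close>

primrec exp_bits :: "nat \<Rightarrow> exp \<Rightarrow> nat" where
  "exp_bits p (Const c) = c"
| "exp_bits p (Reg r) = p"
| "exp_bits p (Load a) = exp_bits p a + p"
| "exp_bits p (Add a b) = exp_bits p a + exp_bits p b + 1"
| "exp_bits p (Sub a b) = exp_bits p a + exp_bits p b + 1"
| "exp_bits p (Mul a b) = exp_bits p a + exp_bits p b + 1"
| "exp_bits p (Div a b) = exp_bits p a + exp_bits p b + 1"

primrec com_bits :: "nat \<Rightarrow> com \<Rightarrow> nat" where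
  "com_bits p Skip = 0"
| "com_bits p (Assign r e) = exp_bits p e"
| "com_bits p (Store a e) = exp_bits p a + exp_bits p e"
| "com_bits p (Seq c1 c2) = com_bits p c1 + com_bits p c2"
| "com_bits p (Cond e c1 c2) = exp_bits p e + com_bits p c1 + com_bits p c2"
| "com_bits p (While e c) = exp_bits p e + com_bits p c"

definition bounded_state :: "nat \<Rightarrow> state \<Rightarrow> bool" where
  "bounded_state B s \<longleftrightarrow> (\<forall>r. reg s r < B) \<and> (\<forall>i. mem s i < B)"

lemma eval_less:
  assumes "2 \<le> N" "bounded_state (N ^ p) s"
  shows "eval e s < N ^ exp_bits p e"
proof (induction e)
  case (Const c)
  \<comment> \<open>The exponent \<open>c\<close> for a constant is generous, but it does not depend
    on \<open>N\<close>.\<close>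
  have "c < 2 ^ c" by (rule less_exp)
  also have "(2::nat) ^ c \<le> N ^ c" using assms by (intro power_mono) auto
  finally show ?case by simp
next
  case (Load e)
  have "N ^ p \<le> N ^ exp_bits p (Load e)" using assms by (intro power_increasing) auto
  then show ?case using assms by (auto simp: bounded_state_def intro: less_le_trans)
next
  case (Add e1 e2)
  have "N ^ exp_bits p e1 \<le> N ^ (exp_bits p e1 + exp_bits p e2)"
    "N ^ exp_bits p e2 \<le> N ^ (exp_bits p e1 + exp_bits p e2)"
    using assms by (auto intro!: power_increasing)
  moreover have "2 * N ^ (exp_bits p e1 + exp_bits p e2) \<le> N ^ exp_bits p (Add e1 e2)"
    using assms by simp
  ultimately show ?case using Add by (simp only: eval.simps)
next
  case (Mul e1 e2)
  have "eval e1 s * eval e2 s < N ^ exp_bits p e1 * N ^ exp_bits p e2"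
    using Mul assms by (intro mult_strict_mono) auto
  also have "\<dots> \<le> N ^ exp_bits p (Mul e1 e2)" using assms by (simp add: power_add)
  finally show ?case by simp
next
  case (Sub e1 e2)
  have "N ^ exp_bits p e1 \<le> N ^ exp_bits p (Sub e1 e2)" using assms by (intro power_increasing) auto
  then show ?case using Sub by (simp add: less_imp_diff_less)
next
  case (Div e1 e2)
  have "N ^ exp_bits p e1 \<le> N ^ exp_bits p (Div e1 e2)" using assms by (intro power_increasing) auto
  moreover have "eval e1 s div eval e2 s \<le> eval e1 s" by (rule div_le_dividend)
  ultimately show ?case using Div by (simp del: div_le_dividend)
qed (use assms in \<open>auto simp: bounded_state_def\<close>)

lemma fits_exp:
  assumes "2 \<le> N" "bounded_state (N ^ p) s"
  shows "exp_bits p e \<le> d \<Longrightarrow> fits (N ^ d) e s"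
proof (induction e)
  have *: "eval e s < N ^ d" if "exp_bits p e \<le> d" for e
    using eval_less[OF assms, of e] power_increasing[OF that, of N] assms by linarith
  { case (Const c) then show ?case using *[of "Const c"] by simp }
  { case (Reg r) then show ?case using *[of "Reg r"] by simp }
  { case (Load e) then show ?case using *[of "Load e"] by simp }
  { case (Add e1 e2) then show ?case using *[of "Add e1 e2"] by simp }
  { case (Sub e1 e2) then show ?case using *[of "Sub e1 e2"] by simp }
  { case (Mul e1 e2) then show ?case using *[of "Mul e1 e2"] by simp }
  { case (Div e1 e2) then show ?case using *[of "Div e1 e2"] by simp }
qed

definition set_reg :: "state \<Rightarrow> nat \<Rightarrow> nat \<Rightarrow> state" where
  "set_reg s r v = s\<lparr>reg := (reg s)(r := v)\<rparr>"

definition set_mem :: "state \<Rightarrow> nat \<Rightarrow> nat \<Rightarrow> state" where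
  "set_mem s a v = s\<lparr>mem := (mem s)(a := v)\<rparr>"

text \<open>Total correctness for every word exponent that covers the program text. Boundedness of
  the state is built in, so assertions need not carry it.\<close>

definition triple ::
  "nat \<Rightarrow> nat \<Rightarrow> (state \<Rightarrow> bool) \<Rightarrow> com \<Rightarrow> nat \<Rightarrow> (state \<Rightarrow> bool) \<Rightarrow> bool" where
  "triple N p P c K Q \<longleftrightarrow> (\<forall>s d. P s \<longrightarrow> bounded_state (N ^ p) s \<longrightarrow> com_bits p c \<le> d \<longrightarrow>
     (\<exists>k s'. exec (N ^ d) c s k s' \<and> k \<le> K \<and> bounded_state (N ^ p) s' \<and> Q s'))"

lemma tripleI:
  assumes "\<And>s d. P s \<Longrightarrow> bounded_state (N ^ p) s \<Longrightarrow> com_bits p c \<le> d \<Longrightarrow>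
     \<exists>k s'. exec (N ^ d) c s k s' \<and> k \<le> K \<and> bounded_state (N ^ p) s' \<and> Q s'"
  shows "triple N p P c K Q"
  using assms unfolding triple_def by blast

lemma tripleE:
  assumes "triple N p P c K Q" "P s" "bounded_state (N ^ p) s" "com_bits p c \<le> d"
  obtains k s' where "exec (N ^ d) c s k s'" "k \<le> K" "bounded_state (N ^ p) s'" "Q s'"
  using assms unfolding triple_def by blast

lemma triple_Seq:
  assumes "triple N p P c1 K1 R" "triple N p R c2 K2 Q"
  shows "triple N p P (Seq c1 c2) (K1 + K2) Q"
proof (rule tripleI, goal_cases)
  case s: (1 s d)
  obtain k1 s1 where 1: "exec (N ^ d) c1 s k1 s1" "k1 \<le> K1" "bounded_state (N ^ p) s1" "R s1"
    by (rule tripleE[OF assms(1) s(1,2), of d]) (use s(3) in auto)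
  obtain k2 s2 where 2: "exec (N ^ d) c2 s1 k2 s2" "k2 \<le> K2" "bounded_state (N ^ p) s2" "Q s2"
    by (rule tripleE[OF assms(2) 1(4,3), of d]) (use s(3) in auto)
  show ?case
    using exec.Seq[OF 1(1) 2(1)] 1(2) 2 by (intro exI conjI) auto
qed

lemma triple_Cond:
  assumes N: "2 \<le> N"
    and "triple N p (\<lambda>s. P s \<and> eval e s \<noteq> 0) c1 K Q" "triple N p (\<lambda>s. P s \<and> eval e s = 0) c2 K Q"
  shows "triple N p P (Cond e c1 c2) (steps e + 1 + K) Q"
proof (rule tripleI, goal_cases)
  case s: (1 s d)
  have fit: "fits (N ^ d) e s" using fits_exp[OF N s(2)] s(3) by simp
  show ?case
  proof (cases "eval e s = 0")
    case True
    obtain k s' where *: "exec (N ^ d) c2 s k s'" "k \<le> K" "bounded_state (N ^ p) s'" "Q s'"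
      by (rule tripleE[OF assms(3) _ s(2), of d]) (use s True in auto)
    show ?thesis using exec.CondFalse[OF fit True *(1)] * by (intro exI conjI) auto
  next
    case False
    obtain k s' where *: "exec (N ^ d) c1 s k s'" "k \<le> K" "bounded_state (N ^ p) s'" "Q s'"
      by (rule tripleE[OF assms(2) _ s(2), of d]) (use s False in auto)
    show ?thesis using exec.CondTrue[OF fit False *(1)] * by (intro exI conjI) auto
  qed
qed

primrec loop_free :: "com \<Rightarrow> bool" where
  "loop_free Skip \<longleftrightarrow> True"
| "loop_free (Assign r e) \<longleftrightarrow> True"
| "loop_free (Store a e) \<longleftrightarrow> True"
| "loop_free (Seq c1 c2) \<longleftrightarrow> loop_free c1 \<and> loop_free c2"
| "loop_free (Cond e c1 c2) \<longleftrightarrow> loop_free c1 \<and> loop_free c2"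
| "loop_free (While e c) \<longleftrightarrow> False"

text \<open>A conditional is charged for both branches, which keeps the bound independent of the
  state and costs only a constant factor.\<close>

primrec com_time :: "com \<Rightarrow> nat" where
  "com_time Skip = 1"
| "com_time (Assign r e) = steps e + 1"
| "com_time (Store a e) = steps a + steps e + 1"
| "com_time (Seq c1 c2) = com_time c1 + com_time c2"
| "com_time (Cond e c1 c2) = steps e + 1 + (com_time c1 + com_time c2)"
| "com_time (While e c) = 0"

text \<open>Only written values are compared with \<open>B\<close>; addresses and intermediate
  results are covered by \<open>com_bits\<close>.\<close>

primrec wp :: "nat \<Rightarrow> com \<Rightarrow> (state \<Rightarrow> bool) \<Rightarrow> state \<Rightarrow> bool" where
  "wp B Skip Q s \<longleftrightarrow> Q s"
| "wp B (Assign r e) Q s \<longleftrightarrow> eval e s < B \<and> Q (set_reg s r (eval e s))"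
| "wp B (Store a e) Q s \<longleftrightarrow> eval e s < B \<and> Q (set_mem s (eval a s) (eval e s))"
| "wp B (Seq c1 c2) Q s \<longleftrightarrow> wp B c1 (wp B c2 Q) s"
| "wp B (Cond e c1 c2) Q s \<longleftrightarrow>
     (eval e s \<noteq> 0 \<longrightarrow> wp B c1 Q s) \<and> (eval e s = 0 \<longrightarrow> wp B c2 Q s)"
| "wp B (While e c) Q s \<longleftrightarrow> False"

lemma triple_weaken:
  assumes "triple N p P' c K' Q'" "\<And>s. P s \<Longrightarrow> P' s" "K' \<le> K" "\<And>s. Q' s \<Longrightarrow> Q s"
  shows "triple N p P c K Q"
  using assms unfolding triple_def by (meson order_trans)

lemma triple_wp:
  assumes "2 \<le> N"
  shows "triple N p (wp (N ^ p) c Q) c (com_time c) Q"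
proof (induction c arbitrary: Q)
  case Skip
  show ?case by (rule tripleI) (use exec.Skip in fastforce)
next
  case (Assign r e)
  show ?case
  proof (rule tripleI, goal_cases)
    case s: (1 s d)
    show ?case
      by (rule exI, rule exI, rule conjI, rule exec.Assign[OF fits_exp[OF assms s(2)]])
         (use s in \<open>auto simp: bounded_state_def set_reg_def set_mem_def\<close>)
  qed
next
  case (Store a e)
  show ?case
  proof (rule tripleI, goal_cases)
    case s: (1 s d)
    show ?case
      by (rule exI, rule exI, rule conjI,
          rule exec.Store[OF fits_exp[OF assms s(2)] fits_exp[OF assms s(2)]])
         (use s in \<open>auto simp: bounded_state_def set_reg_def set_mem_def\<close>)
  qed
next
  case (Seq c1 c2)
  show ?case using triple_Seq[OF Seq(1)[of "wp (N ^ p) c2 Q"] Seq(2)[of Q]] by (simp add: triple_def)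
next
  case (Cond e c1 c2)
  have "triple N p (wp (N ^ p) (Cond e c1 c2) Q) (Cond e c1 c2) (steps e + 1 + (com_time c1 + com_time c2)) Q"
    by (rule triple_Cond[OF assms]; rule triple_weaken[OF Cond(1)] triple_weaken[OF Cond(2)]) auto
  then show ?case by (simp only: com_time.simps)
next
  case (While e c)
  show ?case by (simp add: triple_def)
qed

lemma triple_straight:
  assumes "2 \<le> N" "\<And>s. P s \<Longrightarrow> wp (N ^ p) c Q s"
  shows "triple N p P c (com_time c) Q"
  by (rule triple_weaken[OF triple_wp[OF assms(1)]]) (use assms(2) in auto)

definition For :: "nat \<Rightarrow> nat \<Rightarrow> nat \<Rightarrow> com \<Rightarrow> com" where
  "For a r l c = Seq (Assign r (Const a))
     (While (Sub (Reg l) (Reg r)) (Seq c (Assign r (Add (Reg r) (Const 1)))))"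

text \<open>The \<open>6\<close> is two steps for initialising the counter and four for the last
  test; the \<open>8\<close> is test and increment of a round. The counter never exceeds
  \<open>L\<close>, which is itself the content of a register and hence bounded.\<close>

lemma triple_For:
  assumes N: "2 \<le> N"
    and body: "\<And>i. a \<le> i \<Longrightarrow> i < L \<Longrightarrow>
      triple N p (\<lambda>s. I i s \<and> reg s r = i) c (K i) (\<lambda>s. I (Suc i) s \<and> reg s r = i)"
    and lim: "\<And>i s. I i s \<Longrightarrow> reg s l = L"
    and stable: "\<And>i s v. I i s \<Longrightarrow> I i (set_reg s r v)"
    and aL: "a \<le> L"
  shows "triple N p (I a) (For a r l c) (6 + (\<Sum>i=a..<L. K i + 8)) (\<lambda>s. I L s)"
proof (rule tripleI, goal_cases)
  case s: (1 s d)
  let ?w = "While (Sub (Reg l) (Reg r)) (Seq c (Assign r (Add (Reg r) (Const 1))))"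
  have loop: "\<exists>k s'. exec (N ^ d) ?w s k s' \<and> k \<le> 4 + (\<Sum>j=i..<L. K j + 8) \<and>
      bounded_state (N ^ p) s' \<and> I L s'"
    if "I i s" "reg s r = i" "bounded_state (N ^ p) s" "a \<le> i" "i \<le> L" for i s
    using that
  proof (induction "L - i" arbitrary: i s)
    case 0
    have fit: "fits (N ^ d) (Sub (Reg l) (Reg r)) s"
      by (rule fits_exp[OF N 0(4)]) (use s(3) in \<open>simp add: For_def\<close>)
    have "eval (Sub (Reg l) (Reg r)) s = 0" using lim[OF 0(2)] 0 by simp
    from exec.WhileFalse[OF fit this] show ?case using 0 by (intro exI conjI) auto
  next
    case (Suc m)
    have iL: "i < L" and m: "m = L - Suc i" using Suc(2) by simp_all
    have fit: "fits (N ^ d) (Sub (Reg l) (Reg r)) s"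
      by (rule fits_exp[OF N Suc(5)]) (use s(3) in \<open>simp add: For_def\<close>)
    have ne: "eval (Sub (Reg l) (Reg r)) s \<noteq> 0" using lim[OF Suc(3)] Suc(4) iL by simp
    obtain k1 s1 where 1: "exec (N ^ d) c s k1 s1" "k1 \<le> K i" "bounded_state (N ^ p) s1"
      "I (Suc i) s1" "reg s1 r = i"
      by (rule tripleE[OF body[OF Suc(6) iL] _ Suc(5), of d]) (use Suc s(3) in \<open>auto simp: For_def\<close>)
    let ?s = "s1\<lparr>reg := (reg s1)(r := eval (Add (Reg r) (Const 1)) s1)\<rparr>"
    have fit': "fits (N ^ d) (Add (Reg r) (Const 1)) s1"
      by (rule fits_exp[OF N 1(3)]) (use s(3) in \<open>simp add: For_def\<close>)
    have "L < N ^ p" using lim[OF Suc(3)] Suc(5) by (auto simp: bounded_state_def)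
    then have bd: "bounded_state (N ^ p) ?s" using 1(3,5) iL by (auto simp: bounded_state_def)
    obtain k2 s2 where 2: "exec (N ^ d) ?w ?s k2 s2" "k2 \<le> 4 + (\<Sum>j=Suc i..<L. K j + 8)"
      "bounded_state (N ^ p) s2" "I L s2"
      using Suc(1)[OF m stable[OF 1(4), unfolded set_reg_def] _ bd] Suc(6) 1(5) iL by auto
    have "(\<Sum>j=i..<L. K j + 8) = K i + 8 + (\<Sum>j=Suc i..<L. K j + 8)"
      using iL by (simp add: sum.atLeast_Suc_lessThan)
    then show ?case
      using exec.WhileTrue[OF fit ne exec.Seq[OF 1(1) exec.Assign[OF fit']] 2(1)] 1(2) 2
      by (intro exI conjI) auto
  qed
  have "L < N ^ p" using lim[OF s(1)] s(2) by (auto simp: bounded_state_def)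
  then have bd: "bounded_state (N ^ p) (s\<lparr>reg := (reg s)(r := a)\<rparr>)"
    using s(2) aL by (auto simp: bounded_state_def)
  obtain k s' where *: "exec (N ^ d) ?w (s\<lparr>reg := (reg s)(r := a)\<rparr>) k s'"
    "k \<le> 4 + (\<Sum>j=a..<L. K j + 8)" "bounded_state (N ^ p) s'" "I L s'"
    using loop[OF stable[OF s(1), unfolded set_reg_def] _ bd] aL by auto
  have "fits (N ^ d) (Const a) s" by (rule fits_exp[OF N s(2)]) (use s(3) in \<open>simp add: For_def\<close>)
  from exec.Seq[OF exec.Assign[OF this]] *
  show ?case
    unfolding For_def by (intro exI conjI) auto
qed

lemma triple_For_const:
  assumes "2 \<le> N"
    and "\<And>i. a \<le> i \<Longrightarrow> i < L \<Longrightarrow>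
      triple N p (\<lambda>s. I i s \<and> reg s r = i) c K (\<lambda>s. I (Suc i) s \<and> reg s r = i)"
    and "\<And>i s. I i s \<Longrightarrow> reg s l = L"
    and "\<And>i s v. I i s \<Longrightarrow> I i (set_reg s r v)"
    and "a \<le> L"
  shows "triple N p (I a) (For a r l c) (6 + L * (K + 8)) (I L)"
  by (rule triple_weaken[OF triple_For[where I = I and K = "\<lambda>_. K", OF assms]]) auto

section \<open>Arrays, codes and the push operation\<close>

primrec digits :: "nat \<Rightarrow> nat \<Rightarrow> nat \<Rightarrow> nat list" where
  "digits M 0 c = []"
| "digits M (Suc k) c = (c mod M) # digits M k (c div M)"

primrec undigits :: "nat \<Rightarrow> nat list \<Rightarrow> nat" where
  "undigits M [] = 0"
| "undigits M (d # ds) = d + M * undigits M ds"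

lemma length_digits [simp]: "length (digits M k c) = k"
  by (induction k arbitrary: c) auto

lemma set_digits: "M > 0 \<Longrightarrow> set (digits M k c) \<subseteq> {..<M}"
  by (induction k arbitrary: c) auto

lemma undigits_digits: "c < M ^ k \<Longrightarrow> undigits M (digits M k c) = c"
proof (induction k arbitrary: c)
  case (Suc k)
  have "c div M < M ^ k" using Suc(2) by (simp add: less_mult_imp_div_less mult.commute)
  then show ?case using Suc(1) by simp
qed simp

lemma digits_undigits: "set ds \<subseteq> {..<M} \<Longrightarrow> digits M (length ds) (undigits M ds) = ds"
  by (induction ds) auto

lemma undigits_less: "set ds \<subseteq> {..<M} \<Longrightarrow> undigits M ds < M ^ length ds"
proof (induction ds)
  case (Cons d ds)
  then have "d < M" "undigits M ds + 1 \<le> M ^ length ds" by auto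
  then have "d + M * undigits M ds < M * (undigits M ds + 1)" by simp
  also have "\<dots> \<le> M * M ^ length ds" using Cons by (intro mult_le_mono2) auto
  finally show ?case by simp
qed simp

lemma digits_0: "digits M k 0 = replicate k 0"
  by (induction k) auto

text \<open>
  Register 0 holds \<open>3 * n\<close>, the first address behind the input; registers 1, 2 and 3 hold \<open>n\<close>,
  \<open>M\<close> and \<open>M ^ k\<close>. Six unbounded arrays are interleaved behind the input: 0 is the
  characteristic function of the sets \<open>cut e\<close>, 1 and 2 are the sizes and weights of the regions,
  3 accumulates the costs of the roots, 4 and 5 are the values and the optimal roots.
\<close>

definition arr :: "state \<Rightarrow> nat \<Rightarrow> nat \<Rightarrow> nat" where
  "arr s a i = mem s (reg s 0 + (6 * i + a))"

definition set_arr :: "state \<Rightarrow> nat \<Rightarrow> nat \<Rightarrow> nat \<Rightarrow> state" where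
  "set_arr s a i v = set_mem s (reg s 0 + (6 * i + a)) v"

definition ArrE :: "nat \<Rightarrow> exp \<Rightarrow> exp" where
  "ArrE a e = Load (Add (Reg 0) (Add (Mul (Const 6) e) (Const a)))"

definition ArrS :: "nat \<Rightarrow> exp \<Rightarrow> exp \<Rightarrow> com" where
  "ArrS a e v = Store (Add (Reg 0) (Add (Mul (Const 6) e) (Const a))) v"

lemma eval_ArrE [simp]: "eval (ArrE a e) s = arr s a (eval e s)"
  by (simp add: ArrE_def arr_def)

lemma wp_ArrS [simp]:
  "wp B (ArrS a e v) Q s \<longleftrightarrow> eval v s < B \<and> Q (set_arr s a (eval e s) (eval v s))"
  by (simp add: ArrS_def set_arr_def)

lemma reg_set_reg [simp]: "reg (set_reg s r v) r' = (if r' = r then v else reg s r')"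
  by (simp add: set_reg_def)

lemma mem_set_reg [simp]: "mem (set_reg s r v) = mem s"
  by (simp add: set_reg_def)

lemma arr_set_reg [simp]: "r \<noteq> 0 \<Longrightarrow> arr (set_reg s r v) = arr s"
  by (simp add: arr_def fun_eq_iff)

lemma reg_set_mem [simp]: "reg (set_mem s a v) = reg s"
  by (simp add: set_mem_def)

lemma mem_set_mem [simp]: "mem (set_mem s a v) i = (if i = a then v else mem s i)"
  by (simp add: set_mem_def)

lemma arr_set_mem [simp]: "i < reg s 0 \<Longrightarrow> arr (set_mem s i v) = arr s"
  by (auto simp: arr_def fun_eq_iff)

lemma reg_set_arr [simp]: "reg (set_arr s a i v) = reg s"
  by (simp add: set_arr_def)

lemma mem_set_arr [simp]: "j < reg s 0 \<Longrightarrow> mem (set_arr s a i v) j = mem s j"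
  by (simp add: set_arr_def)

lemma arr_set_arr [simp]:
  assumes "a < 6" "b < 6"
  shows "arr (set_arr s a i v) b = (if b = a then (arr s b)(i := v) else arr s b)"
proof
  fix j
  have "6 * i + a = 6 * j + b \<longleftrightarrow> a = b \<and> i = j" using assms by presburger
  then show "arr (set_arr s a i v) b j = (if b = a then (arr s b)(i := v) else arr s b) j"
    using assms by (auto simp: arr_def set_arr_def fun_upd_def)
qed

definition NeqE :: "exp \<Rightarrow> exp \<Rightarrow> exp" where
  "NeqE a b = Add (Sub a b) (Sub b a)"

lemma eval_NeqE [simp]: "eval (NeqE a b) s = 0 \<longleftrightarrow> eval a s = eval b s"
  by (auto simp: NeqE_def)

definition ModE :: "exp \<Rightarrow> exp" where
  "ModE e = Sub e (Mul (Div e (Reg 2)) (Reg 2))"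

lemma eval_ModE [simp]: "eval (ModE e) s = eval e s mod reg s 2"
  by (simp add: ModE_def minus_div_mult_eq_mod)

definition PairE :: "exp \<Rightarrow> exp \<Rightarrow> exp" where
  "PairE e x = Add (Mul e (Reg 1)) x"

lemma eval_PairE [simp]: "eval (PairE e x) s = eval e s * reg s 1 + eval x s"
  by (simp add: PairE_def)

lemma pair_eq_iff: "x < n \<Longrightarrow> y < n \<Longrightarrow> a * n + x = b * n + y \<longleftrightarrow> a = b \<and> x = (y::nat)"
proof
  assume xy: "x < n" "y < n" and eq: "a * n + x = b * n + y"
  have "(a * n + x) div n = a" "(b * n + y) div n = b" using xy by auto
  then have "a = b" using eq by simp
  then show "a = b \<and> x = y" using eq by simp
qed auto

text \<open>The edge \<open>2 * i + 1\<close> is the \<open>i\<close>-th edge of the input, and \<open>2 * i + 2\<close> is its reversal.\<close>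

definition rev_edge :: "nat \<Rightarrow> nat" where
  "rev_edge e = 4 * ((e - 1) div 2) + 3 - e"

text \<open>The endpoints in the input begin at cell \<open>n + 1\<close>, so cell
  \<open>n + e\<close> holds the tail of \<open>e\<close> without further preparation.\<close>

definition TailE :: "exp \<Rightarrow> exp" where
  "TailE e = Load (Add (Reg 1) e)"

definition HeadE :: "exp \<Rightarrow> exp" where
  "HeadE e = TailE (Sub (Add (Mul (Const 4) (Div (Sub e (Const 1)) (Const 2))) (Const 3)) e)"

primrec PowE :: "nat \<Rightarrow> exp" where
  "PowE 0 = Const 1"
| "PowE (Suc k) = Mul (Reg 2) (PowE k)"

lemma eval_PowE [simp]: "eval (PowE k) s = reg s 2 ^ k"
  by (induction k) auto

text \<open>\<open>OutE k q x\<close> is \<open>0\<close> iff no digit of \<open>q\<close> cuts off \<open>x\<close>.\<close>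

primrec OutE :: "nat \<Rightarrow> exp \<Rightarrow> exp \<Rightarrow> exp" where
  "OutE 0 q x = Const 0"
| "OutE (Suc k) q x = Add (ArrE 0 (PairE (ModE q) x)) (OutE k (Div q (Reg 2)) x)"

text \<open>Handles the lowest digit: register 22 holds the digits still to be read, 23 the result
  so far, 24 the current power of \<open>M\<close>, 25 the value \<open>g\<close> and 26 the digit.
  A redundant digit is first set to \<open>0\<close>, which merges the two kinds of free
  position.\<close>

definition push_step :: com where
  "push_step =
    Seq (Assign 26 (ModE (Reg 22)))
   (Seq (Assign 22 (Div (Reg 22) (Reg 2)))
   (Seq (Cond (ArrE 0 (PairE (Reg 20) (TailE (Reg 26)))) (Assign 26 (Const 0)) Skip)
   (Seq (Cond (Reg 26) Skip (Seq (Assign 26 (Reg 25)) (Assign 25 (Const 0))))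
   (Seq (Assign 23 (Add (Reg 23) (Mul (Reg 24) (Reg 26))))
        (Assign 24 (Mul (Reg 24) (Reg 2)))))))"

primrec push_steps :: "nat \<Rightarrow> com" where
  "push_steps 0 = Skip"
| "push_steps (Suc j) = Seq push_step (push_steps j)"

text \<open>Pushes edge register 20 onto code register 21: result in register 23, failure flag in 25.\<close>

definition push_com :: "nat \<Rightarrow> com" where
  "push_com k =
    Seq (Assign 22 (Reg 21)) (Seq (Assign 23 (Const 0)) (Seq (Assign 24 (Const 1))
   (Seq (Assign 25 (Reg 20)) (push_steps k))))"

text \<open>Cutting a search of depth at most \<open>n\<close> gives depth at most
  \<open>n + n div t \<le> 2 * n\<close>. Such a search costs less than this value, which can
  therefore stand for infinity.\<close>

definition value_bound :: "nat \<Rightarrow> (nat \<Rightarrow> nat) \<Rightarrow> nat" where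
  "value_bound n w = 2 * n * (\<Sum>x<n. w x) + 1"

text \<open>The factor \<open>M + 1\<close> in the last bound leaves room for the accumulated costs,
  sums over incoming edges with terms up to the sentinel.\<close>

locale ram_tree = coded_tree "{..<n}" E M tail head
  for n :: nat and E :: "nat set set" and M :: nat and tail head :: "nat \<Rightarrow> nat" +
  fixes w :: "nat \<Rightarrow> nat" and k N p :: nat
  assumes N: "2 \<le> N" and M: "M = 2 * n - 1" and n: "n \<ge> 1"
    and head_rev: "e \<in> {1..<M} \<Longrightarrow> rev_edge e \<in> {1..<M} \<and> tail (rev_edge e) = head e"
    and bounds: "3 * n < N ^ p" "M ^ k < N ^ p" "(M + 1) * value_bound n w < N ^ p"
begin

abbreviation "bound \<equiv> value_bound n w"
abbreviation "dig \<equiv> digits M k"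
abbreviation "H c \<equiv> region (dig c)"

definition base :: "state \<Rightarrow> bool" where
  "base s \<longleftrightarrow> reg s 0 = 3 * n \<and> reg s 1 = n \<and> reg s 2 = M \<and> reg s 3 = M ^ k \<and>
     (\<forall>e \<in> {1..<M}. mem s (n + e) = tail e)"

definition cuts_ok :: "state \<Rightarrow> bool" where
  "cuts_ok s \<longleftrightarrow> (\<forall>e < M. \<forall>x < n. arr s 0 (e * n + x) = 0 \<longleftrightarrow> x \<notin> cut e)"

lemma baseD:
  assumes "base s"
  shows "reg s 0 = 3 * n" "reg s (Suc 0) = n" "reg s 1 = n" "reg s 2 = M" "reg s 3 = M ^ k"
  using assms by (auto simp: base_def)

lemma base_set_reg [simp]: "r > 3 \<Longrightarrow> base (set_reg s r v) = base s"
  by (simp add: base_def)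

lemma edge_address: "e < M \<Longrightarrow> n + e < 3 * n"
  using M by simp

lemma base_set_arr [simp]: "base s \<Longrightarrow> base (set_arr s a i v)"
  by (auto simp: base_def edge_address)

lemma cuts_ok_set_reg [simp]: "r \<noteq> 0 \<Longrightarrow> cuts_ok (set_reg s r v) = cuts_ok s"
  by (simp add: cuts_ok_def)

lemma cuts_ok_set_arr [simp]: "a < 6 \<Longrightarrow> a \<noteq> 0 \<Longrightarrow> cuts_ok (set_arr s a i v) = cuts_ok s"
  by (simp add: cuts_ok_def)

lemma eval_TailE: "base s \<Longrightarrow> eval e s \<in> {1..<M} \<Longrightarrow> eval (TailE e) s = tail (eval e s)"
  by (simp add: TailE_def base_def)

lemma eval_HeadE: "base s \<Longrightarrow> eval e s \<in> {1..<M} \<Longrightarrow> eval (HeadE e) s = head (eval e s)"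
  using head_rev[of "eval e s"] unfolding HeadE_def by (subst eval_TailE) (auto simp: rev_edge_def)

lemma M_pos: "M > 0"
  using M n by simp

lemma dig_range: "set (dig c) \<subseteq> {..<M}"
  by (rule set_digits[OF M_pos])

lemma tail_less: "e \<in> {1..<M} \<Longrightarrow> tail e < n"
  and head_less: "e \<in> {1..<M} \<Longrightarrow> head e < n"
  using edgeD[OF edge] by auto

lemma less_bound: "x \<le> 3 * n \<Longrightarrow> x < N ^ p" "c \<le> M ^ k \<Longrightarrow> c < N ^ p"
  "y \<le> (M + 1) * bound \<Longrightarrow> y < N ^ p"
  using bounds by linarith+

lemma eval_OutE:
  assumes "base s" "cuts_ok s" "eval x s < n"
  shows "eval (OutE j q x) s = 0 \<longleftrightarrow> eval x s \<in> region (digits M j (eval q s))"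
proof -
  have "eval (OutE j q x) s = 0 \<longleftrightarrow> (\<forall>d \<in> set (digits M j (eval q s)). eval x s \<notin> cut d)"
  proof (induction j arbitrary: q)
    case (Suc j)
    have "eval q s mod M < M" using M_pos by simp
    then show ?case using Suc[of "Div q (Reg 2)"] assms baseD[OF assms(1)]
      by (simp add: cuts_ok_def)
  qed simp
  then show ?thesis using assms(3) by (auto simp: region_def)
qed

definition push_frame :: "state \<Rightarrow> state \<Rightarrow> bool" where
  "push_frame s s' \<longleftrightarrow> mem s' = mem s \<and> (\<forall>r. r \<notin> {22..26} \<longrightarrow> reg s' r = reg s r)"

lemma push_frame_trans: "push_frame s s' \<Longrightarrow> push_frame s' s'' \<Longrightarrow> push_frame s s''"
  by (simp add: push_frame_def)

lemma push_frame_base: "push_frame s s' \<Longrightarrow> base s' = base s"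
  by (simp add: push_frame_def base_def)

lemma push_frame_arr: "push_frame s s' \<Longrightarrow> arr s' = arr s"
  by (simp add: push_frame_def arr_def fun_eq_iff)

lemma push_frame_cuts_ok: "push_frame s s' \<Longrightarrow> cuts_ok s' = cuts_ok s"
  by (simp add: cuts_ok_def push_frame_arr)

lemma wp_mono: "wp B c Q s \<Longrightarrow> (\<And>s. Q s \<Longrightarrow> Q' s) \<Longrightarrow> wp B c Q' s"
  by (induction c arbitrary: Q Q' s) auto

definition push_stepped :: "state \<Rightarrow> state \<Rightarrow> bool" where
  "push_stepped s s' \<longleftrightarrow> push_frame s s' \<and> reg s' 22 = reg s 22 div M \<and>
     reg s' 24 = reg s 24 * M \<and>
     (let d = reg s 22 mod M in
      if d = 0 \<or> tail d \<in> cut (reg s 20)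
      then reg s' 23 = reg s 23 + reg s 24 * reg s 25 \<and> reg s' 25 = 0
      else reg s' 23 = reg s 23 + reg s 24 * d \<and> reg s' 25 = reg s 25)"

lemma wp_push_step:
  assumes s: "base s" "cuts_ok s" and f: "reg s 20 \<in> {1..<M}"
    and g: "reg s 25 < M" and o: "reg s 23 < reg s 24" and pw: "reg s 24 * M \<le> M ^ k"
    and q: "reg s 22 \<le> M ^ k"
  shows "wp (N ^ p) push_step (push_stepped s) s"
proof -
  let ?d = "reg s 22 mod M"
  have d: "?d < M" using M_pos by simp
  have small: "v < M \<Longrightarrow> v < N ^ p" for v using less_bound(1)[of v] M by simp
  \<comment> \<open>The result so far is below the current power of \<open>M\<close>, so it stays
    below the next power when a digit is added.\<close>
  have acc: "reg s 23 + reg s 24 * v < N ^ p" if "v < M" for v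
  proof -
    have "reg s 23 + reg s 24 * v < reg s 24 * (v + 1)" using o by simp
    also have "\<dots> \<le> reg s 24 * M" using that by (intro mult_le_mono2) auto
    finally show ?thesis using less_bound(2) pw by simp
  qed
  have q': "reg s 22 div M < N ^ p"
    using less_bound(2)[OF q] div_le_dividend[of "reg s 22" M] by linarith
  have pw': "reg s 24 * M < N ^ p" using less_bound(2) pw by simp
  have pos: "0 < N ^ p" using N by simp
  have "reg s 23 < N ^ p" using acc[of 0] M_pos by simp
  show ?thesis
  proof (cases "?d = 0")
    \<comment> \<open>For the digit \<open>0\<close> the node loaded by \<open>TailE\<close> is
      meaningless, but either outcome of the test leaves the digit \<open>0\<close>.\<close>
    case True
    then show ?thesis
      using acc[OF g] acc[of 0] small[of 0] M_pos q' pw' pos small[OF g] baseD[OF s(1)]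
      by (simp add: push_step_def push_stepped_def push_frame_def)
  next
    case False
    then have d': "?d \<in> {1..<M}" using d by auto
    have "arr s 0 (reg s 20 * n + mem s (n + ?d)) = 0 \<longleftrightarrow> tail ?d \<notin> cut (reg s 20)"
      using s f d' tail_less[OF d'] by (auto simp: cuts_ok_def base_def)
    then show ?thesis
      using False acc[OF g] acc[OF d] small[OF d] q' pw' pos small[OF g] baseD[OF s(1)]
      by (simp add: push_step_def push_stepped_def push_frame_def TailE_def)
  qed
qed

definition pushed_digits :: "nat \<Rightarrow> state \<Rightarrow> state \<Rightarrow> bool" where
  "pushed_digits j s s' \<longleftrightarrow> push_frame s s' \<and>
     reg s' 23 = reg s 23 + reg s 24 * undigits M (fst (push (reg s 25) (reg s 20) (digits M j (reg s 22)))) \<and>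
     reg s' 25 = snd (push (reg s 25) (reg s 20) (digits M j (reg s 22)))"

lemma wp_push_steps:
  assumes "base s" "cuts_ok s" "reg s 20 \<in> {1..<M}" "reg s 25 < M" "reg s 23 < reg s 24"
    and "reg s 24 * M ^ j \<le> M ^ k" "reg s 22 \<le> M ^ k"
  shows "wp (N ^ p) (push_steps j) (pushed_digits j s) s"
  using assms
proof (induction j arbitrary: s)
  case 0
  then show ?case by (simp add: pushed_digits_def push_frame_def)
next
  case (Suc j)
  note s = Suc(2-)
  have M1: "1 \<le> M ^ j" using M_pos by simp
  have "reg s 24 * M \<le> reg s 24 * M ^ Suc j" using M1 M_pos by simp
  then have pw: "reg s 24 * M \<le> M ^ k" by (rule order_trans[OF _ s(6)])
  show ?case
    unfolding push_steps.simps wp.simps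
  proof (rule wp_mono[OF wp_push_step[OF s(1-5) pw s(7)]])
    fix s' assume "push_stepped s s'"
    note * = this[unfolded push_stepped_def]
    let ?d = "reg s 22 mod M"
    have fr: "push_frame s s'" and r20: "reg s' 20 = reg s 20" and r22: "reg s' 22 = reg s 22 div M"
      and r24: "reg s' 24 = reg s 24 * M"
      using * by (auto simp: push_frame_def)
    have lt: "reg s 23 + reg s 24 * v < reg s 24 * M" if "v < M" for v
    proof -
      have "reg s 23 + reg s 24 * v < reg s 24 * (v + 1)" using s(5) by simp
      also have "\<dots> \<le> reg s 24 * M" using that by (intro mult_le_mono2) auto
      finally show ?thesis .
    qed
    have r25: "reg s' 25 < M" and r23: "reg s' 23 < reg s' 24"
      using * lt[OF s(4)] lt[of ?d] s(4) M_pos by (auto simp: Let_def split: if_splits)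
    have r24': "reg s' 24 * M ^ j \<le> M ^ k" using s(6) r24 by (simp add: mult.assoc)
    have r22': "reg s' 22 \<le> M ^ k" using s(7) r22 div_le_dividend[of "reg s 22" M] by linarith
    have b: "base s'" "cuts_ok s'" "reg s' 20 \<in> {1..<M}"
      using s(1-3) fr r20 by (auto simp: push_frame_base push_frame_cuts_ok)
    show "wp (N ^ p) (push_steps j) (pushed_digits (Suc j) s) s'"
    proof (rule wp_mono[OF Suc(1)[OF b r25 r23 r24' r22']])
      fix s'' assume "pushed_digits j s' s''"
      then show "pushed_digits (Suc j) s s''"
        using * push_frame_trans[OF fr] unfolding pushed_digits_def r20 r22 r24
        by (auto simp: Let_def algebra_simps split: if_splits)
    qed
  qed
qed

lemma wp_push_com:
  assumes "base s" "cuts_ok s" "reg s 20 \<in> {1..<M}" "reg s 21 < M ^ k"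
    and "\<And>s'. push_frame s s' \<Longrightarrow>
      reg s' 23 = undigits M (fst (push (reg s 20) (reg s 20) (dig (reg s 21)))) \<Longrightarrow>
      reg s' 25 = snd (push (reg s 20) (reg s 20) (dig (reg s 21))) \<Longrightarrow> Q s'"
  shows "wp (N ^ p) (push_com k) Q s"
proof -
  let ?s = "set_reg (set_reg (set_reg (set_reg s 22 (reg s 21)) 23 0) 24 1) 25 (reg s 20)"
  have fr: "push_frame s ?s" by (simp add: push_frame_def)
  have "wp (N ^ p) (push_steps k) Q ?s"
    by (rule wp_mono[OF wp_push_steps]) (use assms push_frame_trans[OF fr] in \<open>auto simp: pushed_digits_def\<close>)
  moreover have "1 < N ^ p" using less_bound(1)[of 1] n by simp
  moreover have "reg s 20 < N ^ p" using assms(3) edge_address[of "reg s 20"]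
    by (intro less_bound(1)) auto
  moreover have "reg s 21 < N ^ p" using less_bound(2)[of "reg s 21"] assms(4) by simp
  moreover have "0 < N ^ p" using N by simp
  ultimately show ?thesis by (simp add: push_com_def)
qed

end

section \<open>Cuts and regions\<close>

definition cut_init :: com where
  "cut_init =
    Seq (Assign 6 (TailE (Reg 5)))
   (Seq (Assign 7 (HeadE (Reg 5)))
        (ArrS 0 (PairE (Reg 5) (Reg 7)) (Const 1)))"

definition cut_relax :: com where
  "cut_relax =
    Seq (Assign 10 (TailE (Reg 9)))
   (Seq (Assign 11 (HeadE (Reg 9)))
        (Cond (ArrE 0 (PairE (Reg 5) (Reg 10)))
          (Cond (NeqE (Reg 11) (Reg 6)) (ArrS 0 (PairE (Reg 5) (Reg 11)) (Const 1)) Skip)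
          Skip))"

text \<open>Reachability by repeated relaxation: for each directed edge, \<open>M\<close> rounds
  over all directed edges.\<close>

definition cut_com :: com where
  "cut_com = For 1 5 2 (Seq cut_init (For 0 8 2 (For 1 9 2 cut_relax)))"

definition region_update :: "nat \<Rightarrow> com" where
  "region_update k =
    Cond (OutE k (Reg 21) (Reg 6)) Skip
      (Seq (ArrS 1 (Reg 21) (Add (ArrE 1 (Reg 21)) (Const 1)))
           (ArrS 2 (Reg 21) (Add (ArrE 2 (Reg 21)) (Load (Add (Const 1) (Reg 6))))))"

definition region_com :: "nat \<Rightarrow> com" where
  "region_com k = For 0 21 3 (For 0 6 1 (region_update k))"

context ram_tree
begin

definition weights_ok :: "state \<Rightarrow> bool" where
  "weights_ok s \<longleftrightarrow> (\<forall>x < n. mem s (1 + x) = w x)"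

definition zero_arrays :: "nat \<Rightarrow> state \<Rightarrow> bool" where
  "zero_arrays a s \<longleftrightarrow> (\<forall>b i. a \<le> b \<longrightarrow> b < 6 \<longrightarrow> arr s b i = 0)"

lemma weights_ok_set_reg [simp]: "weights_ok (set_reg s r v) = weights_ok s"
  by (simp add: weights_ok_def)

lemma weights_ok_set_arr [simp]: "base s \<Longrightarrow> weights_ok (set_arr s a i v) = weights_ok s"
  using n by (simp add: weights_ok_def base_def)

lemma zero_arrays_set_reg [simp]: "r \<noteq> 0 \<Longrightarrow> zero_arrays a (set_reg s r v) = zero_arrays a s"
  by (simp add: zero_arrays_def)

lemma zero_arrays_set_arr [simp]: "b < a \<Longrightarrow> a \<le> 6 \<Longrightarrow> zero_arrays a (set_arr s b i v) = zero_arrays a s"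
  by (simp add: zero_arrays_def)

definition reach :: "nat \<Rightarrow> nat \<Rightarrow> nat set" where
  "reach e j = (\<Union>i\<le>j. (adj E ({..<n} - {tail e}) ^^ i) `` {head e})"

lemma reach_0: "reach e 0 = {head e}"
  by (simp add: reach_def)

lemma reach_Suc: "reach e (Suc j) = reach e j \<union> adj E ({..<n} - {tail e}) `` reach e j"
proof -
  have "reach e (Suc j) = (\<Union>i\<in>insert 0 (Suc ` {..j}). (adj E ({..<n} - {tail e}) ^^ i) `` {head e})"
    by (simp add: reach_def atMost_Suc_eq_insert_0)
  also have "\<dots> = {head e} \<union> adj E ({..<n} - {tail e}) `` reach e j"
    by (auto simp: reach_def)
  finally have eq: "reach e (Suc j) = {head e} \<union> adj E ({..<n} - {tail e}) `` reach e j" .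
  have sub: "reach e j \<subseteq> reach e (Suc j)" by (auto simp: reach_def intro: le_SucI)
  have "head e \<in> reach e j" by (auto simp: reach_def intro: bexI[of _ 0])
  then have "reach e (Suc j) \<subseteq> reach e j \<union> adj E ({..<n} - {tail e}) `` reach e j"
    unfolding eq by auto
  moreover have "adj E ({..<n} - {tail e}) `` reach e j \<subseteq> reach e (Suc j)" unfolding eq by auto
  ultimately show ?thesis using sub by (intro equalityI) simp_all
qed

lemma reach_subset: "e \<in> {1..<M} \<Longrightarrow> reach e j \<subseteq> cut e"
  by (auto simp: reach_def cut_def branch_def relpow_imp_rtrancl)

text \<open>Reachability in a finite relation needs no more steps than the relation has pairs, and
  there are fewer than \<open>M\<close> directed edges.\<close>

lemma reach_M: 
  assumes e: "e \<in> {1..<M}"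
  shows "reach e M = cut e"
proof
  let ?R = "adj E ({..<n} - {tail e})"
  have sub: "?R \<subseteq> edge_pairs" by (auto simp: adj_def edge_pairs_def)
  have fin: "finite ?R" using finite_subset[OF sub finite_edge_pairs] .
  have "card ?R \<le> card edge_pairs" by (rule card_mono[OF finite_edge_pairs sub])
  also have "\<dots> = card {1..<M}" using bij_betw_same_card[OF bij] by simp
  finally have card: "card ?R \<le> M" by simp
  show "cut e \<subseteq> reach e M"
  proof
    fix x assume "x \<in> cut e"
    then have "(head e, x) \<in> ?R\<^sup>*" using e by (auto simp: cut_def branch_def)
    then obtain i where "i \<le> card ?R" "(head e, x) \<in> ?R ^^ i"
      unfolding rtrancl_finite_eq_relpow[OF fin] by auto
    then show "x \<in> reach e M" using card unfolding reach_def by (intro UN_I[of i]) auto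
  qed
qed (rule reach_subset[OF e])

text \<open>
  After \<open>j\<close> rounds for edge \<open>e\<close>, and after the edges below \<open>f\<close> have been relaxed once more, the
  marked nodes lie between \<open>reach e j\<close>, extended along these edges, and \<open>cut e\<close>.
\<close>

definition cut_inv :: "nat \<Rightarrow> nat \<Rightarrow> nat \<Rightarrow> state \<Rightarrow> bool" where
  "cut_inv e j f s \<longleftrightarrow> base s \<and> weights_ok s \<and> zero_arrays 1 s \<and>
     reg s 5 = e \<and> reg s 6 = tail e \<and>
     (\<forall>d < e. \<forall>x < n. arr s 0 (d * n + x) = 0 \<longleftrightarrow> x \<notin> cut d) \<and>
     (\<forall>d > e. \<forall>x < n. arr s 0 (d * n + x) = 0) \<and>
     (\<forall>x < n. arr s 0 (e * n + x) \<noteq> 0 \<longrightarrow> x \<in> cut e) \<and>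
     (\<forall>x \<in> reach e j. arr s 0 (e * n + x) \<noteq> 0) \<and>
     (\<forall>g \<in> {1..<f}. tail g \<in> reach e j \<longrightarrow> head g \<noteq> tail e \<longrightarrow> arr s 0 (e * n + head g) \<noteq> 0)"

definition cuts_below :: "nat \<Rightarrow> state \<Rightarrow> bool" where
  "cuts_below e s \<longleftrightarrow> base s \<and> weights_ok s \<and> zero_arrays 1 s \<and>
     (\<forall>d < e. \<forall>x < n. arr s 0 (d * n + x) = 0 \<longleftrightarrow> x \<notin> cut d) \<and>
     (\<forall>d \<ge> e. \<forall>x < n. arr s 0 (d * n + x) = 0)"

lemma one_less: "1 < N ^ p" "0 < N ^ p"
  using less_bound(1)[of 1] n N by auto

lemma node_less: "x < n \<Longrightarrow> x < N ^ p"
  by (rule less_bound(1)) simp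

lemma wp_cut_relax:
  assumes e: "e \<in> {1..<M}" and f: "f \<in> {1..<M}" and s: "cut_inv e j f s" "reg s 9 = f"
  shows "wp (N ^ p) cut_relax (\<lambda>s'. cut_inv e j (Suc f) s' \<and> reg s' 9 = f \<and> reg s' 8 = reg s 8) s"
proof -
  have b: "base s" using s by (simp add: cut_inv_def)
  have c: "tail f < n" "head f < n" "tail e < n" using tail_less head_less e f by auto
  have [simp]: "eval (TailE (Reg 9)) s = tail f" using eval_TailE[OF b, of "Reg 9"] s f by simp
  have hd [simp]: "eval (HeadE (Reg 9)) (set_reg s 10 (tail f)) = head f"
    using eval_HeadE[of "set_reg s 10 (tail f)" "Reg 9"] b s f by simp
  \<comment> \<open>Marking never leaves \<open>cut e\<close>: the only way out of the branch is
    through \<open>tail e\<close>, which the program refuses to mark.\<close>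
  have step: "head f \<in> cut e" if "tail f \<in> cut e" "head f \<noteq> tail e"
  proof -
    have "tail f \<noteq> tail e" using that tail_cut[OF e] by auto
    then show ?thesis using branch_step[OF _ edge[OF f], of "tail e" "head e"] that e
      by (simp add: cut_def)
  qed
  show ?thesis
  proof (cases "arr s 0 (e * n + tail f) \<noteq> 0 \<and> head f \<noteq> tail e")
    case True
    then have hd: "head f \<in> cut e" using step s(1) c by (auto simp: cut_inv_def)
    let ?s = "set_arr (set_reg (set_reg s 10 (tail f)) 11 (head f)) 0 (e * n + head f) 1"
    have arr0: "arr ?s 0 (d * n + x) = (if d = e \<and> x = head f then 1 else arr s 0 (d * n + x))"
      if "x < n" for d x using that c by (auto simp: pair_eq_iff)
    have R: "reach e j \<subseteq> {..<n}"
      using reach_subset[OF e] branch_subset[OF edge[OF e]] e by (auto simp: cut_def)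
    have "cut_inv e j (Suc f) ?s"
      unfolding cut_inv_def
    proof (intro conjI ballI impI)
      fix x assume "x \<in> reach e j"
      then show "arr ?s 0 (e * n + x) \<noteq> 0"
        using R arr0[of x e] s(1) by (auto simp: cut_inv_def)
    next
      fix g assume g: "g \<in> {1..<Suc f}" "tail g \<in> reach e j" "head g \<noteq> tail e"
      then have "head g < n" using f head_less[of g] by auto
      then show "arr ?s 0 (e * n + head g) \<noteq> 0"
        using g arr0[of "head g" e] s(1) by (auto simp: cut_inv_def less_Suc_eq)
    qed (use s(1) hd arr0 in \<open>simp_all add: cut_inv_def\<close>)
    then show ?thesis
      using True s node_less[OF c(1)] node_less[OF c(2)] one_less baseD[OF b]
      by (simp add: cut_relax_def cut_inv_def)
  next
    case False
    then have "tail f \<in> reach e j \<Longrightarrow> head f = tail e"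
      using s(1) unfolding cut_inv_def by blast
    then have "cut_inv e j (Suc f) (set_reg (set_reg s 10 (tail f)) 11 (head f))"
      using s(1) by (auto simp: cut_inv_def less_Suc_eq)
    then show ?thesis
      using False s node_less[OF c(1)] node_less[OF c(2)] baseD[OF b]
      by (cases "arr s 0 (e * n + tail f) = 0") (simp_all add: cut_relax_def cut_inv_def)
  qed
qed

lemma triple_cut_round:
  assumes e: "e \<in> {1..<M}"
  shows "triple N p (\<lambda>s. cut_inv e j 1 s \<and> reg s 8 = j) (For 1 9 2 cut_relax)
    (6 + M * (com_time cut_relax + 8)) (\<lambda>s. cut_inv e (Suc j) 1 s \<and> reg s 8 = j)"
proof (rule triple_weaken[OF triple_For_const[where I = "\<lambda>f s. cut_inv e j f s \<and> reg s 8 = j"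
      and L = M and K = "com_time cut_relax"]])
  fix s assume s: "cut_inv e j M s \<and> reg s 8 = j"
  \<comment> \<open>A node that is new in \<open>reach e (Suc j)\<close> is the head of an edge with
    tail in \<open>reach e j\<close>, and every edge has been relaxed in this round.\<close>
  have "arr s 0 (e * n + y) \<noteq> 0" if y: "y \<in> reach e (Suc j)" for y
  proof (cases "y \<in> reach e j")
    case False
    then obtain x where x: "x \<in> reach e j" "(x, y) \<in> adj E ({..<n} - {tail e})"
      using y reach_Suc by auto
    then obtain g where "g \<in> {1..<M}" "tail g = x" "head g = y"
      using edge_surj[of x y] by (auto simp: adj_def)
    then show ?thesis using s x by (auto simp: cut_inv_def adj_def)
  qed (use s in \<open>auto simp: cut_inv_def\<close>)
  then show "cut_inv e (Suc j) 1 s \<and> reg s 8 = j" using s by (auto simp: cut_inv_def)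
next
  fix i assume i: "1 \<le> i" "i < M"
  show "triple N p (\<lambda>s. (cut_inv e j i s \<and> reg s 8 = j) \<and> reg s 9 = i) cut_relax
      (com_time cut_relax) (\<lambda>s. (cut_inv e j (Suc i) s \<and> reg s 8 = j) \<and> reg s 9 = i)"
  proof (rule triple_straight[OF N])
    fix s assume s: "(cut_inv e j i s \<and> reg s 8 = j) \<and> reg s 9 = i"
    show "wp (N ^ p) cut_relax (\<lambda>s. (cut_inv e j (Suc i) s \<and> reg s 8 = j) \<and> reg s 9 = i) s"
      by (rule wp_mono[OF wp_cut_relax[OF e]]) (use s i in auto)
  qed
qed (use N M_pos in \<open>auto simp: cut_inv_def base_def\<close>)

lemma triple_cut_edge:
  assumes e: "e \<in> {1..<M}"
  shows "triple N p (\<lambda>s. cuts_below e s \<and> reg s 5 = e)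
    (Seq cut_init (For 0 8 2 (For 1 9 2 cut_relax)))
    (com_time cut_init + (6 + M * (6 + M * (com_time cut_relax + 8) + 8)))
    (\<lambda>s. cuts_below (Suc e) s \<and> reg s 5 = e)"
proof (rule triple_Seq)
  show "triple N p (\<lambda>s. cuts_below e s \<and> reg s 5 = e) cut_init (com_time cut_init) (cut_inv e 0 1)"
  proof (rule triple_straight[OF N])
    fix s assume s: "cuts_below e s \<and> reg s 5 = e"
    then have b: "base s" by (simp add: cuts_below_def)
    have c: "head e < n" "tail e < n" using tail_less head_less e by auto
    have [simp]: "eval (TailE (Reg 5)) s = tail e" using eval_TailE[OF b, of "Reg 5"] s e by simp
    have [simp]: "eval (HeadE (Reg 5)) (set_reg s 6 (tail e)) = head e"
      using eval_HeadE[of "set_reg s 6 (tail e)" "Reg 5"] b s e by simp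
    show "wp (N ^ p) cut_init (cut_inv e 0 1) s"
      using s c b baseD[OF b] node_less one_less head_cut[OF e]
      by (simp add: cut_init_def cut_inv_def cuts_below_def reach_0 pair_eq_iff)
  qed
next
  show "triple N p (cut_inv e 0 1) (For 0 8 2 (For 1 9 2 cut_relax))
    (6 + M * (6 + M * (com_time cut_relax + 8) + 8)) (\<lambda>s. cuts_below (Suc e) s \<and> reg s 5 = e)"
  proof (rule triple_weaken[OF triple_For_const[where I = "\<lambda>j. cut_inv e j 1"
      and L = M and K = "6 + M * (com_time cut_relax + 8)"]])
    fix s assume s: "cut_inv e M 1 s"
    show "cuts_below (Suc e) s \<and> reg s 5 = e"
      unfolding cuts_below_def
    proof (intro conjI allI impI)
      fix d x assume d: "d < Suc e" and x: "x < n"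
      show "arr s 0 (d * n + x) = 0 \<longleftrightarrow> x \<notin> cut d"
      proof (cases "d = e")
        case True
        have "x \<in> cut e \<Longrightarrow> arr s 0 (e * n + x) \<noteq> 0" using s reach_M[OF e] by (simp add: cut_inv_def)
        moreover have "arr s 0 (e * n + x) \<noteq> 0 \<Longrightarrow> x \<in> cut e" using s x by (simp add: cut_inv_def)
        ultimately show ?thesis unfolding True by blast
      next
        case False
        then show ?thesis using s d x by (simp add: cut_inv_def)
      qed
    qed (use s in \<open>simp_all add: cut_inv_def\<close>)
  next
    fix j
    show "triple N p (\<lambda>s. cut_inv e j 1 s \<and> reg s 8 = j) (For 1 9 2 cut_relax)
      (6 + M * (com_time cut_relax + 8)) (\<lambda>s. cut_inv e (Suc j) 1 s \<and> reg s 8 = j)"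
      by (rule triple_cut_round[OF e])
  qed (use N M_pos in \<open>auto simp: cut_inv_def base_def cuts_below_def\<close>)
qed

definition cut_time :: nat where
  "cut_time = 6 + M * (com_time cut_init + (6 + M * (6 + M * (com_time cut_relax + 8) + 8)) + 8)"

lemma triple_cut_com:
  "triple N p (\<lambda>s. base s \<and> weights_ok s \<and> zero_arrays 0 s) cut_com cut_time
    (\<lambda>s. base s \<and> weights_ok s \<and> zero_arrays 1 s \<and> cuts_ok s)"
  unfolding cut_com_def cut_time_def
proof (rule triple_weaken[OF triple_For_const[where I = cuts_below and L = M
      and K = "com_time cut_init + (6 + M * (6 + M * (com_time cut_relax + 8) + 8))"]])
  fix s assume "base s \<and> weights_ok s \<and> zero_arrays 0 s"
  then show "cuts_below 1 s" by (auto simp: cuts_below_def zero_arrays_def)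
next
  fix e assume "1 \<le> e" "e < M"
  then show "triple N p (\<lambda>s. cuts_below e s \<and> reg s 5 = e)
      (Seq cut_init (For 0 8 2 (For 1 9 2 cut_relax)))
      (com_time cut_init + (6 + M * (6 + M * (com_time cut_relax + 8) + 8)))
      (\<lambda>s. cuts_below (Suc e) s \<and> reg s 5 = e)"
    by (intro triple_cut_edge) simp
qed (use N M_pos in \<open>auto simp: cuts_below_def cuts_ok_def base_def\<close>)

definition regions_inv :: "nat \<Rightarrow> nat \<Rightarrow> state \<Rightarrow> bool" where
  "regions_inv c x s \<longleftrightarrow> base s \<and> weights_ok s \<and> zero_arrays 3 s \<and> cuts_ok s \<and>
     (\<forall>b < c. arr s 1 b = card (H b) \<and> arr s 2 b = sum w (H b)) \<and>
     arr s 1 c = card (H c \<inter> {..<x}) \<and> arr s 2 c = sum w (H c \<inter> {..<x}) \<and>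
     (\<forall>b > c. arr s 1 b = 0 \<and> arr s 2 b = 0)"

lemma weight_bound: "A \<subseteq> {..<n} \<Longrightarrow> sum w A < bound" "A \<subseteq> {..<n} \<Longrightarrow> sum w A < N ^ p"
proof -
  assume A: "A \<subseteq> {..<n}"
  have "sum w A \<le> sum w {..<n}" by (rule sum_mono2) (use A in auto)
  also have "\<dots> \<le> 2 * n * sum w {..<n}" using n by simp
  finally show *: "sum w A < bound" by (simp add: value_bound_def)
  show "sum w A < N ^ p" by (rule less_bound(3)) (use * in \<open>simp add: less_imp_le trans_le_add1\<close>)
qed

lemma wp_region_update:
  assumes s: "regions_inv c x s" "reg s 21 = c" "reg s 6 = x" and x: "x < n"
  shows "wp (N ^ p) (region_update k)
    (\<lambda>s. (regions_inv c (Suc x) s \<and> reg s 21 = c) \<and> reg s 6 = x) s"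
proof -
  have b: "base s" "cuts_ok s" "weights_ok s" using s by (auto simp: regions_inv_def)
  have out: "eval (OutE k (Reg 21) (Reg 6)) s = 0 \<longleftrightarrow> x \<in> H c"
    using eval_OutE[OF b(1,2), of "Reg 6"] s x by simp
  have w: "mem s (Suc x) = w x" using b(3) x by (simp add: weights_ok_def)
  show ?thesis
  proof (cases "x \<in> H c")
    case True
    then have ins: "H c \<inter> {..<Suc x} = insert x (H c \<inter> {..<x})" by auto
    have "card (insert x (H c \<inter> {..<x})) \<le> card {..<n}"
      using True region_subset by (intro card_mono) auto
    then have "card (insert x (H c \<inter> {..<x})) < N ^ p" using node_less less_bound(1) by simp
    moreover have "sum w (insert x (H c \<inter> {..<x})) < N ^ p"
      by (rule weight_bound) (use True region_subset in auto)
    moreover have "Suc x < reg s 0" using x baseD(1)[OF b(1)] by simp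
    ultimately show ?thesis using s b w out True
      by (simp add: region_update_def regions_inv_def ins add.commute)
  next
    case False
    then have "H c \<inter> {..<Suc x} = H c \<inter> {..<x}" by (auto simp: less_Suc_eq)
    then show ?thesis using s out False by (simp add: region_update_def regions_inv_def)
  qed
qed

definition region_time :: nat where
  "region_time = 6 + M ^ k * (6 + n * (com_time (region_update k) + 8) + 8)"

lemma triple_region_com:
  "triple N p (\<lambda>s. base s \<and> weights_ok s \<and> zero_arrays 1 s \<and> cuts_ok s) (region_com k) region_time
    (\<lambda>s. base s \<and> zero_arrays 3 s \<and> cuts_ok s \<and>
      (\<forall>b < M ^ k. arr s 1 b = card (H b) \<and> arr s 2 b = sum w (H b)))"
  unfolding region_com_def region_time_def
proof (rule triple_weaken[OF triple_For_const[where I = "\<lambda>c. regions_inv c 0"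
      and L = "M ^ k" and K = "6 + n * (com_time (region_update k) + 8)"]])
  fix c assume c: "c < M ^ k"
  show "triple N p (\<lambda>s. regions_inv c 0 s \<and> reg s 21 = c) (For 0 6 1 (region_update k))
     (6 + n * (com_time (region_update k) + 8)) (\<lambda>s. regions_inv (Suc c) 0 s \<and> reg s 21 = c)"
  proof (rule triple_weaken[OF triple_For_const[where I = "\<lambda>x s. regions_inv c x s \<and> reg s 21 = c"
      and L = n and K = "com_time (region_update k)"]])
    fix s assume s: "regions_inv c n s \<and> reg s 21 = c"
    have "H c \<inter> {..<n} = H c" using region_subset by auto
    then show "regions_inv (Suc c) 0 s \<and> reg s 21 = c"
      using s by (auto simp: regions_inv_def less_Suc_eq)
  next
    fix x assume "x < n"
    then show "triple N p (\<lambda>s. (regions_inv c x s \<and> reg s 21 = c) \<and> reg s 6 = x) (region_update k)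
      (com_time (region_update k)) (\<lambda>s. (regions_inv c (Suc x) s \<and> reg s 21 = c) \<and> reg s 6 = x)"
      by (intro triple_straight[OF N] wp_region_update) auto
  qed (use N in \<open>auto simp: regions_inv_def base_def\<close>)
next
  fix s assume "base s \<and> weights_ok s \<and> zero_arrays 1 s \<and> cuts_ok s"
  then show "regions_inv 0 0 s" by (auto simp: regions_inv_def zero_arrays_def)
qed (use N in \<open>auto simp: regions_inv_def base_def\<close>)

end

section \<open>Filling the table\<close>

definition accumulate :: "exp \<Rightarrow> com" where
  "accumulate v = ArrS 3 (PairE (Reg 21) (Reg 9)) (Add (ArrE 3 (PairE (Reg 21) (Reg 9))) v)"

definition relax_com :: "nat \<Rightarrow> com" where
  "relax_com k =
    Seq (Assign 8 (TailE (Reg 20)))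
   (Seq (Assign 9 (HeadE (Reg 20)))
        (Cond (Add (OutE k (Reg 21) (Reg 8)) (OutE k (Reg 21) (Reg 9))) Skip
          (Seq (push_com k)
               (Cond (Reg 25) (accumulate (Reg 4)) (accumulate (ArrE 4 (Reg 23)))))))"

definition RootCostE :: exp where
  "RootCostE = Add (ArrE 2 (Reg 21)) (ArrE 3 (PairE (Reg 21) (Reg 7)))"

definition best_com :: "nat \<Rightarrow> com" where
  "best_com k =
    Cond (OutE k (Reg 21) (Reg 7)) Skip
      (Cond (Sub (ArrE 4 (Reg 21)) RootCostE)
        (Seq (ArrS 4 (Reg 21) RootCostE) (ArrS 5 (Reg 21) (Reg 7)))
        Skip)"

definition process_com :: "nat \<Rightarrow> com" where
  "process_com k =
    Seq (For 1 20 2 (relax_com k)) (Seq (ArrS 4 (Reg 21) (Reg 4)) (For 0 7 1 (best_com k)))"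

text \<open>The round counter starts at \<open>0\<close>, so round \<open>i\<close> treats regions
  of size \<open>i + 1\<close>; empty regions are never processed.\<close>

definition size_test :: exp where
  "size_test = NeqE (ArrE 1 (Reg 21)) (Add (Reg 5) (Const 1))"

definition dp_com :: "nat \<Rightarrow> com" where
  "dp_com k = For 0 5 1 (For 0 21 3 (Cond size_test Skip (process_com k)))"

context ram_tree
begin

definition pushed :: "nat \<Rightarrow> nat \<Rightarrow> nat" where
  "pushed f c = undigits M (fst (push f f (dig c)))"

definition child_val :: "(nat \<Rightarrow> nat) \<Rightarrow> nat \<Rightarrow> nat \<Rightarrow> nat" where
  "child_val v f c = (if snd (push f f (dig c)) = 0 then v (pushed f c) else bound)"

definition root_val :: "(nat \<Rightarrow> nat) \<Rightarrow> nat \<Rightarrow> nat \<Rightarrow> nat \<Rightarrow> nat" where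
  "root_val v c r f = (\<Sum>g\<in>incoming (dig c) r \<inter> {..<f}. child_val v g c)"

text \<open>The condition \<open>entry\<close> expressed for code numbers instead of digit
  lists.\<close>

definition code_entry :: "(nat \<Rightarrow> nat) \<Rightarrow> (nat \<Rightarrow> nat) \<Rightarrow> nat \<Rightarrow> bool" where
  "code_entry v ch c \<longleftrightarrow>
    (\<forall>r \<in> H c. v c \<le> sum w (H c) + root_val v c r M) \<and>
    (v c < bound \<longrightarrow> ch c \<in> H c \<and> v c = sum w (H c) + root_val v c (ch c) M)"

lemma dig_pushed: "f < M \<Longrightarrow> dig (pushed f c) = fst (push f f (dig c))"
  unfolding pushed_def using digits_undigits[of "fst (push f f (dig c))" M] push_range[OF dig_range]
  by simp

lemma pushed_less: "f < M \<Longrightarrow> pushed f c < M ^ k"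
  unfolding pushed_def using undigits_less[of "fst (push f f (dig c))" M] push_range[OF dig_range]
  by simp

lemma H_pushed:
  assumes "f \<in> {1..<M}" "tail f \<in> H c" "snd (push f f (dig c)) = 0"
  shows "H (pushed f c) = H c - cut f"
  using region_push[OF dig_range assms] dig_pushed[of f c] assms by simp

lemma card_H_pushed:
  assumes "f \<in> incoming (dig c) r" "r \<in> H c" "snd (push f f (dig c)) = 0"
  shows "card (H (pushed f c)) < card (H c)"
proof -
  have f: "f \<in> {1..<M}" "tail f \<in> H c" "head f \<in> H c" using assms by (auto simp: incoming_def)
  have "H c - cut f \<subset> H c" using f head_cut[OF f(1)] by auto
  then show ?thesis using H_pushed[OF f(1,2) assms(3)] by (simp add: psubset_card_mono)
qed

text \<open>Children have strictly smaller regions, so writing the value of \<open>b\<close>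
  disturbs no code whose region is at most as large. This is why filling the table by region size
  works.\<close>

lemma child_val_upd:
  assumes "f \<in> incoming (dig c) r" "r \<in> H c" "card (H c) \<le> card (H b)"
  shows "child_val (v(b := z)) f c = child_val v f c"
  using card_H_pushed[OF assms(1,2)] assms(3) by (auto simp: child_val_def)

lemma root_val_upd:
  "r \<in> H c \<Longrightarrow> card (H c) \<le> card (H b) \<Longrightarrow> root_val (v(b := z)) c r f = root_val v c r f"
  unfolding root_val_def by (rule sum.cong) (auto intro: child_val_upd)

lemma code_entry_upd:
  assumes "code_entry v ch c" "c \<noteq> b" "card (H c) \<le> card (H b)"
  shows "code_entry (v(b := z)) (ch(b := y)) c"
  using assms by (auto simp: code_entry_def root_val_upd)

definition finished :: "nat \<Rightarrow> nat \<Rightarrow> nat \<Rightarrow> bool" where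
  "finished i c b \<longleftrightarrow> H b \<noteq> {} \<and> (card (H b) \<le> i \<or> card (H b) = Suc i \<and> b < c)"

definition regions_ok :: "state \<Rightarrow> bool" where
  "regions_ok s \<longleftrightarrow> (\<forall>b < M ^ k. arr s 1 b = card (H b) \<and> arr s 2 b = sum w (H b))"

text \<open>\<open>c\<close> separates finished codes from pending ones, and \<open>c'\<close> used
  accumulators from those still zero. While \<open>c\<close> itself is processed its accumulators
  are in use but its entry is not finished, so the two differ by one.\<close>

definition dp_inv :: "nat \<Rightarrow> nat \<Rightarrow> nat \<Rightarrow> state \<Rightarrow> bool" where
  "dp_inv i c c' s \<longleftrightarrow> base s \<and> cuts_ok s \<and> regions_ok s \<and> reg s 4 = bound \<and>
     (\<forall>b. arr s 4 b \<le> bound) \<and>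
     (\<forall>b < M ^ k. finished i c b \<longrightarrow> code_entry (arr s 4) (arr s 5) b) \<and>
     (\<forall>b < M ^ k. card (H b) > Suc i \<or> card (H b) = Suc i \<and> c' \<le> b \<longrightarrow>
        (\<forall>r < n. arr s 3 (b * n + r) = 0))"

definition relax_inv :: "nat \<Rightarrow> nat \<Rightarrow> nat \<Rightarrow> state \<Rightarrow> bool" where
  "relax_inv i c f s \<longleftrightarrow> dp_inv i c (Suc c) s \<and> reg s 5 = i \<and> reg s 21 = c \<and>
     (\<forall>r \<in> H c. arr s 3 (c * n + r) = root_val (arr s 4) c r f)"

definition best_inv :: "nat \<Rightarrow> nat \<Rightarrow> nat \<Rightarrow> state \<Rightarrow> bool" where
  "best_inv i c x s \<longleftrightarrow> relax_inv i c M s \<and>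
     (\<forall>r \<in> H c. r < x \<longrightarrow> arr s 4 c \<le> sum w (H c) + root_val (arr s 4) c r M) \<and>
     (arr s 4 c < bound \<longrightarrow> arr s 5 c \<in> H c \<and>
        arr s 4 c = sum w (H c) + root_val (arr s 4) c (arr s 5 c) M)"

lemma regions_ok_set_reg [simp]: "r \<noteq> 0 \<Longrightarrow> regions_ok (set_reg s r v) = regions_ok s"
  by (simp add: regions_ok_def)

lemma regions_ok_set_arr [simp]: "a < 6 \<Longrightarrow> a > 2 \<Longrightarrow> regions_ok (set_arr s a i v) = regions_ok s"
  by (simp add: regions_ok_def)

lemma push_frame_regions_ok: "push_frame s s' \<Longrightarrow> regions_ok s' = regions_ok s"
  by (simp add: regions_ok_def push_frame_arr)

lemma dp_inv_set_reg [simp]: "r > 4 \<Longrightarrow> dp_inv i c c' (set_reg s r v) = dp_inv i c c' s"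
  by (simp add: dp_inv_def)

lemma push_frame_dp_inv: "push_frame s s' \<Longrightarrow> dp_inv i c c' s' = dp_inv i c c' s"
  by (simp add: dp_inv_def push_frame_base push_frame_cuts_ok push_frame_regions_ok push_frame_arr)
     (simp add: push_frame_def)

lemma dp_inv_set_acc:
  assumes "dp_inv i c (Suc c) s" "r < n" and c: "card (H c) = Suc i"
  shows "dp_inv i c (Suc c) (set_arr s 3 (c * n + r) v)"
  unfolding dp_inv_def
proof (intro conjI allI impI)
  fix b x assume b: "b < M ^ k" "card (H b) > Suc i \<or> card (H b) = Suc i \<and> Suc c \<le> b" and x: "x < n"
  then have "b \<noteq> c" using c by auto
  then have "b * n + x \<noteq> c * n + r" using pair_eq_iff[OF x assms(2)] by simp
  then show "arr (set_arr s 3 (c * n + r) v) 3 (b * n + x) = 0"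
    using assms(1) b x by (auto simp: dp_inv_def)
qed (use assms in \<open>simp_all add: dp_inv_def\<close>)

lemma dp_inv_set_val:
  assumes s: "dp_inv i c c' s" and c: "card (H c) = Suc i" and z: "z \<le> bound"
  shows "dp_inv i c c' (set_arr s 4 c z)" "dp_inv i c c' (set_arr s 5 c y)"
proof -
  have *: "code_entry ((arr s 4)(c := z)) ((arr s 5)(c := y)) b" if "b < M ^ k" "finished i c b" for b z y
    using s that c by (intro code_entry_upd) (auto simp: dp_inv_def finished_def)
  have 4: "code_entry ((arr s 4)(c := z)) (arr s 5) b" if "b < M ^ k" "finished i c b" for b
    using *[OF that, of z "arr s 5 c"] by simp
  have 5: "code_entry (arr s 4) ((arr s 5)(c := y)) b" if "b < M ^ k" "finished i c b" for b
    using *[OF that, of "arr s 4 c" y] by simp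
  show "dp_inv i c c' (set_arr s 4 c z)" using s 4 z by (simp add: dp_inv_def)
  show "dp_inv i c c' (set_arr s 5 c y)" using s 5 by (simp add: dp_inv_def)
qed

lemma child_val_le: "(\<And>b. v b \<le> bound) \<Longrightarrow> child_val v f c \<le> bound"
  by (simp add: child_val_def)

lemma root_val_le:
  assumes "\<And>b. v b \<le> bound"
  shows "root_val v c r f \<le> M * bound"
proof -
  have "root_val v c r f \<le> card (incoming (dig c) r \<inter> {..<f}) * bound"
    unfolding root_val_def using sum_bounded_above[of _ "\<lambda>g. child_val v g c" bound] child_val_le[OF assms]
    by simp
  also have "card (incoming (dig c) r \<inter> {..<f}) \<le> card {1..<M}"
    by (rule card_mono) (auto simp: incoming_def)
  then have "card (incoming (dig c) r \<inter> {..<f}) * bound \<le> M * bound"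
    by (intro mult_le_mono1) simp
  finally show ?thesis .
qed

lemma root_val_Suc:
  assumes "f \<in> {1..<M}"
  shows "root_val v c r (Suc f) = root_val v c r f +
    (if head f = r \<and> tail f \<in> H c then child_val v f c else 0)"
proof (cases "head f = r \<and> tail f \<in> H c")
  case True
  then have "incoming (dig c) r \<inter> {..<Suc f} = insert f (incoming (dig c) r \<inter> {..<f})"
    using assms by (auto simp: incoming_def)
  then show ?thesis using True by (simp add: root_val_def)
next
  case False
  then have "incoming (dig c) r \<inter> {..<Suc f} = incoming (dig c) r \<inter> {..<f}"
    by (auto simp: incoming_def less_Suc_eq)
  then show ?thesis using False by (auto simp: root_val_def)
qed

lemma H_less: "r \<in> H c \<Longrightarrow> r < n"
  using region_subset by auto

lemma wp_relax_com:
  assumes f: "f \<in> {1..<M}" and s: "relax_inv i c f s" "reg s 20 = f"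
    and c: "c < M ^ k" "card (H c) = Suc i"
  shows "wp (N ^ p) (relax_com k) (\<lambda>s. relax_inv i c (Suc f) s \<and> reg s 20 = f) s"
proof -
  let ?Q = "\<lambda>s. relax_inv i c (Suc f) s \<and> reg s 20 = f"
  have b: "base s" "cuts_ok s" using s by (auto simp: relax_inv_def dp_inv_def)
  have tn: "tail f < n" "head f < n" using tail_less head_less f by auto
  have [simp]: "eval (TailE (Reg 20)) s = tail f" using eval_TailE[OF b(1), of "Reg 20"] s f by simp
  have [simp]: "eval (HeadE (Reg 20)) (set_reg s 8 (tail f)) = head f"
    using eval_HeadE[of "set_reg s 8 (tail f)" "Reg 20"] b s f by simp
  let ?s = "set_reg (set_reg s 8 (tail f)) 9 (head f)"
  have inv: "dp_inv i c (Suc c) ?s" using s by (simp add: relax_inv_def)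
  have c21: "reg ?s 21 = c" "reg ?s 20 = f" using s by (simp_all add: relax_inv_def)
  have out: "eval (OutE k (Reg 21) (Reg 8)) ?s = 0 \<longleftrightarrow> tail f \<in> H c"
    "eval (OutE k (Reg 21) (Reg 9)) ?s = 0 \<longleftrightarrow> head f \<in> H c"
    using eval_OutE[of ?s "Reg 8" k "Reg 21"] eval_OutE[of ?s "Reg 9" k "Reg 21"] b tn c21 by simp_all
  show ?thesis
  proof (cases "tail f \<in> H c \<and> head f \<in> H c")
    case False
    then have "root_val v c r (Suc f) = root_val v c r f" if "r \<in> H c" for r v
      using root_val_Suc[OF f, of v c r] that by auto
    then have "relax_inv i c (Suc f) ?s" using s(1) by (simp add: relax_inv_def)
    then show ?thesis using False out c21 node_less[OF tn(1)] node_less[OF tn(2)]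
      by (auto simp: relax_com_def)
  next
    case True
    \<comment> \<open>Serves both outcomes of the push: the sentinel in register 4 and the table
      entry each equal \<open>child_val\<close>.\<close>
    have acc: "wp (N ^ p) (accumulate e) ?Q s'"
      if s': "push_frame ?s s'" and e: "eval e s' = child_val (arr s 4) f c" for e s'
    proof -
      have r: "reg s' 21 = c" "reg s' 20 = f" "reg s' 9 = head f" "reg s' 5 = i"
        using s' s by (auto simp: push_frame_def relax_inv_def)
      have dp: "dp_inv i c (Suc c) s'" using inv push_frame_dp_inv[OF s'] by simp
      then have n': "reg s' 1 = n" "\<And>b. arr s' 4 b \<le> bound" by (auto simp: dp_inv_def baseD)
      have ar: "arr s' = arr s" using push_frame_arr[OF s'] by simp
      let ?v = "arr s 3 (c * n + head f) + child_val (arr s 4) f c"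
      have old: "arr s 3 (c * n + r) = root_val (arr s 4) c r f" if "r \<in> H c" for r
        using s that by (simp add: relax_inv_def)
      have "?v \<le> M * bound + bound"
        using old True root_val_le[of "arr s 4" c "head f" f] child_val_le[of "arr s 4" f c] n'(2) ar
        by (intro add_mono) auto
      then have lt: "?v < N ^ p" by (intro less_bound(3)) (simp add: algebra_simps)
      have "relax_inv i c (Suc f) (set_arr s' 3 (c * n + head f) ?v)"
        using dp_inv_set_acc[OF dp tn(2) c(2)] r old True root_val_Suc[OF f] H_less
        by (auto simp: relax_inv_def ar pair_eq_iff)
      then show ?thesis using e r n'(1) ar lt by (simp add: accumulate_def)
    qed
    have "wp (N ^ p) (push_com k) (wp (N ^ p)
        (Cond (Reg 25) (accumulate (Reg 4)) (accumulate (ArrE 4 (Reg 23))))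
        ?Q) ?s"
    proof (rule wp_push_com)
      fix s' assume s': "push_frame ?s s'"
        and r23: "reg s' 23 = undigits M (fst (push (reg ?s 20) (reg ?s 20) (dig (reg ?s 21))))"
        and r25: "reg s' 25 = snd (push (reg ?s 20) (reg ?s 20) (dig (reg ?s 21)))"
      have r: "reg s' 23 = pushed f c" "reg s' 25 = snd (push f f (dig c))"
        using r23 r25 c21 by (simp_all add: pushed_def)
      have "dp_inv i c (Suc c) s'" using inv push_frame_dp_inv[OF s'] by simp
      then have "reg s' 4 = bound" by (simp add: dp_inv_def)
      moreover have "arr s' 4 = arr s 4" using push_frame_arr[OF s'] by simp
      ultimately show "wp (N ^ p) (Cond (Reg 25) (accumulate (Reg 4)) (accumulate (ArrE 4 (Reg 23))))
        ?Q s'"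
        using acc[OF s', of "Reg 4"] acc[OF s', of "ArrE 4 (Reg 23)"] r by (simp add: child_val_def)
    qed (use b f c c21 in simp_all)
    then show ?thesis using True out node_less[OF tn(1)] node_less[OF tn(2)]
      by (simp add: relax_com_def)
  qed
qed

text \<open>Starting the minimum at \<open>bound\<close> realises the truncation: no root has been
  recorded yet, and the claim about the recorded root is vacuous.\<close>

lemma best_inv_start:
  assumes s: "relax_inv i c M s" and c: "c < M ^ k" "card (H c) = Suc i"
  shows "wp (N ^ p) (ArrS 4 (Reg 21) (Reg 4)) (best_inv i c 0) s"
proof -
  have dp: "dp_inv i c (Suc c) s" and r: "reg s 21 = c" "reg s 4 = bound"
    using s by (auto simp: relax_inv_def dp_inv_def)
  have "best_inv i c 0 (set_arr s 4 c bound)"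
    using s dp_inv_set_val(1)[OF dp c(2), of bound]
    by (auto simp: best_inv_def relax_inv_def root_val_upd)
  moreover have "bound < N ^ p" by (rule less_bound(3)) simp
  ultimately show ?thesis using r by simp
qed

lemma wp_best_com:
  assumes x: "x < n" and s: "best_inv i c x s" "reg s 7 = x"
    and c: "c < M ^ k" "card (H c) = Suc i"
  shows "wp (N ^ p) (best_com k) (\<lambda>s. best_inv i c (Suc x) s \<and> reg s 7 = x) s"
proof -
  have dp: "dp_inv i c (Suc c) s" and r: "reg s 21 = c" "reg s 5 = i"
    using s by (auto simp: best_inv_def relax_inv_def)
  have b: "base s" "cuts_ok s" using dp by (auto simp: dp_inv_def)
  have le: "\<And>b. arr s 4 b \<le> bound" using dp by (simp add: dp_inv_def)
  have out: "eval (OutE k (Reg 21) (Reg 7)) s = 0 \<longleftrightarrow> x \<in> H c"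
    using eval_OutE[OF b, of "Reg 7" k "Reg 21"] x s(2) r by simp
  show ?thesis
  proof (cases "x \<in> H c")
    case False
    then have "best_inv i c (Suc x) s" using s(1) by (auto simp: best_inv_def less_Suc_eq)
    then show ?thesis using False out s by (simp add: best_com_def)
  next
    case True
    let ?z = "sum w (H c) + root_val (arr s 4) c x M"
    have z: "eval RootCostE s = ?z"
      using s dp c(1) True r baseD[OF b(1)]
      by (simp add: RootCostE_def best_inv_def relax_inv_def dp_inv_def regions_ok_def)
    show ?thesis
    proof (cases "?z < arr s 4 c")
      case False
      then have "best_inv i c (Suc x) s" using s(1) by (auto simp: best_inv_def less_Suc_eq)
      then show ?thesis using False True out s z r by (simp add: best_com_def)
    next
      case lt: True
      then have zb: "?z < bound" using le[of c] by linarith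
      let ?s = "set_arr (set_arr s 4 c ?z) 5 c x"
      have dp': "dp_inv i c (Suc c) ?s"
        by (rule dp_inv_set_val(2)[OF dp_inv_set_val(1)[OF dp c(2)] c(2), where z = 0])
           (use zb in simp_all)
      \<comment> \<open>The new value at \<open>c\<close> does not change the costs of the roots of
        \<open>c\<close>, which depend on smaller regions only.\<close>
      have "best_inv i c (Suc x) ?s"
        using s(1) dp' r True lt
        by (auto simp: best_inv_def relax_inv_def root_val_upd less_Suc_eq)
      moreover have "?z < N ^ p" "x < N ^ p"
        using zb node_less[OF x] by (auto intro!: less_bound(3))
      ultimately show ?thesis using True lt out s(2) z r by (simp add: best_com_def)
    qed
  qed
qed

definition process_time :: nat where
  "process_time = 6 + M * (com_time (relax_com k) + 8) +
     (com_time (ArrS 4 (Reg 21) (Reg 4)) + (6 + n * (com_time (best_com k) + 8)))"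

lemma triple_process_com:
  assumes c: "c < M ^ k" "card (H c) = Suc i"
  shows "triple N p (\<lambda>s. dp_inv i c c s \<and> reg s 5 = i \<and> reg s 21 = c) (process_com k) process_time
    (\<lambda>s. dp_inv i (Suc c) (Suc c) s \<and> reg s 5 = i \<and> reg s 21 = c)"
  unfolding process_com_def process_time_def
proof -
  let ?P = "\<lambda>s. dp_inv i c c s \<and> reg s 5 = i \<and> reg s 21 = c"
  let ?Q = "\<lambda>s. dp_inv i (Suc c) (Suc c) s \<and> reg s 5 = i \<and> reg s 21 = c"
  let ?relax = "com_time (relax_com k)" and ?best = "com_time (best_com k)"
    and ?store = "com_time (ArrS 4 (Reg 21) (Reg 4))"
  show "triple N p ?P (Seq (For 1 20 2 (relax_com k)) (Seq (ArrS 4 (Reg 21) (Reg 4)) (For 0 7 1 (best_com k))))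
    (6 + M * (?relax + 8) + (?store + (6 + n * (?best + 8)))) ?Q"
  proof (rule triple_Seq[where R = "relax_inv i c M"])
  show "triple N p ?P (For 1 20 2 (relax_com k))
      (6 + M * (?relax + 8)) (relax_inv i c M)"
  proof (rule triple_weaken[OF triple_For_const[where I = "relax_inv i c" and L = M
        and K = "?relax"]])
    fix f assume "1 \<le> f" "f < M"
    then show "triple N p (\<lambda>s. relax_inv i c f s \<and> reg s 20 = f) (relax_com k) ?relax
      (\<lambda>s. relax_inv i c (Suc f) s \<and> reg s 20 = f)"
      by (intro triple_straight[OF N] wp_relax_com[OF _ _ _ c]) auto
  next
    fix s assume s: "?P s"
    have "incoming (dig c) r \<inter> {..<1} = {}" for r by (auto simp: incoming_def)
    then have "root_val v c r 1 = 0" for v r by (simp add: root_val_def)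
    moreover have "arr s 3 (c * n + r) = 0" if "r \<in> H c" for r
      using s c H_less[OF that] unfolding dp_inv_def by auto
    moreover have "dp_inv i c (Suc c) s" using s unfolding dp_inv_def by auto
    ultimately show "relax_inv i c 1 s" using s by (simp add: relax_inv_def)
  next
    fix s v f assume "relax_inv i c f s"
    then show "relax_inv i c f (set_reg s 20 v)" by (simp add: relax_inv_def)
  qed (use N M_pos in \<open>auto simp: relax_inv_def dp_inv_def base_def\<close>)
next
  show "triple N p (relax_inv i c M) (Seq (ArrS 4 (Reg 21) (Reg 4)) (For 0 7 1 (best_com k)))
    (?store + (6 + n * (?best + 8)))
    ?Q"
  proof (rule triple_Seq[where R = "best_inv i c 0"])
    show "triple N p (relax_inv i c M) (ArrS 4 (Reg 21) (Reg 4)) ?store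
      (best_inv i c 0)"
      by (intro triple_straight[OF N] best_inv_start[OF _ c])
    show "triple N p (best_inv i c 0) (For 0 7 1 (best_com k)) (6 + n * (?best + 8))
      ?Q"
    proof (rule triple_weaken[OF triple_For_const[where I = "best_inv i c" and L = n
          and K = "?best"]])
      fix x assume "x < n"
      then show "triple N p (\<lambda>s. best_inv i c x s \<and> reg s 7 = x) (best_com k) ?best
        (\<lambda>s. best_inv i c (Suc x) s \<and> reg s 7 = x)"
        by (intro triple_straight[OF N] wp_best_com[OF _ _ _ c]) auto
    next
      fix s assume s: "best_inv i c n s"
      then have dp: "dp_inv i c (Suc c) s" and r: "reg s 5 = i" "reg s 21 = c"
        by (auto simp: best_inv_def relax_inv_def)
      have "code_entry (arr s 4) (arr s 5) c"
        using s H_less by (auto simp: best_inv_def code_entry_def)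
      moreover have "finished i (Suc c) b \<Longrightarrow> b = c \<or> finished i c b" for b
        by (auto simp: finished_def less_Suc_eq)
      ultimately have "code_entry (arr s 4) (arr s 5) b" if "b < M ^ k" "finished i (Suc c) b" for b
        using dp that by (auto simp: dp_inv_def)
      then have "dp_inv i (Suc c) (Suc c) s" using dp by (simp add: dp_inv_def)
      then show "?Q s" using r by simp
    next
      fix s v x assume "best_inv i c x s"
      then show "best_inv i c x (set_reg s 7 v)" by (simp add: best_inv_def relax_inv_def)
    qed (use N in \<open>auto simp: best_inv_def relax_inv_def dp_inv_def base_def\<close>)
  qed
qed
qed

text \<open>The dependence on the region size is essential: charging \<open>process_time\<close> in
  every round would cost another factor \<open>n\<close>.\<close>

definition code_time :: "nat \<Rightarrow> nat \<Rightarrow> nat" where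
  "code_time i c = steps size_test + 1 + (if card (H c) = Suc i then process_time else 1)"

lemma triple_code:
  assumes c: "c < M ^ k"
  shows "triple N p (\<lambda>s. dp_inv i c c s \<and> reg s 5 = i \<and> reg s 21 = c)
    (Cond size_test Skip (process_com k)) (code_time i c)
    (\<lambda>s. dp_inv i (Suc c) (Suc c) s \<and> reg s 5 = i \<and> reg s 21 = c)"
proof -
  let ?P = "\<lambda>s. dp_inv i c c s \<and> reg s 5 = i \<and> reg s 21 = c"
  let ?Q = "\<lambda>s. dp_inv i (Suc c) (Suc c) s \<and> reg s 5 = i \<and> reg s 21 = c"
  have test: "eval size_test s = 0 \<longleftrightarrow> card (H c) = Suc i" if "?P s" for s
    using that c by (simp add: size_test_def dp_inv_def regions_ok_def)
  show ?thesis unfolding code_time_def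
  proof (rule triple_Cond[OF N])
    show "triple N p (\<lambda>s. ?P s \<and> eval size_test s \<noteq> 0) Skip
      (if card (H c) = Suc i then process_time else 1) ?Q"
    proof (rule triple_weaken[OF triple_straight[OF N]])
      fix s assume s: "?P s \<and> eval size_test s \<noteq> 0"
      then have "card (H c) \<noteq> Suc i" using test by auto
      then have "finished i (Suc c) b \<longleftrightarrow> finished i c b"
        "b \<ge> c \<and> card (H b) = Suc i \<longleftrightarrow> b \<ge> Suc c \<and> card (H b) = Suc i" for b
        by (auto simp: finished_def less_Suc_eq not_less_eq_eq le_less)
      then show "wp (N ^ p) Skip ?Q s" using s by (auto simp: dp_inv_def)
    qed (auto simp: process_time_def)
    show "triple N p (\<lambda>s. ?P s \<and> eval size_test s = 0) (process_com k)
      (if card (H c) = Suc i then process_time else 1) ?Q"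
    proof (cases "card (H c) = Suc i")
      case True
      then show ?thesis using triple_process_com[OF c True] by (auto intro: triple_weaken)
    next
      case False
      then have "\<not> (?P s \<and> eval size_test s = 0)" for s using test by auto
      then show ?thesis unfolding triple_def by blast
    qed
  qed
qed

definition dp_time :: nat where
  "dp_time = 6 + (\<Sum>i=0..<n. 6 + (\<Sum>c=0..<M ^ k. code_time i c + 8) + 8)"

lemma triple_dp_com:
  "triple N p (dp_inv 0 0 0) (dp_com k) dp_time (dp_inv n 0 0)"
  unfolding dp_com_def dp_time_def
proof (rule triple_weaken[OF triple_For[where I = "\<lambda>i. dp_inv i 0 0" and L = n
      and K = "\<lambda>i. 6 + (\<Sum>c=0..<M ^ k. code_time i c + 8)"]])
  fix i
  show "triple N p (\<lambda>s. dp_inv i 0 0 s \<and> reg s 5 = i)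
     (For 0 21 3 (Cond size_test Skip (process_com k)))
     (6 + (\<Sum>c=0..<M ^ k. code_time i c + 8)) (\<lambda>s. dp_inv (Suc i) 0 0 s \<and> reg s 5 = i)"
  proof (rule triple_weaken[OF triple_For[where I = "\<lambda>c s. dp_inv i c c s \<and> reg s 5 = i"
        and L = "M ^ k" and K = "code_time i"]])
    fix c assume "c < M ^ k"
    from triple_code[OF this]
    show "triple N p (\<lambda>s. (dp_inv i c c s \<and> reg s 5 = i) \<and> reg s 21 = c)
      (Cond size_test Skip (process_com k)) (code_time i c)
      (\<lambda>s. (dp_inv i (Suc c) (Suc c) s \<and> reg s 5 = i) \<and> reg s 21 = c)"
      by (simp add: conj_assoc)
  next
    fix s assume s: "dp_inv i (M ^ k) (M ^ k) s \<and> reg s 5 = i"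
    have "b < M ^ k \<Longrightarrow> finished (Suc i) 0 b \<Longrightarrow> finished i (M ^ k) b" for b
      by (auto simp: finished_def)
    then show "dp_inv (Suc i) 0 0 s \<and> reg s 5 = i" using s by (auto simp: dp_inv_def)
  qed (use N in \<open>auto simp: dp_inv_def base_def\<close>)
qed (use N in \<open>auto simp: dp_inv_def base_def\<close>)

lemma dp_inv_start:
  assumes "base s" "zero_arrays 3 s" "cuts_ok s" "regions_ok s" "reg s 4 = bound"
  shows "dp_inv 0 0 0 s"
  using assms by (auto simp: dp_inv_def zero_arrays_def finished_def)

lemma dp_inv_end:
  assumes "dp_inv n 0 0 s" "b < M ^ k" "H b \<noteq> {}"
  shows "code_entry (arr s 4) (arr s 5) b"
proof -
  have "card (H b) \<le> card {..<n}" by (rule card_mono) (use region_subset in auto)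
  then have "finished n 0 b" using assms(3) by (simp add: finished_def)
  then show ?thesis using assms(1,2) by (simp add: dp_inv_def)
qed

end

section \<open>Reading off the parent array\<close>

text \<open>Register 20 keeps the edge into the current root on whose tail side the target lies; at
  most one edge passes both tests.\<close>

definition find_com :: com where
  "find_com =
    Seq (Assign 11 (HeadE (Reg 10)))
        (Cond (NeqE (Reg 11) (Reg 7)) Skip
          (Cond (ArrE 0 (PairE (Reg 10) (Reg 5))) Skip (Assign 20 (Reg 10))))"

definition move_com :: "nat \<Rightarrow> com" where
  "move_com k = Seq (push_com k) (Seq (Assign 21 (Reg 23)) (Assign 7 (ArrE 5 (Reg 21))))"

definition walk_com :: "nat \<Rightarrow> com" where
  "walk_com k =
    Cond (NeqE (Reg 7) (Reg 5))
      (Seq (Assign 8 (Reg 7)) (Seq (For 1 10 2 find_com) (move_com k)))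
      Skip"

definition walk_init :: com where
  "walk_init = Seq (Assign 21 (Const 0)) (Seq (Assign 7 (ArrE 5 (Const 0))) (Assign 8 (Reg 7)))"

text \<open>Each node is searched afresh from the root with \<open>n\<close> moves, each scanning
  all edges, which is cubic in total.\<close>

definition output_com :: "nat \<Rightarrow> com" where
  "output_com k =
    For 0 5 1 (Seq walk_init (Seq (For 0 9 1 (walk_com k)) (Store (Reg 5) (Reg 8))))"

context ram_tree
begin

definition list_fun :: "(nat \<Rightarrow> nat) \<Rightarrow> nat list \<Rightarrow> nat" where
  "list_fun h ds = h (undigits M ds)"

lemma list_fun_dig: "c < M ^ k \<Longrightarrow> list_fun h (dig c) = h c"
  by (simp add: list_fun_def undigits_digits)

definition walk_time :: nat where
  "walk_time = steps (NeqE (Reg 7) (Reg 5)) + 1 + (com_time (Assign 8 (Reg 7)) +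
     (6 + M * (com_time find_com + 8) + com_time (move_com k)))"

definition output_time :: nat where
  "output_time = 6 + n * (com_time walk_init +
     (6 + n * (walk_time + 8) + com_time (Store (Reg 5) (Reg 8))) + 8)"

lemma solved_table:
  assumes "\<And>b. b < M ^ k \<Longrightarrow> H b \<noteq> {} \<Longrightarrow> code_entry v ch b"
  shows "solved_dp_table {..<n} E M tail head k w bound (list_fun v) (list_fun ch)"
proof
  fix ds assume ds: "ds \<in> dp_table.codes M k" and ne: "region ds \<noteq> {}"
  have ds': "length ds = k" "set ds \<subseteq> {..<M}"
    using ds by (auto simp: dp_table.codes_def[OF dp_table.intro[OF coded_tree_axioms]])
  define b where "b = undigits M ds"
  have b: "b < M ^ k" "dig b = ds"
    using undigits_less[OF ds'(2)] digits_undigits[OF ds'(2)] ds'(1) by (auto simp: b_def)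
  have "root_val v b r M =
    (\<Sum>f\<in>incoming ds r. dp_table.child {..<n} E M tail head bound (list_fun v) f ds)" for r
    unfolding root_val_def b(2)
  proof (rule sum.cong)
    show "incoming ds r \<inter> {..<M} = incoming ds r" by (auto simp: incoming_def)
    show "child_val v f b = dp_table.child {..<n} E M tail head bound (list_fun v) f ds" for f
      by (simp add: child_val_def b(2) pushed_def list_fun_def
          dp_table.child_def[OF dp_table.intro[OF coded_tree_axioms]])
  qed
  then show "dp_table.entry {..<n} E M tail head w bound (list_fun v) (list_fun ch) ds"
    using assms[OF b(1)] ne b
    by (simp add: code_entry_def dp_table.entry_def[OF dp_table.intro[OF coded_tree_axioms]]
        list_fun_def b_def[symmetric])
qed

end

locale ram_walk = ram_tree n E M tail head w k N p
  for n :: nat and E :: "nat set set" and M :: nat and tail head :: "nat \<Rightarrow> nat"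
    and w :: "nat \<Rightarrow> nat" and k N p :: nat +
  fixes v ch :: "nat \<Rightarrow> nat"
  assumes code_entries: "\<And>b. b < M ^ k \<Longrightarrow> H b \<noteq> {} \<Longrightarrow> code_entry v ch b"
    and start: "v 0 < bound"
begin

sublocale solved_dp_table "{..<n}" E M tail head k w bound "list_fun v" "list_fun ch"
  by (rule solved_table[OF code_entries])

lemma H_0: "H 0 = {..<n}"
  by (auto simp: region_def digits_0)

lemma solved_0: "solved (dig 0)"
  using start connected_V dig_range H_0 M_pos
  by (simp add: solved_def codes_def list_fun_dig)

text \<open>The initial parent is the root itself, in accordance with the convention for the parent
  array.\<close>

definition walk :: "nat \<Rightarrow> nat \<Rightarrow> nat list \<times> nat" where
  "walk x j = (descend x ^^ j) (dig 0, ch 0)"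

lemma walk_Suc: "walk x (Suc j) = descend x (walk x j)"
  by (simp add: walk_def)

lemma walk_solved:
  assumes "x < n"
  shows "solved (fst (walk x j))" "x \<in> region (fst (walk x j))"
proof -
  have "solved (fst (walk x j)) \<and> x \<in> region (fst (walk x j))"
  proof (induction j)
    case 0
    then show ?case using solved_0 H_0 assms by (simp add: walk_def)
  next
    case (Suc j)
    then show ?case
      using descend_solved[of "fst (walk x j)" x "snd (walk x j)"] by (simp add: walk_Suc)
  qed
  then show "solved (fst (walk x j))" "x \<in> region (fst (walk x j))" by auto
qed

lemma choice_less:
  assumes "c < M ^ k" "solved (dig c)" "x \<in> H c"
  shows "ch c < n"
  using choice_region[OF assms(2)] assms(3) H_less[of "ch c" c] by (auto simp: list_fun_dig[OF assms(1)])

definition walk_inv :: "nat \<Rightarrow> nat \<Rightarrow> state \<Rightarrow> bool" where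
  "walk_inv x j s \<longleftrightarrow> base s \<and> cuts_ok s \<and> arr s 5 = ch \<and> reg s 5 = x \<and> reg s 21 < M ^ k \<and>
     reg s 7 = ch (reg s 21) \<and> reg s 8 < n \<and> walk x j = (dig (reg s 21), reg s 8) \<and>
     (\<forall>y < x. mem s y = snd (walk y n))"

definition find_inv :: "nat \<Rightarrow> nat \<Rightarrow> nat \<Rightarrow> state \<Rightarrow> bool" where
  "find_inv x j f s \<longleftrightarrow> base s \<and> cuts_ok s \<and> arr s 5 = ch \<and> reg s 5 = x \<and> reg s 21 < M ^ k \<and>
     reg s 7 = ch (reg s 21) \<and> reg s 8 = ch (reg s 21) \<and> reg s 9 = j \<and>
     ch (reg s 21) \<noteq> x \<and> fst (walk x j) = dig (reg s 21) \<and>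
     (\<forall>y < x. mem s y = snd (walk y n)) \<and>
     (\<forall>g \<in> {1..<f}. head g = ch (reg s 21) \<longrightarrow> x \<notin> cut g \<longrightarrow> reg s 20 = g)"

lemma find_inv_edge:
  assumes x: "x < n" and s: "find_inv x j f s"
  obtains g where "g \<in> {1..<M}" "head g = ch (reg s 21)" "x \<notin> cut g"
    "\<And>g'. g' \<in> {1..<M} \<Longrightarrow> head g' = ch (reg s 21) \<Longrightarrow> x \<notin> cut g' \<Longrightarrow> g' = g"
    "walk x (Suc j) = (fst (push g g (dig (reg s 21))), ch (reg s 21))"
proof -
  have c: "reg s 21 < M ^ k" "ch (reg s 21) \<noteq> x" "fst (walk x j) = dig (reg s 21)"
    using s by (auto simp: find_inv_def)
  have ch: "list_fun ch (dig (reg s 21)) = ch (reg s 21)" by (rule list_fun_dig[OF c(1)])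
  have "solved (dig (reg s 21))" "x \<in> H (reg s 21)" using walk_solved[OF x, of j] c(3) by auto
  then obtain g where g: "g \<in> {1..<M}" "head g = ch (reg s 21)" "x \<notin> cut g"
    "\<And>g'. g' \<in> {1..<M} \<Longrightarrow> head g' = ch (reg s 21) \<Longrightarrow> x \<notin> cut g' \<Longrightarrow> g' = g"
    "\<And>q. descend x (dig (reg s 21), q) = (fst (push g g (dig (reg s 21))), ch (reg s 21))"
    using descend_edge[of "dig (reg s 21)" x] c(2) unfolding ch by metis
  have "walk x (Suc j) = descend x (dig (reg s 21), snd (walk x j))"
    unfolding walk_Suc c(3)[symmetric] by simp
  then show thesis using that g by metis
qed

lemma wp_find_com:
  assumes x: "x < n" and f: "f \<in> {1..<M}" and s: "find_inv x j f s" "reg s 10 = f"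
  shows "wp (N ^ p) find_com (\<lambda>s. find_inv x j (Suc f) s \<and> reg s 10 = f) s"
proof -
  have b: "base s" "cuts_ok s" using s by (auto simp: find_inv_def)
  have [simp]: "eval (HeadE (Reg 10)) s = head f" using eval_HeadE[OF b(1), of "Reg 10"] s f by simp
  have cut: "arr s 0 (f * n + x) = 0 \<longleftrightarrow> x \<notin> cut f" using b(2) f x by (auto simp: cuts_ok_def)
  have fb: "f < N ^ p" by (rule less_bound(1)) (use f edge_address[of f] in auto)
  have hb: "head f < N ^ p" by (rule node_less[OF head_less[OF f]])
  have r: "reg s 5 = x" "reg s 7 = ch (reg s 21)" using s by (auto simp: find_inv_def)
  show ?thesis
  proof (cases "head f = ch (reg s 21) \<and> x \<notin> cut f")
    case True
    \<comment> \<open>By uniqueness an earlier edge passing both tests would be \<open>f\<close>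
      itself, so overwriting register 20 loses nothing.\<close>
    have "f = g" if "g \<in> {1..<Suc f}" "head g = ch (reg s 21)" "x \<notin> cut g" for g
      using find_inv_edge[OF x s(1)] that True f by (metis atLeastLessThan_iff less_Suc_eq less_trans)
    then have "find_inv x j (Suc f) (set_reg (set_reg s 11 (head f)) 20 f)"
      using s(1) by (auto simp: find_inv_def)
    then show ?thesis using True cut fb hb s(2) r baseD[OF b(1)] by (simp add: find_com_def)
  next
    case False
    then have "find_inv x j (Suc f) (set_reg s 11 (head f))"
      using s(1) by (auto simp: find_inv_def less_Suc_eq)
    then show ?thesis using False cut hb s(2) r baseD[OF b(1)]
      by (cases "head f = ch (reg s 21)") (simp_all add: find_com_def)
  qed
qed

lemma wp_move_com:
  assumes x: "x < n" and s: "find_inv x j M s"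
  shows "wp (N ^ p) (move_com k) (\<lambda>s. walk_inv x (Suc j) s \<and> reg s 9 = j) s"
proof -
  let ?c = "reg s 21"
  obtain g where g: "g \<in> {1..<M}" "head g = ch ?c" "x \<notin> cut g"
    "walk x (Suc j) = (fst (push g g (dig ?c)), ch ?c)"
    using find_inv_edge[OF x s] by metis
  have b: "base s" "cuts_ok s" "?c < M ^ k" and r20: "reg s 20 = g"
    and fw: "fst (walk x j) = dig ?c" using s g by (auto simp: find_inv_def)
  have gM: "g < M" using g by auto
  have new: "pushed g ?c < M ^ k" "dig (pushed g ?c) = fst (push g g (dig ?c))"
    using pushed_less[OF gM] dig_pushed[OF gM] by auto
  have ch1: "ch ?c < n"
    using choice_less[OF b(3), of x] walk_solved[OF x, of j] fw by simp
  have ch2: "ch (pushed g ?c) < n"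
    using choice_less[OF new(1), of x] walk_solved[OF x, of "Suc j"] g(4) new(2) by simp
  show "wp (N ^ p) (move_com k) (\<lambda>s. walk_inv x (Suc j) s \<and> reg s 9 = j) s"
    unfolding move_com_def wp.simps(4)[of _ "push_com k"]
  proof (rule wp_push_com[OF b(1,2) _ b(3)])
    fix s' assume s': "push_frame s s'"
      and r23: "reg s' 23 = undigits M (fst (push (reg s 20) (reg s 20) (dig (reg s 21))))"
    have r: "reg s' 23 = pushed g ?c" using r23 r20 by (simp add: pushed_def)
    have ar: "arr s' = arr s" "mem s' = mem s" "base s'" "cuts_ok s'"
      using push_frame_arr[OF s'] push_frame_base[OF s'] push_frame_cuts_ok[OF s'] s' b
      by (auto simp: push_frame_def)
    have rs: "reg s' 5 = reg s 5" "reg s' 8 = reg s 8" "reg s' 9 = reg s 9"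
      using s' by (auto simp: push_frame_def)
    have "walk_inv x (Suc j) (set_reg (set_reg s' 21 (pushed g ?c)) 7 (ch (pushed g ?c)))"
      using s ar rs new g(4) ch1 by (simp add: walk_inv_def find_inv_def)
    moreover have "pushed g ?c < N ^ p" using new(1) by (intro less_bound(2)) simp
    moreover have "arr s' 5 = ch" "reg s' 9 = j" using s ar rs by (auto simp: find_inv_def)
    ultimately show "wp (N ^ p) (Seq (Assign 21 (Reg 23)) (Assign 7 (ArrE 5 (Reg 21))))
        (\<lambda>s. walk_inv x (Suc j) s \<and> reg s 9 = j) s'"
      using r node_less[OF ch2] by simp
  qed (use g r20 in auto)
qed

lemma triple_walk_com:
  assumes x: "x < n"
  shows "triple N p (\<lambda>s. walk_inv x j s \<and> reg s 9 = j) (walk_com k) walk_time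
    (\<lambda>s. walk_inv x (Suc j) s \<and> reg s 9 = j)"
  unfolding walk_com_def walk_time_def
proof -
  let ?P = "\<lambda>s. walk_inv x j s \<and> reg s 9 = j" and ?Q = "\<lambda>s. walk_inv x (Suc j) s \<and> reg s 9 = j"
  let ?K = "com_time (Assign 8 (Reg 7)) + (6 + M * (com_time find_com + 8) + com_time (move_com k))"
  let ?test = "eval (NeqE (Reg 7) (Reg 5))"
  show "triple N p ?P (Cond (NeqE (Reg 7) (Reg 5))
      (Seq (Assign 8 (Reg 7)) (Seq (For 1 10 2 find_com) (move_com k))) Skip)
    (steps (NeqE (Reg 7) (Reg 5)) + 1 + ?K) ?Q"
  proof (rule triple_Cond[OF N])
  show "triple N p (\<lambda>s. ?P s \<and> ?test s = 0) Skip
    ?K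
    ?Q"
  proof (rule triple_weaken[OF triple_straight[OF N]])
    fix s assume s: "?P s \<and> ?test s = 0"
    then have "list_fun ch (dig (reg s 21)) = x" by (simp add: walk_inv_def list_fun_dig)
    moreover have "walk x j = (dig (reg s 21), reg s 8)" using s by (simp add: walk_inv_def)
    ultimately have "walk x (Suc j) = walk x j" by (simp add: walk_Suc)
    then show "wp (N ^ p) Skip ?Q s"
      using s by (simp add: walk_inv_def)
  qed auto
next
  show "triple N p (\<lambda>s. ?P s \<and> ?test s \<noteq> 0)
    (Seq (Assign 8 (Reg 7)) (Seq (For 1 10 2 find_com) (move_com k)))
    ?K
    ?Q"
  proof (intro triple_Seq)
    show "triple N p (\<lambda>s. ?P s \<and> ?test s \<noteq> 0)
      (Assign 8 (Reg 7)) (com_time (Assign 8 (Reg 7))) (find_inv x j 1)"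
    proof (rule triple_straight[OF N])
      fix s assume s: "?P s \<and> ?test s \<noteq> 0"
      then have c: "reg s 21 < M ^ k" "walk x j = (dig (reg s 21), reg s 8)" by (auto simp: walk_inv_def)
      have "ch (reg s 21) < N ^ p"
        using choice_less[OF c(1), of x] walk_solved[OF x, of j] c(2) node_less by simp
      moreover have "find_inv x j 1 (set_reg s 8 (ch (reg s 21)))"
        using s c by (simp add: walk_inv_def find_inv_def)
      ultimately show "wp (N ^ p) (Assign 8 (Reg 7)) (find_inv x j 1) s"
        using s by (simp add: walk_inv_def)
    qed
    show "triple N p (find_inv x j 1) (For 1 10 2 find_com) (6 + M * (com_time find_com + 8))
      (find_inv x j M)"
    proof (rule triple_weaken[OF triple_For_const[where I = "find_inv x j" and L = M
          and K = "com_time find_com"]])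
      fix f assume "1 \<le> f" "f < M"
      then show "triple N p (\<lambda>s. find_inv x j f s \<and> reg s 10 = f) find_com (com_time find_com)
        (\<lambda>s. find_inv x j (Suc f) s \<and> reg s 10 = f)"
        by (intro triple_straight[OF N] wp_find_com[OF x]) auto
    next
      fix s v f assume "find_inv x j f s"
      then show "find_inv x j f (set_reg s 10 v)" by (simp add: find_inv_def)
    qed (use N M_pos in \<open>auto simp: find_inv_def base_def\<close>)
    show "triple N p (find_inv x j M) (move_com k) (com_time (move_com k))
      ?Q"
      by (intro triple_straight[OF N] wp_move_com[OF x])
  qed
qed
qed

definition out_inv :: "nat \<Rightarrow> state \<Rightarrow> bool" where
  "out_inv x s \<longleftrightarrow> base s \<and> cuts_ok s \<and> arr s 5 = ch \<and> (\<forall>y < x. mem s y = snd (walk y n))"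

text \<open>The output overwrites cells holding \<open>n\<close> and node counts, which the output
  phase no longer reads: \<open>n\<close> is kept in a register, and \<open>base\<close> refers to
  cells from \<open>n + 1\<close> on.\<close>

lemma base_set_mem:
  assumes "base s" "x < n"
  shows "base (set_mem s x z)" "arr (set_mem s x z) = arr s"
  using assms by (auto simp: base_def)

lemma triple_output_com:
  "triple N p (out_inv 0) (output_com k) output_time (out_inv n)"
  unfolding output_com_def output_time_def
proof (rule triple_weaken[OF triple_For_const[where I = out_inv and L = n
      and K = "com_time walk_init + (6 + n * (walk_time + 8) + com_time (Store (Reg 5) (Reg 8)))"]])
  fix x assume x: "x < n"
  show "triple N p (\<lambda>s. out_inv x s \<and> reg s 5 = x)
    (Seq walk_init (Seq (For 0 9 1 (walk_com k)) (Store (Reg 5) (Reg 8))))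
    (com_time walk_init + (6 + n * (walk_time + 8) + com_time (Store (Reg 5) (Reg 8))))
    (\<lambda>s. out_inv (Suc x) s \<and> reg s 5 = x)"
  proof (intro triple_Seq)
    show "triple N p (\<lambda>s. out_inv x s \<and> reg s 5 = x) walk_init (com_time walk_init) (walk_inv x 0)"
    proof (rule triple_straight[OF N])
      fix s assume s: "out_inv x s \<and> reg s 5 = x"
      have ch: "ch 0 < n" using choice_less[OF _ solved_0, of x] H_0 x M_pos by simp
      then have "walk_inv x 0 (set_reg (set_reg (set_reg s 21 0) 7 (ch 0)) 8 (ch 0))"
        using s M_pos by (simp add: walk_inv_def out_inv_def walk_def)
      then show "wp (N ^ p) walk_init (walk_inv x 0) s"
        using s ch node_less one_less by (simp add: walk_init_def out_inv_def)
    qed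
    show "triple N p (walk_inv x 0) (For 0 9 1 (walk_com k)) (6 + n * (walk_time + 8)) (walk_inv x n)"
    proof (rule triple_weaken[OF triple_For_const[where I = "walk_inv x" and L = n and K = walk_time]])
      fix s v j assume "walk_inv x j s"
      then show "walk_inv x j (set_reg s 9 v)" by (simp add: walk_inv_def)
    qed (use N triple_walk_com[OF x] in \<open>auto simp: walk_inv_def base_def\<close>)
    show "triple N p (walk_inv x n) (Store (Reg 5) (Reg 8)) (com_time (Store (Reg 5) (Reg 8)))
      (\<lambda>s. out_inv (Suc x) s \<and> reg s 5 = x)"
    proof (rule triple_straight[OF N])
      fix s assume s: "walk_inv x n s"
      then have b: "base s" and r: "reg s 8 < n" "reg s 5 = x" by (auto simp: walk_inv_def)
      have "cuts_ok (set_mem s x (reg s 8))"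
        using s base_set_mem(2)[OF b x] by (simp add: walk_inv_def cuts_ok_def)
      then have "out_inv (Suc x) (set_mem s x (reg s 8))"
        using s base_set_mem[OF b x] by (auto simp: walk_inv_def out_inv_def less_Suc_eq)
      then show "wp (N ^ p) (Store (Reg 5) (Reg 8)) (\<lambda>s. out_inv (Suc x) s \<and> reg s 5 = x) s"
        using r node_less by simp
    qed
  qed
qed (use N in \<open>auto simp: out_inv_def base_def\<close>)

lemma out_inv_tree:
  assumes "out_inv n s"
  obtains T where "stt E {..<n} T" "parent_array (mem s) T" "(\<Sum>x<n. w x * depth T x) = v 0"
proof -
  have "0 \<in> H 0" unfolding H_0 using n by simp
  then have "H 0 \<noteq> {}" by blast
  from reconstruct[OF solved_0 this] obtain T where T: "stt E {..<n} T" "root T = ch 0"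
    "(\<Sum>x<n. w x * depth T x) = v 0"
    "snd (walk (root T) n) = ch 0" "\<forall>(q, y) \<in> arcs T. y < n \<and> snd (walk y n) = q"
    using M_pos unfolding H_0 by (auto simp: list_fun_dig walk_def)
  have "ch 0 < n" using choice_less[OF _ solved_0, of 0] H_0 n M_pos by simp
  then have "parent_array (mem s) T"
    using T assms by (auto simp: parent_array_def out_inv_def)
  then show thesis using that T by blast
qed

end

section \<open>The whole program\<close>

definition init_com :: "nat \<Rightarrow> com" where
  "init_com k =
    Seq (Assign 1 (Load (Const 0)))
   (Seq (Assign 0 (Mul (Const 3) (Reg 1)))
   (Seq (Assign 2 (Sub (Mul (Const 2) (Reg 1)) (Const 1)))
        (Assign 3 (PowE k))))"

definition bound_com :: com where
  "bound_com = Assign 4 (Add (Mul (Mul (Const 2) (Reg 1)) (ArrE 2 (Const 0))) (Const 1))"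

definition main_com :: "nat \<Rightarrow> com" where
  "main_com k =
    Seq (init_com k) (Seq cut_com (Seq (region_com k) (Seq bound_com (Seq (dp_com k) (output_com k)))))"

text \<open>Fixing the initial state turns the tables stored in it into constants, as needed to
  instantiate \<open>ram_walk\<close>.\<close>

lemma triple_pointwise:
  "(\<And>s0. P s0 \<Longrightarrow> triple N p (\<lambda>s. s = s0) c K Q) \<Longrightarrow> triple N p P c K Q"
  unfolding triple_def by blast

context ram_tree
begin

definition loaded :: "state \<Rightarrow> bool" where
  "loaded s \<longleftrightarrow> mem s 0 = n \<and> weights_ok s \<and> (\<forall>e \<in> {1..<M}. mem s (n + e) = tail e) \<and>
     (\<forall>i \<ge> 3 * n. mem s i = 0)"

definition solution :: "state \<Rightarrow> bool" where
  "solution s \<longleftrightarrow> (\<exists>T. stt E {..<n} T \<and> parent_array (mem s) T \<and>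
     (\<forall>D. searchable k {..<n} D \<longrightarrow> (\<Sum>x<n. w x * depth T x) \<le> (\<Sum>x<n. w x * D x)))"

lemma canonical_0: "canonical (dig 0)"
proof -
  have "region (dig 0) = {..<n}" by (auto simp: region_def digits_0)
  then have "boundary (region (dig 0)) = {}" by (simp only: boundary_V)
  moreover have "filter (\<lambda>e. e \<noteq> 0) (dig 0) = []" by (simp add: digits_0)
  moreover have "set (dig 0) - {0} = {}" by (auto simp: digits_0)
  ultimately show ?thesis unfolding canonical_def by (simp only:) simp
qed

lemma triple_init: "triple N p loaded (init_com k) (com_time (init_com k))
  (\<lambda>s. base s \<and> weights_ok s \<and> zero_arrays 0 s)"
proof (rule triple_straight[OF N])
  fix s assume s: "loaded s"
  then have m0: "mem s 0 = n" by (simp add: loaded_def)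
  have M': "2 * n - Suc 0 = M" using M by simp
  let ?s = "set_reg (set_reg (set_reg (set_reg s 1 n) 0 (3 * n)) 2 M) 3 (M ^ k)"
  have "arr ?s b i = 0" for b i
    using s by (simp add: arr_def loaded_def)
  then have "base ?s \<and> weights_ok ?s \<and> zero_arrays 0 ?s"
    using s by (simp add: base_def loaded_def weights_ok_def zero_arrays_def)
  moreover have "n < N ^ p" "3 * n < N ^ p" "M < N ^ p" "M ^ k < N ^ p"
    using bounds M by auto
  ultimately show "wp (N ^ p) (init_com k) (\<lambda>s. base s \<and> weights_ok s \<and> zero_arrays 0 s) s"
    using m0 M' by (simp add: init_com_def)
qed

text \<open>The given shallow \<open>D\<close> puts the value of the whole tree below the sentinel.
  A tree can then be rebuilt, and \<open>val_le\<close> compares it with all searchable depth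
  bounds.\<close>

lemma triple_output:
  assumes D: "searchable k {..<n} D" "\<And>x. x < n \<Longrightarrow> D x \<le> 2 * n"
  shows "triple N p (dp_inv n 0 0) (output_com k) output_time solution"
proof (rule triple_pointwise)
  fix s0 assume s0: "dp_inv n 0 0 s0"
  note entries = dp_inv_end[OF s0]
  interpret S: solved_dp_table "{..<n}" E M tail head k w bound "list_fun (arr s0 4)" "list_fun (arr s0 5)"
    by (rule solved_table[OF entries])
  have H0: "region (dig 0) = {..<n}" by (auto simp: region_def digits_0)
  have codes: "dig 0 \<in> S.codes" using dig_range by (simp add: S.codes_def)
  have le: "arr s0 4 0 \<le> (\<Sum>x<n. w x * D x)" if "searchable k {..<n} D" for D
    using S.val_le[OF that codes H0 connected_V canonical_0] M_pos by (simp add: list_fun_dig)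
  have "(\<Sum>x<n. w x * D x) \<le> (\<Sum>x<n. w x * (2 * n))"
    by (rule sum_mono) (use D(2) in auto)
  also have "\<dots> < bound" by (simp add: value_bound_def sum_distrib_right mult.commute)
  finally have "arr s0 4 0 < bound" using le[OF D(1)] by linarith
  then interpret W: ram_walk n E M tail head w k N p "arr s0 4" "arr s0 5"
    by unfold_locales (use entries in auto)
  show "triple N p (\<lambda>s. s = s0) (output_com k) output_time solution"
  proof (rule triple_weaken[OF W.triple_output_com])
    fix s assume "s = s0"
    then show "W.out_inv 0 s" using s0 by (simp add: W.out_inv_def dp_inv_def)
  next
    fix s assume "W.out_inv n s"
    from W.out_inv_tree[OF this] show "solution s" unfolding solution_def using le by metis
  qed simp
qed

definition main_time :: nat where
  "main_time = com_time (init_com k) + (cut_time + (region_time + (com_time bound_com +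
     (dp_time + output_time))))"

lemma triple_main:
  assumes D: "searchable k {..<n} D" "\<And>x. x < n \<Longrightarrow> D x \<le> 2 * n"
  shows "triple N p loaded (main_com k) main_time solution"
  unfolding main_com_def main_time_def
proof (intro triple_Seq)
  show "triple N p (\<lambda>s. base s \<and> zero_arrays 3 s \<and> cuts_ok s \<and>
      (\<forall>b < M ^ k. arr s 1 b = card (H b) \<and> arr s 2 b = sum w (H b))) bound_com (com_time bound_com)
      (dp_inv 0 0 0)"
  proof (rule triple_straight[OF N])
    fix s assume s: "base s \<and> zero_arrays 3 s \<and> cuts_ok s \<and>
      (\<forall>b < M ^ k. arr s 1 b = card (H b) \<and> arr s 2 b = sum w (H b))"
    have "H 0 = {..<n}" by (auto simp: region_def digits_0)
    then have "arr s 2 0 = sum w {..<n}" using s M_pos by simp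
    then have "eval (Add (Mul (Mul (Const 2) (Reg 1)) (ArrE 2 (Const 0))) (Const 1)) s = bound"
      using s by (simp add: base_def value_bound_def)
    moreover have "dp_inv 0 0 0 (set_reg s 4 bound)"
      by (rule dp_inv_start) (use s in \<open>simp_all add: regions_ok_def\<close>)
    moreover have "bound < N ^ p" by (rule less_bound(3)) simp
    ultimately show "wp (N ^ p) bound_com (dp_inv 0 0 0) s" by (simp only: bound_com_def wp.simps)
  qed
qed (rule triple_init triple_cut_com triple_region_com triple_dp_com triple_output[OF D])+

section \<open>Polynomial bounds on the running time\<close>

lemma horner_n:
  assumes "x \<le> c * n ^ j"
  shows "a + n * x \<le> (a + c) * n ^ Suc j"
proof -
  have "a * 1 \<le> a * n ^ Suc j" using n by (intro mult_le_mono2 one_le_power)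
  then have "a \<le> a * n ^ Suc j" by (simp only: mult_1_right)
  moreover have "n * x \<le> n * (c * n ^ j)" by (rule mult_le_mono2[OF assms])
  then have "n * x \<le> c * n ^ Suc j" by (simp only: power_Suc mult.left_commute)
  ultimately show ?thesis by (simp only: add_mult_distrib add_mono)
qed

text \<open>Times of nested loops are estimated in Horner form, one level at a time; a loop over
  directed edges contributes \<open>M \<le> 2 * n\<close>.\<close>

lemma horner_M:
  assumes "x \<le> c * n ^ j"
  shows "a + M * x \<le> (a + 2 * c) * n ^ Suc j"
proof -
  have "M * x \<le> (2 * n) * x" using M by (intro mult_le_mono1) simp
  then have "a + M * x \<le> a + (2 * n) * x" by (rule add_left_mono)
  also have "(2 * n) * x = n * (2 * x)" by simp
  also have "a + n * (2 * x) \<le> (a + 2 * c) * n ^ Suc j" by (rule horner_n) (use assms in simp)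
  finally show ?thesis .
qed

lemma power_grow: "i \<le> j \<Longrightarrow> c * n ^ i \<le> c * n ^ j"
  using n by (intro mult_le_mono2 power_increasing) auto

lemma M_power: "M ^ k \<le> 2 ^ k * n ^ k"
  using power_mono[of M "2 * n" k] M by (simp add: power_mult_distrib)

definition cut_factor :: nat where
  "cut_factor = 6 + 2 * (com_time cut_init + 14 + 2 * (14 + 2 * (com_time cut_relax + 8)))"

lemma cut_time_le: "cut_time \<le> cut_factor * n ^ 3"
proof -
  have "com_time cut_relax + 8 \<le> (com_time cut_relax + 8) * n ^ 0" by simp
  note horner_M[OF horner_M[OF horner_M[OF this, of 14], of "com_time cut_init + 14"], of 6]
  moreover have "cut_time = 6 + M * (com_time cut_init + 14 + M * (14 + M * (com_time cut_relax + 8)))"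
    by (simp add: cut_time_def algebra_simps)
  ultimately show ?thesis by (simp add: cut_factor_def numeral_3_eq_3)
qed

definition region_factor :: nat where
  "region_factor = 6 + 2 ^ k * (14 + (com_time (region_update k) + 8))"

lemma region_time_le: "region_time \<le> region_factor * n ^ (k + 1)"
proof -
  let ?c = "14 + (com_time (region_update k) + 8)"
  have "14 + n * (com_time (region_update k) + 8) \<le> ?c * n ^ Suc 0"
    by (rule horner_n) simp
  then have "M ^ k * (14 + n * (com_time (region_update k) + 8)) \<le> (2 ^ k * n ^ k) * (?c * n ^ Suc 0)"
    by (intro mult_le_mono M_power)
  also have "\<dots> = (2 ^ k * ?c) * n ^ (k + 1)" by (simp add: algebra_simps)
  finally have "region_time \<le> 6 * n ^ 0 + (2 ^ k * ?c) * n ^ (k + 1)"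
    by (simp add: region_time_def algebra_simps)
  also have "6 * n ^ 0 \<le> 6 * n ^ (k + 1)" by (rule power_grow) simp
  finally show ?thesis by (simp add: region_factor_def add_mult_distrib)
qed

definition process_factor :: nat where
  "process_factor = 6 + 2 * (com_time (relax_com k) + 8) +
     (com_time (ArrS 4 (Reg 21) (Reg 4)) + 6 + (com_time (best_com k) + 8))"

lemma process_time_le: "process_time \<le> process_factor * n"
proof -
  have "6 + M * (com_time (relax_com k) + 8) \<le> (6 + 2 * (com_time (relax_com k) + 8)) * n ^ Suc 0"
    by (rule horner_M) simp
  moreover have "com_time (ArrS 4 (Reg 21) (Reg 4)) + 6 + n * (com_time (best_com k) + 8) \<le>
      (com_time (ArrS 4 (Reg 21) (Reg 4)) + 6 + (com_time (best_com k) + 8)) * n ^ Suc 0"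
    by (rule horner_n) simp
  ultimately show ?thesis by (simp add: process_time_def process_factor_def add_mult_distrib)
qed

definition dp_factor :: nat where
  "dp_factor = 20 + 2 ^ k * (steps size_test + 10 + process_factor)"

text \<open>Each code is processed only for the one value of \<open>i\<close> that matches the size of its region.\<close>

lemma dp_time_le: "dp_time \<le> dp_factor * n ^ (k + 1)"
proof -
  let ?st = "steps size_test + 10"
  have once: "(\<Sum>i=0..<n. if card (H c) = Suc i then process_time else 0) \<le> process_time" for c
  proof -
    have "(\<Sum>i=0..<n. if card (H c) = Suc i then process_time else 0) \<le>
        (\<Sum>i=0..<n. if i = card (H c) - 1 then process_time else 0)"
      by (rule sum_mono) auto
    also have "\<dots> \<le> process_time" by simp
    finally show ?thesis .
  qed
  have "(\<Sum>i=0..<n. \<Sum>c=0..<M ^ k. code_time i c + 8) \<le>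
      (\<Sum>i=0..<n. \<Sum>c=0..<M ^ k. ?st + (if card (H c) = Suc i then process_time else 0))"
    by (intro sum_mono) (simp add: code_time_def)
  also have "\<dots> = (\<Sum>c=0..<M ^ k. \<Sum>i=0..<n. ?st + (if card (H c) = Suc i then process_time else 0))"
    by (rule sum.swap)
  also have "\<dots> \<le> (\<Sum>c=0..<M ^ k. n * ?st + process_time)"
    by (rule sum_mono) (subst sum.distrib, use once in simp)
  also have "\<dots> = M ^ k * (n * ?st + process_time)" by simp
  also have "\<dots> \<le> (2 ^ k * n ^ k) * ((?st + process_factor) * n)"
    using process_time_le by (intro mult_le_mono M_power) (simp add: algebra_simps)
  also have "\<dots> = (2 ^ k * (?st + process_factor)) * n ^ (k + 1)" by (simp add: algebra_simps)
  finally have sum: "(\<Sum>i=0..<n. \<Sum>c=0..<M ^ k. code_time i c + 8) \<le>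
    (2 ^ k * (?st + process_factor)) * n ^ (k + 1)" .
  have "dp_time = 6 + n * 14 + (\<Sum>i=0..<n. \<Sum>c=0..<M ^ k. code_time i c + 8)"
    by (simp add: dp_time_def sum.distrib)
  moreover have "6 + n * 14 \<le> 20 * n ^ Suc 0" using horner_n[of 14 14 0 6] by simp
  moreover have "20 * n ^ Suc 0 \<le> 20 * n ^ (k + 1)" by (rule power_grow) simp
  ultimately have "dp_time \<le> 20 * n ^ (k + 1) + (2 ^ k * (?st + process_factor)) * n ^ (k + 1)"
    using sum by linarith
  then show ?thesis by (simp add: dp_factor_def add_mult_distrib)
qed

definition output_factor :: nat where
  "output_factor = 6 + (com_time walk_init + com_time (Store (Reg 5) (Reg 8)) + 14 +
     (steps (NeqE (Reg 7) (Reg 5)) + com_time (Assign 8 (Reg 7)) + com_time (move_com k) + 15 +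
      2 * (com_time find_com + 8)))"

lemma output_time_le: "output_time \<le> output_factor * n ^ 3"
proof -
  let ?a = "steps (NeqE (Reg 7) (Reg 5)) + com_time (Assign 8 (Reg 7)) + com_time (move_com k) + 15"
  let ?b = "com_time walk_init + com_time (Store (Reg 5) (Reg 8)) + 14"
  have "com_time find_com + 8 \<le> (com_time find_com + 8) * n ^ 0" by simp
  note horner_n[OF horner_n[OF horner_M[OF this, of ?a], of ?b], of 6]
  moreover have "output_time = 6 + n * (?b + n * (?a + M * (com_time find_com + 8)))"
    by (simp add: output_time_def walk_time_def algebra_simps)
  ultimately show ?thesis by (simp add: output_factor_def numeral_3_eq_3)
qed

definition time_factor :: nat where
  "time_factor = com_time (init_com k) + cut_factor + region_factor + com_time bound_com +
     dp_factor + output_factor"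

lemma main_time_le:
  assumes "k \<ge> 2"
  shows "main_time \<le> time_factor * n ^ (k + 1)"
proof -
  \<comment> \<open>Here \<open>k \<ge> 2\<close> lets the table bound absorb the cubic
    phases.\<close>
  have "cut_time \<le> cut_factor * n ^ (k + 1)" "output_time \<le> output_factor * n ^ (k + 1)"
    using order_trans[OF cut_time_le power_grow[of 3 "k + 1"]]
      order_trans[OF output_time_le power_grow[of 3 "k + 1"]] assms by simp_all
  moreover have "c \<le> c * n ^ (k + 1)" for c
    using power_grow[of 0 "k + 1" c] by (simp only: power_0 mult_1_right le0)
  ultimately show ?thesis
    using region_time_le dp_time_le unfolding main_time_def time_factor_def add_mult_distrib
    by (simp only: add.assoc add_mono)
qed

end

section \<open>The memory layout of the input\<close>

definition flat_edges :: "(nat \<times> nat) list \<Rightarrow> nat list" where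
  "flat_edges es = concat (map (\<lambda>(u, v). [u, v]) es)"

lemma length_flat_edges: "length (flat_edges es) = 2 * length es"
  by (induction es) (auto simp: flat_edges_def)

lemma flat_edges_nth:
  "i < length es \<Longrightarrow> flat_edges es ! (2 * i) = fst (es ! i) \<and> flat_edges es ! (2 * i + 1) = snd (es ! i)"
proof (induction es arbitrary: i)
  case (Cons e es)
  then show ?case by (cases i) (auto simp: flat_edges_def split: prod.splits)
qed simp

lemma set_flat_edges: "set (flat_edges es) = (\<Union>(u, v) \<in> set es. {u, v})"
  by (induction es) (auto simp: flat_edges_def)

definition edge_tail :: "(nat \<times> nat) list \<Rightarrow> nat \<Rightarrow> nat" where
  "edge_tail es e = flat_edges es ! (e - 1)"

definition edge_head :: "(nat \<times> nat) list \<Rightarrow> nat \<Rightarrow> nat" where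
  "edge_head es e = edge_tail es (rev_edge e)"

lemma edge_cases:
  assumes "e \<in> {1..<2 * m + 1}"
  obtains i where "i < m" "e = 2 * i + 1" "rev_edge e = 2 * i + 2"
    | i where "i < m" "e = 2 * i + 2" "rev_edge e = 2 * i + 1"
proof (cases "even e")
  case True
  then obtain j where j: "e = 2 * j" by blast
  then have "j - 1 < m" "e = 2 * (j - 1) + 2" using assms by auto
  moreover from this(2) have "rev_edge e = 2 * (j - 1) + 1" by (simp add: rev_edge_def)
  ultimately show thesis using that(2) by blast
next
  case False
  then obtain j where j: "e = 2 * j + 1" by (elim oddE)
  then have "j < m" "rev_edge e = 2 * j + 2" using assms by (auto simp: rev_edge_def)
  then show thesis using that(1) j by blast
qed

lemma rev_edge_range: "e \<in> {1..<2 * m + 1} \<Longrightarrow> rev_edge e \<in> {1..<2 * m + 1}"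
  by (erule edge_cases) auto

lemma edge_ends_odd:
  assumes "i < length es"
  shows "edge_tail es (2 * i + 1) = fst (es ! i)" "edge_head es (2 * i + 1) = snd (es ! i)"
proof -
  have "rev_edge (2 * i + 1) = 2 * i + 2" by (simp add: rev_edge_def)
  then show "edge_tail es (2 * i + 1) = fst (es ! i)" "edge_head es (2 * i + 1) = snd (es ! i)"
    using flat_edges_nth[OF assms] by (simp_all add: edge_head_def edge_tail_def)
qed

lemma edge_ends_even:
  assumes "i < length es"
  shows "edge_tail es (2 * i + 2) = snd (es ! i)" "edge_head es (2 * i + 2) = fst (es ! i)"
proof -
  have "rev_edge (2 * i + 2) = 2 * i + 1" by (simp add: rev_edge_def)
  then show "edge_tail es (2 * i + 2) = snd (es ! i)" "edge_head es (2 * i + 2) = fst (es ! i)"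
    using flat_edges_nth[OF assms] by (simp_all add: edge_head_def edge_tail_def)
qed

text \<open>Distinctness of the undirected edges separates list positions, and distinct endpoints
  separate the two orientations at one position.\<close>

lemma coded_tree_edges:
  assumes tree: "unrooted_tree {..<n} E" and es: "edge_list E es"
  shows "coded_tree {..<n} E (2 * n - 1) (edge_tail es) (edge_head es)"
    and "2 * n - 1 = 2 * length es + 1"
proof -
  interpret utree "{..<n}" E by unfold_locales (rule tree)
  let ?u = "\<lambda>(u, v). {u, v}"
  have dist: "distinct (map ?u es)" and set: "?u ` set es = E" using es by (auto simp: edge_list_def)
  have "length es = card E" using distinct_card[OF dist] set by simp
  moreover have "n > 0" using tree by (auto simp: unrooted_tree_def)
  ultimately show M: "2 * n - 1 = 2 * length es + 1" using card_E by simp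
  have nth: "es ! i = (u, v) \<Longrightarrow> i < length es \<Longrightarrow> {u, v} \<in> E" for i u v
    using set nth_mem[of i es] by force
  have inj: "i = j" if "i < length es" "j < length es" "?u (es ! i) = ?u (es ! j)" for i j
    using nth_eq_iff_index_eq[OF dist, of i j] that by simp
  let ?f = "\<lambda>e. (edge_tail es e, edge_head es e)"
  have und: "?u (?f e) = ?u (es ! i)" if "i < length es" "e = 2 * i + 1 \<or> e = 2 * i + 2" for e i
    using that edge_ends_odd[of i es] edge_ends_even[of i es] by (auto simp: case_prod_unfold)
  have ne: "fst (es ! i) \<noteq> snd (es ! i)" if "i < length es" for i
    using nth[of i "fst (es ! i)" "snd (es ! i)"] that edgeD(3) by auto
  have "bij_betw ?f {1..<2 * length es + 1} edge_pairs"
    unfolding bij_betw_def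
  proof
    show "inj_on ?f {1..<2 * length es + 1}"
    proof (rule inj_onI)
      fix d e assume d: "d \<in> {1..<2 * length es + 1}" and e: "e \<in> {1..<2 * length es + 1}"
        and eq: "?f d = ?f e"
      obtain i where i: "i < length es" "d = 2 * i + 1 \<or> d = 2 * i + 2"
        by (rule edge_cases[OF d]) auto
      obtain j where j: "j < length es" "e = 2 * j + 1 \<or> e = 2 * j + 2"
        by (rule edge_cases[OF e]) auto
      have ij: "i = j" using inj[OF i(1) j(1)] und[OF i] und[OF j] eq by simp
      show "d = e"
      proof (rule ccontr)
        assume "d \<noteq> e"
        then have "fst (es ! i) = snd (es ! i)"
          using i(2) j(2) ij eq edge_ends_odd[OF i(1)] edge_ends_even[OF i(1)] by auto
        then show False using ne[OF i(1)] by simp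
      qed
    qed
    show "?f ` {1..<2 * length es + 1} = edge_pairs"
    proof (intro equalityI subsetI)
      fix q assume "q \<in> ?f ` {1..<2 * length es + 1}"
      then obtain e where e: "e \<in> {1..<2 * length es + 1}" "q = ?f e" by auto
      obtain i where i: "i < length es" "e = 2 * i + 1 \<or> e = 2 * i + 2"
        by (rule edge_cases[OF e(1)]) auto
      then have "?u q \<in> E" using und[OF i] e(2) set nth_mem[OF i(1)] by auto
      then show "q \<in> edge_pairs" by (simp add: edge_pairs_def case_prod_unfold)
    next
      fix q assume "q \<in> edge_pairs"
      then have "?u q \<in> E" by (auto simp: edge_pairs_def)
      then have "?u q \<in> ?u ` set es" by (simp only: set)
      then obtain x where x: "?u q = ?u x" "x \<in> set es" by (rule imageE)
      obtain i where i: "i < length es" "es ! i = x" using x(2) by (auto simp: in_set_conv_nth)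
      then have "q = es ! i \<or> q = (snd (es ! i), fst (es ! i))"
        using x(1) unfolding i(2) by (auto simp: case_prod_unfold doubleton_eq_iff prod_eq_iff)
      then have "q = ?f (2 * i + 1) \<or> q = ?f (2 * i + 2)"
        using edge_ends_odd[OF i(1)] edge_ends_even[OF i(1)] by (simp add: prod_eq_iff)
      moreover have "2 * i + 1 \<in> {1..<2 * length es + 1}" "2 * i + 2 \<in> {1..<2 * length es + 1}"
        using i by auto
      ultimately show "q \<in> ?f ` {1..<2 * length es + 1}" by blast
    qed
  qed
  then show "coded_tree {..<n} E (2 * n - 1) (edge_tail es) (edge_head es)"
    unfolding M by unfold_locales
qed

lemma edge_node:
  assumes "unrooted_tree {..<n} E" "edge_list E es" "x \<in> set (flat_edges es)"
  shows "x < n"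
proof -
  obtain u v where "(u, v) \<in> set es" "x \<in> {u, v}" using assms(3) by (auto simp: set_flat_edges)
  then have "{u, v} \<in> E" "x \<in> {u, v}" using assms(2) by (force simp: edge_list_def)+
  then have "x \<in> {..<n}" using assms(1) unfolding unrooted_tree_def by blast
  then show ?thesis by simp
qed

text \<open>With \<open>N = n + m + 1\<close>, where \<open>m\<close> is the length of
  \<open>X\<close>, one has \<open>2 * n \<le> N ^ 2\<close> and
  \<open>M ^ k \<le> N ^ (2 * k)\<close>. The weights sum to \<open>m\<close>, so the sentinel is at
  most \<open>N ^ 3\<close> and the last bound at most \<open>N ^ 5\<close>. The exponent
  \<open>2 * k + 6\<close> makes all of them strict.\<close>

lemma ram_tree_input:
  assumes tree: "unrooted_tree {..<n} E" and es: "edge_list E es" and X: "set X \<subseteq> {..<n}"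
  shows "ram_tree n E (2 * n - 1) (edge_tail es) (edge_head es) (count_list X) k
    (n + length X + 1) (2 * k + 6)"
proof -
  interpret coded_tree "{..<n}" E "2 * n - 1" "edge_tail es" "edge_head es"
    by (rule coded_tree_edges(1)[OF tree es])
  let ?N = "n + length X + 1" and ?p = "2 * k + 6"
  have n: "n \<ge> 1" using tree by (auto simp: unrooted_tree_def Suc_le_eq)
  have N2: "2 \<le> ?N" and nN: "n \<le> ?N" using n by auto
  have twice: "2 * y \<le> ?N * y" for y using N2 by (rule mult_le_mono1)
  have grow: "y \<le> ?N ^ i \<Longrightarrow> i < j \<Longrightarrow> y < ?N ^ j" for y i j
    by (erule le_less_trans, rule power_strict_increasing) (use N2 in linarith)+
  have nn: "2 * n \<le> ?N ^ 2" using twice[of n] mult_le_mono2[OF nN, of ?N] by (simp only: power2_eq_square)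
  have m: "(\<Sum>x<n. count_list X x) = length X" using X by (simp add: sum_count_set)
  have b: "value_bound n (count_list X) \<le> ?N ^ 3"
  proof -
    have "2 * n * length X + 1 \<le> ?N ^ 2 * length X + ?N ^ 2"
      by (intro add_mono mult_le_mono1 nn one_le_power) simp
    also have "\<dots> = ?N ^ 2 * (length X + 1)" by simp
    also have "\<dots> \<le> ?N ^ 2 * ?N" by (intro mult_le_mono2) simp
    finally show ?thesis unfolding value_bound_def m by (simp only: power3_eq_cube power2_eq_square)
  qed
  show ?thesis
  proof
    show "rev_edge e \<in> {1..<2 * n - 1} \<and> edge_tail es (rev_edge e) = edge_head es e"
      if "e \<in> {1..<2 * n - 1}" for e
      using rev_edge_range[of e "length es"] that coded_tree_edges(2)[OF tree es]
      by (simp add: edge_head_def)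
    have "3 * n \<le> 2 * (2 * n)" by simp
    also have "\<dots> \<le> ?N * ?N ^ 2" using twice[of "2 * n"] mult_le_mono2[OF nn, of ?N] by linarith
    also have "\<dots> = ?N ^ 3" by (simp only: power3_eq_cube power2_eq_square mult.assoc)
    finally show "3 * n < ?N ^ ?p" by (rule grow) simp
    have "(2 * n - 1) ^ k \<le> (?N ^ 2) ^ k" by (intro power_mono) (use nn in auto)
    then show "(2 * n - 1) ^ k < ?N ^ ?p" unfolding power_mult[symmetric] by (rule grow) simp
    have "(2 * n - 1 + 1) * value_bound n (count_list X) \<le> ?N ^ 2 * ?N ^ 3"
      by (intro mult_le_mono b) (use nn n in simp)
    then show "(2 * n - 1 + 1) * value_bound n (count_list X) < ?N ^ ?p"
      unfolding power_add[symmetric] by (rule grow) simp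
  qed (use N2 n in auto)
qed

lemma input_words_flat:
  "input_words n es X = n # map (count_list X) [0..<n] @ flat_edges es"
  by (simp add: input_words_def flat_edges_def)

lemma input_words_less:
  assumes "unrooted_tree {..<n} E" "edge_list E es" "x \<in> set (input_words n es X)"
  shows "x < n + length X + 1"
proof -
  have "x = n \<or> (\<exists>y. x = count_list X y) \<or> x < n"
    using assms(3) edge_node[OF assms(1,2), of x] by (auto simp: input_words_flat)
  then show ?thesis using count_le_length[of X] by (auto simp: less_Suc_eq_le trans_le_add2)
qed

lemma initial_loaded:
  assumes tree: "unrooted_tree {..<n} E" and es: "edge_list E es" and X: "set X \<subseteq> {..<n}"
  defines "s \<equiv> initial_state (input_words n es X)"
  shows "bounded_state ((n + length X + 1) ^ (2 * k + 6)) s"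
    and "ram_tree.loaded n (2 * n - 1) (edge_tail es) (count_list X) s"
proof -
  let ?N = "n + length X + 1"
  interpret ram_tree n E "2 * n - 1" "edge_tail es" "edge_head es" "count_list X" k ?N "2 * k + 6"
    by (rule ram_tree_input[OF tree es X])
  have len: "length (input_words n es X) = n + 1 + 2 * length es"
    by (simp add: input_words_flat length_flat_edges)
  have M: "2 * n - 1 = 2 * length es + 1" by (rule coded_tree_edges(2)[OF tree es])
  have "?N ^ 1 \<le> ?N ^ (2 * k + 6)" by (rule power_increasing) auto
  then have grow: "x < ?N \<Longrightarrow> x < ?N ^ (2 * k + 6)" for x by simp
  have "mem s i < ?N" for i
    using input_words_less[OF tree es] by (auto simp: s_def initial_state_def)
  moreover have "reg s i < ?N" for i by (simp add: s_def initial_state_def)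
  ultimately show "bounded_state (?N ^ (2 * k + 6)) s" using grow by (simp add: bounded_state_def)
  have "mem s 0 = n" by (simp add: s_def initial_state_def input_words_flat)
  moreover have "mem s (1 + x) = count_list X x" if "x < n" for x
    using that by (simp add: s_def initial_state_def input_words_flat nth_append)
  moreover have "mem s (n + e) = edge_tail es e" if "e \<in> {1..<2 * n - 1}" for e
    using that M len
    by (cases e) (auto simp: s_def initial_state_def input_words_flat nth_append edge_tail_def)
  moreover have "mem s i = 0" if "i \<ge> 3 * n" for i
  proof -
    \<comment> \<open>The input fills \<open>n + 1 + 2 * (n - 1) = 3 * n - 1\<close> cells, so the
      arrays starting at \<open>3 * n\<close> are initially zero.\<close>
    have "\<not> i < length (input_words n es X)" using that M len n by simp
    then show ?thesis by (simp add: s_def initial_state_def)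
  qed
  ultimately show "loaded s"
    unfolding loaded_def weights_ok_def by (intro conjI allI ballI impI) simp_all
qed

theorem theorem1:
  fixes t :: nat
  assumes "t \<ge> 1"
  shows "\<exists>(P :: com) (d :: nat) (time :: nat \<Rightarrow> nat).
    (\<lambda>n. real (time n)) \<in> O(\<lambda>n. real n ^ (2 * t + 1)) \<and>
    (\<forall>(n :: nat) (E :: nat set set) (es :: (nat \<times> nat) list) (X :: nat list).
       unrooted_tree {..<n} E \<and> edge_list E es \<and> set X \<subseteq> {..<n} \<longrightarrow>
       (\<exists>k s T.
          exec (word_bound d n X) P (initial_state (input_words n es X)) k s \<and>
          k \<le> time n \<and>
          stt E {..<n} T \<and> parent_array (mem s) T \<and>
          real (cost T X) \<le> (1 + 1 / real t) * real (opt {..<n} E X)))"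
proof (rule exI[of _ "main_com (2 * t)"], rule exI[of _ "com_bits (2 * (2 * t) + 6) (main_com (2 * t))"],
    rule exI[of _ "\<lambda>n. ram_tree.time_factor (2 * t) * n ^ (2 * t + 1)"], intro conjI allI impI)
  \<comment> \<open>\<open>2 * t\<close> is the boundary size that cutting respects. The word
    exponent and the factor in the time bound are built from \<open>t\<close> alone, hence uniform
    in all inputs.\<close>
  let ?k = "2 * t"
  let ?P = "main_com ?k" and ?p = "2 * ?k + 6"
  let ?time = "\<lambda>n. ram_tree.time_factor ?k * n ^ (?k + 1)"
  show "(\<lambda>n. real (?time n)) \<in> O(\<lambda>n. real n ^ (2 * t + 1))" by simp
  fix n E es X
  assume asm: "unrooted_tree {..<n} E \<and> edge_list E es \<and> set X \<subseteq> {..<n}"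
  then have tree: "unrooted_tree {..<n} E" and es: "edge_list E es" and X: "set X \<subseteq> {..<n}" by auto
  let ?N = "n + length X + 1"
  interpret ram_tree n E "2 * n - 1" "edge_tail es" "edge_head es" "count_list X" ?k ?N ?p
    by (rule ram_tree_input[OF tree es X])
  have cut: "searchable ?k {..<n} (\<lambda>x. D x + D x div t)"
    if "searchable (card edge_pairs) {..<n} D" for D
    using searchable_cut[OF that subset_refl subset_refl connected_V, of t 0] n assms
    by (simp add: boundary_V lessThan_empty_iff)
  \<comment> \<open>Some search has depth at most \<open>n\<close>; its cut version provides the
    bound \<open>n + n div t \<le> 2 * n\<close> that keeps the optimum below the sentinel.\<close>
  have "searchable ?k {..<n} (\<lambda>_. n + n div t)"
    using cut[OF searchable_exists[OF subset_refl]] n by (simp add: lessThan_empty_iff)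
  then have "triple ?N ?p loaded ?P main_time solution"
    by (rule triple_main) simp
  from tripleE[OF this initial_loaded(2,1)[OF tree es X] order_refl]
  obtain j s where run: "exec (?N ^ com_bits ?p ?P) ?P (initial_state (input_words n es X)) j s"
    "j \<le> main_time" "solution s" by metis
  obtain T where T: "stt E {..<n} T" "parent_array (mem s) T"
    and best: "\<And>D. searchable ?k {..<n} D \<Longrightarrow>
      (\<Sum>x<n. count_list X x * depth T x) \<le> (\<Sum>x<n. count_list X x * D x)"
    using run(3) by (auto simp: solution_def)
  have "\<exists>T'. stt E {..<n} T' \<and> opt {..<n} E X = cost T' X"
    unfolding opt_def by (rule LeastI[of _ "cost T X"]) (use T in blast)
  then obtain T' where T': "stt E {..<n} T'" "opt {..<n} E X = cost T' X" by blast
  have cost: "cost U X = (\<Sum>x<n. count_list X x * depth U x)" for U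
    by (rule cost_sum[OF _ X]) simp
  \<comment> \<open>The computed tree competes with the cut version of an optimal tree
    \<open>T'\<close>, whose depth at \<open>x\<close> is bounded by
    \<open>depth T' x + depth T' x div t\<close>.\<close>
  have "real (cost T X) \<le> real (\<Sum>x<n. count_list X x * (depth T' x + depth T' x div t))"
    unfolding cost of_nat_le_iff by (rule best[OF cut[OF stt_searchable[OF T'(1)]]])
  also have "\<dots> \<le> (\<Sum>x<n. (1 + 1 / real t) * (real (count_list X x) * real (depth T' x)))"
    unfolding of_nat_sum
  proof (rule sum_mono)
    fix x
    have "real (depth T' x div t) \<le> real (depth T' x) / real t" by (rule of_nat_div_le_of_nat)
    then have "real (count_list X x) * (real (depth T' x) + real (depth T' x div t)) \<le>
        real (count_list X x) * (real (depth T' x) + real (depth T' x) / real t)"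
      by (intro mult_left_mono add_left_mono) auto
    then show "real (count_list X x * (depth T' x + depth T' x div t)) \<le>
        (1 + 1 / real t) * (real (count_list X x) * real (depth T' x))"
      by (simp add: algebra_simps)
  qed
  also have "\<dots> = (1 + 1 / real t) * real (opt {..<n} E X)"
    unfolding T'(2) cost by (simp add: sum_distrib_left)
  finally have "real (cost T X) \<le> (1 + 1 / real t) * real (opt {..<n} E X)" .
  moreover have "j \<le> ?time n" using run(2) main_time_le assms by simp
  ultimately show "\<exists>k s T. exec (word_bound (com_bits ?p ?P) n X) ?P (initial_state (input_words n es X)) k s \<and>
      k \<le> ?time n \<and> stt E {..<n} T \<and> parent_array (mem s) T \<and>
      real (cost T X) \<le> (1 + 1 / real t) * real (opt {..<n} E X)"
    using run(1) T unfolding word_bound_def by blast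
qed

end
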